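(* Let $\mathcal{P}$ be a hereditary property of tournaments. Then either (a) $|\mathcal{P}_n| = \Theta(n^k)$ for some $k \in \mathbb{N}$, or (b) $|\mathcal{P}_n| \geq F^*_n$ for every $n \in \mathbb{N}$ with $n \neq 4$. Moreover, this lower bound is best possible, and $\mathcal{T}$ is the unique hereditary property of tournaments $\mathcal{P}$ with $|\mathcal{P}_n| = F^*_n$ for every $n \in \mathbb{N}$.
   Context: A tournament is a complete graph with an orientation on each edge; tournaments are considered unlabelled (up to isomorphism). A property of tournaments is a collection of unlabelled tournaments closed under isomorphism; it is hereditary if it is closed under taking induced sub-tournaments. For a property $\mathcal{P}$, $\mathcal{P}_n = \{T \in \mathcal{P} : |V(T)| = n\}$, and $n \mapsto |\mathcal{P}_n|$ is the speed of $\mathcal{P}$. The sequence $F^*_n$ is defined by $F^*_0 = F^*_1 = F^*_2 = 1$ and $F^*_n = F^*_{n-1} + F^*_{n-3}$ for $n \geq 3$. For $m \in \mathbb{N}$ and $a_1, \ldots, a_m \in \{1,3\}$, let $T(a_1,\ldots,a_m)$ be the tournament with vertex set $\{x(i,j) : i \in [m], j \in [a_i]\}$ in which $x(i,j) \to x(k,\ell)$ if $i < k$, or if $i = k$ and $\ell - j \equiv 1 \pmod 3$ (so it is an ordered sequence of blocks, each a single vertex or a cyclic triangle, with every vertex of an earlier block dominating every vertex of a later block). Let $\mathcal{T} = \{T(a_1,\ldots,a_m) : m \in \mathbb{N}, a_1,\ldots,a_m \in \{1,3\}\}$ (closed under isomorphism).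
   Formalization: The dichotomy gets a third alternative, that P_n is empty for all large n, because a hereditary property with only finitely many unlabelled tournaments (e.g. those on at most one vertex) satisfies neither (a) nor (b). *)

theory Defs
  imports "Graph_Theory.Digraph_Isomorphism" "HOL-Library.Landau_Symbols"
begin

text \<open>
  A tournament is a finite loop-free digraph without parallel arcs in which every two distinct
  vertices are joined by exactly one arc.  The tournament without vertices is allowed; this matches
  the conventions \<open>Fstar 0 = 1\<close> and \<open>m = 0\<close> below.
\<close>

locale tournament = pair_digraph T for T :: "'a pair_pre_digraph" +
  assumes ex1_orientation:
    "\<lbrakk>u \<in> pverts T; v \<in> pverts T; u \<noteq> v\<rbrakk> \<Longrightarrow> (u, v) \<in> parcs T \<longleftrightarrow> (v, u) \<notin> parcs T"

abbreviation iso :: "'a pair_pre_digraph \<Rightarrow> 'b pair_pre_digraph \<Rightarrow> bool"  (infix \<open>\<cong>\<^sub>T\<close> 50)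
  where "S \<cong>\<^sub>T T \<equiv> digraph_iso (with_proj S) (with_proj T)"

text \<open>
  On digraphs whose arcs are pairs, the library's notion, which also maps the arcs and the
  projections, is the usual one.
\<close>

lemma iso_iff:
  "S \<cong>\<^sub>T T \<longleftrightarrow> pair_wf_digraph S \<and>
    (\<exists>h. inj_on h (pverts S) \<and> pverts T = h ` pverts S \<and> parcs T = map_prod h h ` parcs S)"
    (is "?L \<longleftrightarrow> ?R")
proof
  assume ?L
  then obtain f where f: "pre_digraph.digraph_isomorphism (with_proj S) f"
    and T: "with_proj T = app_iso f (with_proj S)"
    by (auto simp: digraph_iso_def)
  define h where "h = iso_verts f"
  from arg_cong[OF T, of verts] arg_cong[OF T, of arcs] arg_cong[OF T, of tail]
    arg_cong[OF T, of head]
  have *: "pverts T = h ` pverts S" "parcs T = iso_arcs f ` parcs S"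
    "iso_tail f = fst" "iso_head f = snd"
    by (simp_all add: h_def)
  have "iso_arcs f e = map_prod h h e" if "e \<in> parcs S" for e
    using f that * by (cases e) (auto simp: pre_digraph.digraph_isomorphism_def h_def prod_eq_iff)
  then have "iso_arcs f ` parcs S = map_prod h h ` parcs S"
    by (rule image_cong[OF refl])
  with f * show ?R
    by (auto simp: pre_digraph.digraph_isomorphism_def wf_digraph_wp_iff h_def)
next
  assume ?R
  then obtain h where wf: "pair_wf_digraph S" and inj: "inj_on h (pverts S)"
    and T: "pverts T = h ` pverts S" "parcs T = map_prod h h ` parcs S"
    by blast
  let ?f = "\<lparr>iso_verts = h, iso_arcs = map_prod h h, iso_head = snd, iso_tail = fst\<rparr>"
  have "parcs S \<subseteq> pverts S \<times> pverts S"
    using wf by (auto simp: pair_wf_digraph_def)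
  then have "inj_on (map_prod h h) (parcs S)"
    using map_prod_inj_on[OF inj inj] inj_on_subset by blast
  then have "pre_digraph.digraph_isomorphism (with_proj S) ?f"
    using wf inj by (simp add: pre_digraph.digraph_isomorphism_def wf_digraph_wp_iff)
  moreover have "with_proj T = app_iso ?f (with_proj S)"
    using T by (simp add: with_proj_def app_iso_def)
  ultimately show ?L
    unfolding digraph_iso_def by blast
qed

text \<open>
  Every finite tournament is isomorphic to one with vertices in \<^typ>\<open>nat\<close>, so a property of
  tournaments is an isomorphism-closed set of tournaments with vertices in \<^typ>\<open>nat\<close>.
\<close>

definition tournament_property :: "nat pair_pre_digraph set \<Rightarrow> bool" where
  "tournament_property P \<longleftrightarrow>
    (\<forall>T \<in> P. tournament T) \<and> (\<forall>S \<in> P. \<forall>T. S \<cong>\<^sub>T T \<longrightarrow> T \<in> P)"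

definition hereditary :: "nat pair_pre_digraph set \<Rightarrow> bool" where
  "hereditary P \<longleftrightarrow> tournament_property P \<and>
    (\<forall>T \<in> P. \<forall>S. induced_subgraph (with_proj S) (with_proj T) \<longrightarrow> S \<in> P)"

text \<open>Unlabelled tournaments are isomorphism classes.\<close>

definition level :: "nat pair_pre_digraph set \<Rightarrow> nat \<Rightarrow> nat pair_pre_digraph set set" where
  "level P n = {T \<in> P. card (pverts T) = n} // {(S, T). S \<cong>\<^sub>T T}"

definition speed :: "nat pair_pre_digraph set \<Rightarrow> nat \<Rightarrow> nat" where
  "speed P n = card (level P n)"

fun Fstar :: "nat \<Rightarrow> nat" where
  "Fstar 0 = 1"
| "Fstar (Suc 0) = 1"
| "Fstar (Suc (Suc 0)) = 1"
| "Fstar (Suc (Suc (Suc n))) = Fstar (Suc (Suc n)) + Fstar n"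

text \<open>The vertex \<open>x(i + 1, j + 1)\<close> is the pair \<open>(i, j)\<close>.\<close>

definition block_tournament :: "nat list \<Rightarrow> (nat \<times> nat) pair_pre_digraph" where
  "block_tournament as =
    (let V = {(i, j). i < length as \<and> j < as ! i}
     in \<lparr> pverts = V,
          parcs = {((i, j), (k, l)). (i, j) \<in> V \<and> (k, l) \<in> V \<and>
                     (i < k \<or> i = k \<and> (int l - int j) mod 3 = 1)} \<rparr>)"

definition block_tournaments :: "nat pair_pre_digraph set" where
  "block_tournaments = {T. \<exists>as. set as \<subseteq> {1, 3} \<and> block_tournament as \<cong>\<^sub>T T}"

end

theory Submission
  imports Defs "HOL-Library.Ramsey"
begin

text \<open>
  Call a set of vertices a transitive module if it induces a transitive tournament and no outside
  vertex distinguishes two of its elements. Overlapping transitive modules have a transitive union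
  that is again a module, so the maximal ones, the blocks of the tournament, partition the vertices.

  If the number of blocks is bounded on \<open>P\<close>, then a tournament in \<open>P\<close> is given by a bounded
  tournament and the block sizes. The speed is then of order \<open>n\<^bsup>d - 1\<^esup>\<close>, where \<open>d\<close> is the largest number
  of blocks that can be arbitrarily large simultaneously.

  If the number of blocks is unbounded, take a long transitive sequence of vertices from distinct
  blocks. Between two vertices of distinct blocks there is an obstruction that contains a cyclic
  triangle. By Ramsey's theorem the obstructions can be assumed to be arranged uniformly. Either all
  triangles follow one another, so that \<open>P\<close> contains all block tournaments, or \<open>P\<close> contains tournaments
  built from words of length \<open>n - 1\<close> in two letters, such that the word can be recovered from the
  tournament together with a root vertex. Since there are at most \<open>n\<close> choices for the root, this
  gives \<open>2\<^bsup>n - 1\<^esup> \<le> n * speed P n\<close>, which implies the required bound for \<open>n \<noteq> 4\<close> and excludes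
  \<open>speed P 7 = Fstar 7 = 9\<close>.
\<close>

subsection \<open>Tournaments and isomorphism classes\<close>

text \<open>The obstacle is that Ramsey's theorem controls only arcs between different indices; the
  arc between the \<open>i\<close>-th terms of two sequences stays free. Hence two kinds of words:
  \<open>half_graph\<close>, read off outside the diagonal, and \<open>matching\<close>, where all
  arcs outside the diagonal run the same way and the diagonal carries the information. Once the root
  is fixed, the arcs reveal letters and order, so the root is the only ambiguity. Vertices of the
  transitive sequence are grouped into pairs because a single vertex that distinguishes many pairs
  already yields all words. The third vertex of a cyclic triangle may lie anywhere, so it is placed
  only after the other two are known to form a chain of pairs. The exception \<open>n = 4\<close> is
  numerical: \<open>8 \<le> 4 * s\<close> yields only \<open>s \<ge> 2\<close>, while
  \<open>Fstar 4 = 3\<close>. At \<open>n = 7\<close> the bound \<open>64 \<le> 7 * s\<close>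
  excludes 9 by a margin of one. Eventual emptiness is a separate alternative because a property of
  bounded tournaments has speed eventually 0, which is not of order \<open>n ^ k\<close>.\<close>

lemma tournamentI:
  assumes "finite (pverts T)" "parcs T \<subseteq> pverts T \<times> pverts T"
    and "\<And>u v. (u, v) \<in> parcs T \<Longrightarrow> (v, u) \<notin> parcs T"
    and "\<And>u v. u \<in> pverts T \<Longrightarrow> v \<in> pverts T \<Longrightarrow> u \<noteq> v \<Longrightarrow> (u, v) \<in> parcs T \<or> (v, u) \<in> parcs T"
  shows "tournament T"
proof -
  have "finite (parcs T)"
    using assms(1,2) by (meson finite_SigmaI finite_subset)
  moreover have "(u, u) \<notin> parcs T" for u
    using assms(3) by blast
  ultimately show ?thesis
    using assms(1,2) by unfold_locales (fastforce, fastforce, blast, blast, force, metis assms(3,4))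
qed

context
  fixes T :: "'a pair_pre_digraph"
  assumes T: "tournament T"
begin

interpretation tournament T by (rule T)

lemma tournament_finite: "finite (pverts T)"
  by (rule pair_finite_verts)

lemma tournament_verts: "(u, v) \<in> parcs T \<Longrightarrow> u \<in> pverts T \<and> v \<in> pverts T"
  using wellformed' by blast

lemma tournament_sub: "parcs T \<subseteq> pverts T \<times> pverts T"
  using tournament_verts by auto

lemma tournament_irrefl: "(u, u) \<notin> parcs T"
  using pair_no_loops by fastforce

lemma tournament_asym: "(u, v) \<in> parcs T \<Longrightarrow> (v, u) \<notin> parcs T"
  using ex1_orientation tournament_verts tournament_irrefl by metis

lemma tournament_total:
  "u \<in> pverts T \<Longrightarrow> v \<in> pverts T \<Longrightarrow> u \<noteq> v \<Longrightarrow> (u, v) \<in> parcs T \<or> (v, u) \<in> parcs T"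
  using ex1_orientation by blast

lemma tournament_pair_wf: "pair_wf_digraph T"
  by (rule pair_wf_digraph_axioms)

end

text \<open>Preserving arcs suffices: totality and the absence of loops make such a map between
  tournaments injective, and asymmetry makes it reflect arcs. It is thus an isomorphism onto an
  induced sub-tournament.\<close>

definition embeds :: "'a pair_pre_digraph \<Rightarrow> 'b pair_pre_digraph \<Rightarrow> ('a \<Rightarrow> 'b) \<Rightarrow> bool" where
  "embeds S T g \<longleftrightarrow> g ` pverts S \<subseteq> pverts T \<and>
     (\<forall>u v. (u, v) \<in> parcs S \<longrightarrow> (g u, g v) \<in> parcs T)"

lemma embeds_inj_on:
  assumes "tournament S" "tournament T" "embeds S T g"
  shows "inj_on g (pverts S)"
proof (rule inj_onI, rule ccontr)
  fix x y assume *: "x \<in> pverts S" "y \<in> pverts S" "g x = g y" "x \<noteq> y"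
  then have "(x, y) \<in> parcs S \<or> (y, x) \<in> parcs S"
    using tournament_total[OF assms(1)] by blast
  then have "(g x, g x) \<in> parcs T"
    using assms(3) *(3) unfolding embeds_def by metis
  then show False
    using tournament_irrefl[OF assms(2)] by blast
qed

lemma embeds_iff:
  assumes "tournament S" "tournament T" "embeds S T g" "u \<in> pverts S" "v \<in> pverts S"
  shows "(g u, g v) \<in> parcs T \<longleftrightarrow> (u, v) \<in> parcs S"
  using tournament_total[OF assms(1,4,5)] tournament_irrefl[OF assms(2)] tournament_asym[OF assms(2)]
    assms(3) unfolding embeds_def by metis

lemma embeds_trans: "embeds S T g \<Longrightarrow> embeds T U h \<Longrightarrow> embeds S U (h \<circ> g)"
  by (fastforce simp: embeds_def)

lemma iso_tournamentI:
  assumes "tournament S" "tournament T" "embeds S T g" "pverts T = g ` pverts S"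
  shows "S \<cong>\<^sub>T T"
proof -
  have "parcs T \<subseteq> map_prod g g ` parcs S"
  proof
    fix e assume e: "e \<in> parcs T"
    then obtain u v where uv: "e = (g u, g v)" "u \<in> pverts S" "v \<in> pverts S"
      using tournament_verts[OF assms(2)] assms(4) by (cases e) blast
    with e embeds_iff[OF assms(1-3)] have "(u, v) \<in> parcs S"
      by simp
    with uv show "e \<in> map_prod g g ` parcs S"
      by force
  qed
  moreover have "map_prod g g ` parcs S \<subseteq> parcs T"
    using assms(3) by (auto simp: embeds_def)
  moreover have "pair_wf_digraph S"
    using assms(1) by (rule tournament_pair_wf)
  ultimately show ?thesis
    unfolding iso_iff using embeds_inj_on[OF assms(1-3)] assms(4) by blast
qed

lemma iso_embedsE:
  assumes "S \<cong>\<^sub>T T"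
  obtains g where "embeds S T g" "pverts T = g ` pverts S" "inj_on g (pverts S)"
  using assms unfolding iso_iff embeds_def by force

lemma iso_tournament:
  assumes "S \<cong>\<^sub>T T" "tournament S"
  shows "tournament T"
proof -
  obtain h where h: "inj_on h (pverts S)" "pverts T = h ` pverts S" "parcs T = map_prod h h ` parcs S"
    using assms(1) by (auto simp: iso_iff)
  have sub: "parcs S \<subseteq> pverts S \<times> pverts S"
    using assms(2) by (rule tournament_sub)
  then have iff: "(h u, h v) \<in> parcs T \<longleftrightarrow> (u, v) \<in> parcs S" if "u \<in> pverts S" "v \<in> pverts S" for u v
    using that by (auto simp: h(3) dest!: inj_onD[OF h(1)])
  have sub': "parcs T \<subseteq> pverts T \<times> pverts T"
    using h sub by auto
  show ?thesis
  proof (rule tournamentI)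
    fix u v
    assume "(u, v) \<in> parcs T"
    with sub' h(2) obtain x y where "u = h x" "v = h y" "x \<in> pverts S" "y \<in> pverts S"
      by auto
    with iff \<open>(u, v) \<in> parcs T\<close> show "(v, u) \<notin> parcs T"
      using tournament_asym[OF assms(2)] by simp
  next
    fix u v
    assume "u \<in> pverts T" "v \<in> pverts T" "u \<noteq> v"
    with h(2) obtain x y where "u = h x" "v = h y" "x \<in> pverts S" "y \<in> pverts S" "x \<noteq> y"
      by auto
    with iff show "(u, v) \<in> parcs T \<or> (v, u) \<in> parcs T"
      using tournament_total[OF assms(2)] by simp
  qed (use sub' h(2) tournament_finite[OF assms(2)] in auto)
qed

lemma iso_refl: "tournament S \<Longrightarrow> S \<cong>\<^sub>T S"
  by (rule iso_tournamentI[where g = id]) (auto simp: embeds_def)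

lemma embeds_inv_into:
  assumes "tournament S" "tournament T" "embeds S T g" "pverts T = g ` pverts S"
  shows "embeds T S (inv_into (pverts S) g)"
  unfolding embeds_def
proof (intro conjI allI impI)
  let ?h = "inv_into (pverts S) g"
  have hg: "?h (g u) = u" if "u \<in> pverts S" for u
    using embeds_inj_on[OF assms(1-3)] that by simp
  show "?h ` pverts T \<subseteq> pverts S"
    using hg assms(4) by auto
  fix u v assume uv: "(u, v) \<in> parcs T"
  with assms(4) obtain x y where "u = g x" "v = g y" "x \<in> pverts S" "y \<in> pverts S"
    using tournament_verts[OF assms(2)] by blast
  with uv embeds_iff[OF assms(1-3)] hg show "(?h u, ?h v) \<in> parcs S"
    by simp
qed

lemma iso_sym:
  assumes "S \<cong>\<^sub>T T" "tournament S"
  shows "T \<cong>\<^sub>T S"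
proof -
  have T: "tournament T"
    by (rule iso_tournament) fact+
  obtain g where g: "embeds S T g" "pverts T = g ` pverts S" "inj_on g (pverts S)"
    using assms(1) by (rule iso_embedsE)
  then have "embeds T S (inv_into (pverts S) g)" "pverts S = inv_into (pverts S) g ` pverts T"
    using embeds_inv_into[OF assms(2) T] by (auto simp: inv_into_image_cancel)
  then show ?thesis
    using T assms(2) iso_tournamentI by blast
qed

lemma iso_trans:
  assumes "S \<cong>\<^sub>T T" "T \<cong>\<^sub>T U" "tournament S"
  shows "S \<cong>\<^sub>T U"
proof -
  have T: "tournament T" "tournament U"
    using assms iso_tournament[OF assms(1,3)] iso_tournament[OF assms(2)] by blast+
  obtain g h where "embeds S T g" "pverts T = g ` pverts S" "embeds T U h" "pverts U = h ` pverts T"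
    using assms(1,2) by (meson iso_embedsE)
  then show ?thesis
    using iso_tournamentI[of S U "h \<circ> g"] embeds_trans T assms(3) by (metis image_comp)
qed

lemma hereditary_tournament: "hereditary P \<Longrightarrow> T \<in> P \<Longrightarrow> tournament T"
  unfolding hereditary_def tournament_property_def by blast

lemma hereditary_iso: "hereditary P \<Longrightarrow> S \<in> P \<Longrightarrow> S \<cong>\<^sub>T T \<Longrightarrow> T \<in> P"
  unfolding hereditary_def tournament_property_def by blast

abbreviation restrict_tournament :: "'a pair_pre_digraph \<Rightarrow> 'a set \<Rightarrow> 'a pair_pre_digraph"
    (infixl \<open>\<restriction>\<^sub>T\<close> 100) where
  "T \<restriction>\<^sub>T U \<equiv> \<lparr>pverts = U, parcs = parcs T \<inter> U \<times> U\<rparr>"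

lemma tournament_restrict: "tournament T \<Longrightarrow> U \<subseteq> pverts T \<Longrightarrow> tournament (T \<restriction>\<^sub>T U)"
  by (rule tournamentI) (auto dest: tournament_asym tournament_total finite_subset tournament_finite)

lemma hereditary_restrict:
  assumes "hereditary P" "T \<in> P" "U \<subseteq> pverts T"
  shows "T \<restriction>\<^sub>T U \<in> P"
proof -
  have T: "tournament T"
    using assms hereditary_tournament by blast
  then have "tournament (T \<restriction>\<^sub>T U)"
    using assms(3) tournament_restrict by blast
  then have "induced_subgraph (with_proj (T \<restriction>\<^sub>T U)) (with_proj T)"
    using tournament_pair_wf[OF T] tournament_pair_wf[OF \<open>tournament (T \<restriction>\<^sub>T U)\<close>] assms(3)
    by (auto simp: induced_subgraph_def subgraph_def compatible_def wf_digraph_wp_iff)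
  then show ?thesis
    using assms(1,2) unfolding hereditary_def by blast
qed

text \<open>The image of \<open>g\<close> induces a member of \<open>P\<close>, and \<open>S\<close>
  is isomorphic to it. In this form heredity turns an assignment of vertices into
  membership.\<close>

lemma hereditary_embeds:
  assumes "hereditary P" "T \<in> P" "tournament S" "embeds S T g"
  shows "S \<in> P"
proof -
  let ?U = "g ` pverts S"
  have T: "tournament T"
    using assms hereditary_tournament by blast
  have U: "?U \<subseteq> pverts T"
    using assms(4) by (simp add: embeds_def)
  have "embeds S (T \<restriction>\<^sub>T ?U) g"
    using assms(4) tournament_verts[OF assms(3)] by (auto simp: embeds_def)
  then have "S \<cong>\<^sub>T T \<restriction>\<^sub>T ?U"
    using iso_tournamentI assms(3) tournament_restrict[OF T U] by fastforce
  then have "T \<restriction>\<^sub>T ?U \<cong>\<^sub>T S"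
    using iso_sym assms(3) by blast
  then show ?thesis
    using hereditary_iso hereditary_restrict assms(1,2) U by blast
qed

lemma ex_iso_nat:
  assumes "tournament T" "finite V" "card V = card (pverts T)"
  shows "\<exists>S. T \<cong>\<^sub>T S \<and> pverts S = V"
proof -
  obtain h where h: "bij_betw h (pverts T) V"
    using assms finite_same_card_bij[of "pverts T" V] tournament_finite by metis
  then have "T \<cong>\<^sub>T \<lparr>pverts = V, parcs = map_prod h h ` parcs T\<rparr>"
    using tournament_pair_wf[OF assms(1)] by (auto simp: iso_iff bij_betw_def)
  then show ?thesis
    by auto
qed

subsection \<open>Counting isomorphism classes\<close>

definition iso_class :: "nat pair_pre_digraph \<Rightarrow> nat pair_pre_digraph set" where
  "iso_class S = {T. S \<cong>\<^sub>T T}"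

lemma iso_class_eq_iff:
  assumes "hereditary P" "S \<in> P" "T \<in> P"
  shows "iso_class S = iso_class T \<longleftrightarrow> S \<cong>\<^sub>T T"
proof
  assume "iso_class S = iso_class T"
  moreover have "T \<cong>\<^sub>T T"
    using assms hereditary_tournament iso_refl by blast
  ultimately show "S \<cong>\<^sub>T T"
    unfolding iso_class_def by blast
next
  assume ST: "S \<cong>\<^sub>T T"
  have t: "tournament S" "tournament T"
    using assms hereditary_tournament by blast+
  show "iso_class S = iso_class T"
    unfolding iso_class_def
    using iso_trans[OF ST _ t(1)] iso_trans[OF iso_sym[OF ST t(1)] _ t(2)] by blast
qed

lemma level_eq_image:
  "level P n = iso_class ` {T \<in> P. card (pverts T) = n}"
  by (auto simp: level_def quotient_def iso_class_def)

text \<open>Every class has a representative on \<open>{..<n}\<close>, which carries only finitely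
  many arc sets. Lower bounds on \<open>speed\<close> depend on this, since \<open>card\<close> is 0
  on infinite sets.\<close>

lemma finite_level:
  assumes "hereditary P"
  shows "finite (level P n)"
proof -
  let ?A = "{S :: nat pair_pre_digraph. pverts S = {..<n} \<and> parcs S \<subseteq> {..<n} \<times> {..<n}}"
  have "?A \<subseteq> (\<lambda>A. \<lparr>pverts = {..<n}, parcs = A\<rparr>) ` Pow ({..<n} \<times> {..<n})"
  proof
    fix S :: "nat pair_pre_digraph"
    assume "S \<in> ?A"
    then show "S \<in> (\<lambda>A. \<lparr>pverts = {..<n}, parcs = A\<rparr>) ` Pow ({..<n} \<times> {..<n})"
      by (intro image_eqI[where x = "parcs S"]) auto
  qed
  then have "finite ?A"
    by (rule finite_subset) simp
  moreover have "level P n \<subseteq> iso_class ` ?A"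
    unfolding level_eq_image
  proof safe
    fix T assume T: "T \<in> P" "n = card (pverts T)"
    then have t: "tournament T"
      using assms hereditary_tournament by blast
    then obtain S where S: "T \<cong>\<^sub>T S" "pverts S = {..<card (pverts T)}"
      using ex_iso_nat[of T "{..<card (pverts T)}"] by auto
    then have "tournament S" "S \<in> P"
      using t T iso_tournament assms hereditary_iso by blast+
    with S T iso_class_eq_iff[OF assms \<open>T \<in> P\<close>] show "iso_class T \<in>
      iso_class ` {S. pverts S = {..<card (pverts T)} \<and>
         parcs S \<subseteq> {..<card (pverts T)} \<times> {..<card (pverts T)}}"
      using tournament_sub[OF \<open>tournament S\<close>] by (intro image_eqI[where x = S]) auto
  qed
  ultimately show ?thesis
    by (meson finite_imageI finite_subset)
qed

text \<open>Each isomorphism class receives at most \<open>k\<close> elements of \<open>X\<close>.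
  Rooted words use \<open>k = n\<close>, the number of possible roots; complete invariants use
  \<open>k = 1\<close>.\<close>

lemma card_le_mult_speed:
  assumes "hereditary P" "finite X" "\<And>x. x \<in> X \<Longrightarrow> f x \<in> P \<and> card (pverts (f x)) = n"
    and "\<And>x. x \<in> X \<Longrightarrow> card {y \<in> X. f x \<cong>\<^sub>T f y} \<le> k"
  shows "card X \<le> k * speed P n"
proof -
  define c where "c x = iso_class (f x)" for x
  have cX: "c ` X \<subseteq> level P n"
    using assms(3) by (auto simp: c_def level_eq_image)
  have "card X = (\<Sum>C\<in>c ` X. card {y \<in> X. c y = C})"
    using sum.image_gen[OF assms(2), of "\<lambda>_. 1::nat" c] by simp
  also have "\<dots> \<le> (\<Sum>C\<in>c ` X. k)"
  proof (rule sum_mono)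
    fix C assume "C \<in> c ` X"
    then obtain x where x: "x \<in> X" "C = c x"
      by auto
    then have "{y \<in> X. c y = C} = {y \<in> X. f x \<cong>\<^sub>T f y}"
      using iso_class_eq_iff[OF assms(1)] assms(3) unfolding c_def by blast
    then show "card {y \<in> X. c y = C} \<le> k"
      using assms(4) x by simp
  qed
  also have "\<dots> \<le> k * speed P n"
    using cX finite_level[OF assms(1)] by (simp add: card_mono speed_def)
  finally show ?thesis .
qed

lemma card_le_speed:
  assumes "hereditary P" "finite X" "\<And>x. x \<in> X \<Longrightarrow> f x \<in> P \<and> card (pverts (f x)) = n"
    and "\<And>x y. x \<in> X \<Longrightarrow> y \<in> X \<Longrightarrow> f x \<cong>\<^sub>T f y \<Longrightarrow> x = y"
  shows "card X \<le> speed P n"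
proof -
  have "card {y \<in> X. f x \<cong>\<^sub>T f y} \<le> 1" if "x \<in> X" for x
  proof -
    have "{y \<in> X. f x \<cong>\<^sub>T f y} \<subseteq> {x}"
      using assms(4) that by blast
    then show ?thesis
      using card_mono[of "{x}"] by fastforce
  qed
  from card_le_mult_speed[OF assms(1-3) this] show ?thesis
    by simp
qed

text \<open>\<open>R x T\<close> reads as: \<open>x\<close> describes \<open>T\<close>. A
  description fits at most one class, so choosing any member that it describes covers all
  classes.\<close>

lemma speed_le_card:
  assumes "hereditary P" "finite X"
    and "\<And>T. T \<in> P \<Longrightarrow> card (pverts T) = n \<Longrightarrow> \<exists>x\<in>X. R x T"
    and "\<And>x S T. x \<in> X \<Longrightarrow> S \<in> P \<Longrightarrow> T \<in> P \<Longrightarrow> R x S \<Longrightarrow> R x T \<Longrightarrow> S \<cong>\<^sub>T T"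
  shows "speed P n \<le> card X"
proof -
  have "level P n \<subseteq> (\<lambda>x. iso_class (SOME T. T \<in> P \<and> R x T)) ` X"
  proof
    fix C assume "C \<in> level P n"
    then obtain T where T: "C = iso_class T" "T \<in> P" "card (pverts T) = n"
      by (auto simp: level_eq_image)
    then obtain x where x: "x \<in> X" "R x T"
      using assms(3) by blast
    let ?S = "SOME T. T \<in> P \<and> R x T"
    have "?S \<in> P \<and> R x ?S"
      by (rule someI[where x = T]) (use x T in blast)
    then have "iso_class ?S = iso_class T"
      using iso_class_eq_iff[OF assms(1)] assms(4) x T by blast
    with x T show "C \<in> (\<lambda>x. iso_class (SOME T. T \<in> P \<and> R x T)) ` X"
      by force
  qed
  then show ?thesis
    unfolding speed_def using assms(2) surj_card_le by blast
qed

lemma level_mono: "P \<subseteq> Q \<Longrightarrow> level P n \<subseteq> level Q n"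
  by (auto simp: level_eq_image)

lemma speed_mono: "hereditary Q \<Longrightarrow> P \<subseteq> Q \<Longrightarrow> speed P n \<le> speed Q n"
  by (simp add: speed_def card_mono finite_level level_mono)

text \<open>On each level, nested finite sets of equal cardinality coincide; closure under
  isomorphism leads from classes back to tournaments.\<close>

lemma eq_if_speed_eq:
  assumes "hereditary P" "hereditary Q" "P \<subseteq> Q" "\<And>n. speed P n = speed Q n"
  shows "P = Q"
proof -
  have "T \<in> P" if "T \<in> Q" for T
  proof -
    let ?n = "card (pverts T)"
    have "level P ?n = level Q ?n"
      using card_subset_eq[OF finite_level[OF assms(2)] level_mono[OF assms(3)]] assms(4)
      by (simp add: speed_def)
    then have "iso_class T \<in> level P ?n"
      using that by (auto simp: level_eq_image)
    then obtain S where S: "S \<in> P" "iso_class S = iso_class T"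
      unfolding level_eq_image by auto
    then have "S \<cong>\<^sub>T T"
      using iso_class_eq_iff[OF assms(2)] that assms(3) by blast
    then show "T \<in> P"
      by (rule hereditary_iso[OF assms(1) S(1)])
  qed
  with assms(3) show ?thesis
    by blast
qed

lemma level_empty_iff: "level P n = {} \<longleftrightarrow> (\<forall>T\<in>P. card (pverts T) \<noteq> n)"
  by (auto simp: level_eq_image)

subsection \<open>Rooted words\<close>

text \<open>
  The vertices \<open>1, \<dots>, n - 1\<close> form a word in two letters: a position in \<open>W\<close> is dominated by the
  root \<open>0\<close>, the other positions dominate it.  The arc between two positions depends on their
  letters, their order and whether they are adjacent.
\<close>

definition word_arc :: "(bool \<Rightarrow> bool \<Rightarrow> bool \<Rightarrow> bool) \<Rightarrow> nat set \<Rightarrow> nat \<Rightarrow> nat \<Rightarrow> bool" where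
  "word_arc F W p q \<longleftrightarrow>
     (if p = 0 then q \<noteq> 0 \<and> q \<in> W
      else if q = 0 then p \<notin> W
      else if p < q then F (p \<in> W) (q \<in> W) (q = Suc p)
      else q < p \<and> \<not> F (q \<in> W) (p \<in> W) (p = Suc q))"

definition word_tournament ::
    "(bool \<Rightarrow> bool \<Rightarrow> bool \<Rightarrow> bool) \<Rightarrow> nat set \<Rightarrow> nat \<Rightarrow> nat pair_pre_digraph" where
  "word_tournament F W n =
     \<lparr>pverts = {..<n}, parcs = {(p, q). p < n \<and> q < n \<and> word_arc F W p q}\<rparr>"

text \<open>The flags \<open>a\<close> and \<open>b\<close> orient the chains of positions inside
  and outside \<open>W\<close>. Between different letters, \<open>d\<close> says whether the earlier
  position dominates, so the order alone decides, as in a half graph.\<close>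

definition half_graph :: "bool \<Rightarrow> bool \<Rightarrow> bool \<Rightarrow> bool \<Rightarrow> bool \<Rightarrow> bool \<Rightarrow> bool" where
  "half_graph a b d s t adj = (if s = t then (if s then a else b) else d)"

text \<open>The complement of \<open>W\<close> dominates \<open>W\<close>, except that a position in
  \<open>W\<close> dominates its immediate predecessor outside. These exceptional arcs form the
  matching; \<open>c\<close> orients the chain outside \<open>W\<close>.\<close>

definition matching :: "bool \<Rightarrow> bool \<Rightarrow> bool \<Rightarrow> bool \<Rightarrow> bool" where
  "matching c s t adj = (if s = t then s \<or> c else t \<and> \<not> adj)"

definition word_family :: "(bool \<Rightarrow> bool \<Rightarrow> bool \<Rightarrow> bool) \<Rightarrow> bool" where
  "word_family F \<longleftrightarrow> (\<exists>a b d. F = half_graph a b d) \<or> (\<exists>c. F = matching c)"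

lemma word_tournament_simps [simp]:
  "pverts (word_tournament F W n) = {..<n}"
  "(p, q) \<in> parcs (word_tournament F W n) \<longleftrightarrow> p < n \<and> q < n \<and> word_arc F W p q"
  by (simp_all add: word_tournament_def)

lemma tournament_word_tournament: "tournament (word_tournament F W n)"
  by (rule tournamentI) (auto simp: word_arc_def split: if_splits)

context
  fixes F W W' n and g :: "nat \<Rightarrow> nat"
  assumes F: "word_family F"
    and g: "embeds (word_tournament F W n) (word_tournament F W' n) g" and g0: "g 0 = 0"
begin

lemma word_arc_image: "p < n \<Longrightarrow> q < n \<Longrightarrow> word_arc F W' (g p) (g q) \<longleftrightarrow> word_arc F W p q"
  and image_less: "p < n \<Longrightarrow> g p < n"
  using embeds_iff[OF tournament_word_tournament tournament_word_tournament g, of p q] g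
  by (auto simp: embeds_def)

lemma inj_on_image: "inj_on g {..<n}"
  using embeds_inj_on[OF tournament_word_tournament tournament_word_tournament g] by simp

lemma image_pos: "0 < p \<Longrightarrow> p < n \<Longrightarrow> 0 < g p"
  using inj_onD[OF inj_on_image, of p 0] g0 by fastforce

text \<open>With the root fixed, the letter of a position is the direction of its arc to the
  root.\<close>

lemma letter_image: "0 < p \<Longrightarrow> p < n \<Longrightarrow> g p \<in> W' \<longleftrightarrow> p \<in> W"
  using word_arc_image[of 0 p] image_pos[of p] g0 by (simp add: word_arc_def)

text \<open>Positions with the same letter form a chain, ordered along or against the positions and
  regardless of adjacency. A map that keeps arcs and letters keeps this order.\<close>

lemma less_image_same:
  assumes "0 < p" "p < q" "q < n" "p \<in> W \<longleftrightarrow> q \<in> W"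
  shows "g p < g q"
proof (rule ccontr)
  assume "\<not> g p < g q"
  moreover have "g p \<noteq> g q"
    using inj_onD[OF inj_on_image, of p q] assms by auto
  ultimately have "g q < g p"
    by simp
  moreover have "F s s x = F s s y" for s x y
    using F by (auto simp: word_family_def half_graph_def matching_def)
  ultimately show False
    using assms word_arc_image[of p q] image_pos[of p] image_pos[of q] letter_image[of p] letter_image[of q]
    by (auto simp: word_arc_def)
qed

text \<open>Between different letters the arc reveals the order as well, because the same
  \<open>d\<close> serves both letter patterns.\<close>

lemma less_image_half_graph:
  assumes "F = half_graph a b d" "0 < p" "p < q" "q < n"
  shows "g p < g q"
proof (cases "p \<in> W \<longleftrightarrow> q \<in> W")
  case False
  have "g p \<noteq> g q"
    using inj_onD[OF inj_on_image, of p q] assms by auto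
  then show ?thesis
    using False assms word_arc_image[of p q] image_pos[of p] image_pos[of q]
      letter_image[of p] letter_image[of q]
    by (auto simp: word_arc_def half_graph_def split: if_splits)
qed (use less_image_same assms in blast)

text \<open>
  In a matching, only adjacent positions \<open>i \<notin> W\<close>, \<open>i + 1 \<in> W\<close> are joined by an arc from \<open>W\<close> to its
  complement, and between a position outside \<open>W\<close> and a later one inside there is such a pair.
\<close>

lemma less_image_matching:
  assumes "F = matching c" "0 < p" "p < q" "q < n" "p \<notin> W" "q \<in> W"
  shows "g p < g q"
proof -
  define i where "i = Max {i. i < q \<and> i \<notin> W}"
  have fin: "finite {i. i < q \<and> i \<notin> W}" and p: "p \<in> {i. i < q \<and> i \<notin> W}"
    using assms by auto
  have "i \<in> {i. i < q \<and> i \<notin> W}"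
    unfolding i_def using Max_in[OF fin] p by blast
  then have i: "i < q" "i \<notin> W" "p \<le> i"
    using Max_ge[OF fin p] unfolding i_def by auto
  have "Suc i \<in> W"
  proof (rule ccontr)
    assume "Suc i \<notin> W"
    then have "Suc i < q"
      using i(1) assms(6) by (metis Suc_lessI)
    then have "Suc i \<le> Max {i. i < q \<and> i \<notin> W}"
      using \<open>Suc i \<notin> W\<close> Max_ge[OF fin, of "Suc i"] by simp
    then show False
      by (simp flip: i_def)
  qed
  then have "word_arc F W' (g (Suc i)) (g i)"
    using i assms word_arc_image[of "Suc i" i] by (simp add: word_arc_def matching_def)
  moreover have "g i \<noteq> 0" "g (Suc i) \<noteq> 0" "g i \<notin> W'" "g (Suc i) \<in> W'"
    using i assms \<open>Suc i \<in> W\<close> image_pos[of i] image_pos[of "Suc i"] letter_image[of i] letter_image[of "Suc i"]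
    by auto
  ultimately have "g (Suc i) = Suc (g i)"
    using assms(1) by (auto simp: word_arc_def matching_def split: if_splits)
  moreover have "g p \<le> g i"
    using less_image_same[of p i] i assms by (cases "p = i") auto
  moreover have "g (Suc i) \<le> g q"
    using less_image_same[of "Suc i" q] i assms \<open>Suc i \<in> W\<close> by (cases "Suc i = q") auto
  ultimately show ?thesis
    by simp
qed

end

text \<open>The argument for matchings settles only a position outside \<open>W\<close> followed by
  one inside. In the opposite pattern, an inversion \<open>g q < g p\<close> is of the settled kind
  for the inverse \<open>h\<close>, which would give \<open>q < p\<close>.\<close>

lemma less_image:
  assumes F: "word_family F"
    and g: "embeds (word_tournament F W n) (word_tournament F W' n) g" "g 0 = 0"
    and h: "embeds (word_tournament F W' n) (word_tournament F W n) h" "h 0 = 0"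
    and hg: "\<And>p. p < n \<Longrightarrow> h (g p) = p"
    and pq: "p < q" "q < n"
  shows "g p < g q"
proof (cases "p = 0")
  case True
  then show ?thesis
    using image_pos[OF F g] pq g(2) by simp
next
  case False
  have ne: "g p \<noteq> g q"
    using hg[of p] hg[of q] pq by auto
  consider a b d where "F = half_graph a b d" | c where "F = matching c" "p \<in> W \<longleftrightarrow> q \<in> W"
    | c where "F = matching c" "p \<notin> W" "q \<in> W" | c where "F = matching c" "p \<in> W" "q \<notin> W"
    using F unfolding word_family_def by blast
  then show ?thesis
  proof cases
    case 4
    have "h (g q) < h (g p)" if "g q < g p"
      using less_image_matching[OF F h 4(1) _ that] 4(2,3) letter_image[OF F g, of p] letter_image[OF F g, of q]
        image_less[OF F g, of p] image_pos[OF F g, of q] False pq by simp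
    then have "\<not> g q < g p"
      using hg[of p] hg[of q] pq by auto
    with ne show ?thesis by simp
  next
    case 1
    then show ?thesis
      using less_image_half_graph[OF F g] pq False by blast
  next
    case 2
    then show ?thesis
      using less_image_same[OF F g] pq False by blast
  next
    case 3
    then show ?thesis
      using less_image_matching[OF F g] pq False by blast
  qed
qed

text \<open>An increasing map on \<open>{..<n}\<close> satisfies \<open>p \<le> g p\<close>. Applied
  to \<open>g\<close> and to its inverse, this makes \<open>g\<close> the identity, and letters are
  preserved.\<close>

lemma word_tournament_rigid:
  assumes F: "word_family F"
    and g: "embeds (word_tournament F W n) (word_tournament F W' n) g" "g 0 = 0"
    and surj: "g ` {..<n} = {..<n}" and W: "W \<subseteq> {1..<n}" "W' \<subseteq> {1..<n}"
  shows "W = W'"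
proof (cases "n = 0")
  case False
  define h where "h = inv_into {..<n} g"
  have inj: "inj_on g {..<n}"
    by (rule inj_on_image[OF F g])
  have h: "embeds (word_tournament F W' n) (word_tournament F W n) h"
    using embeds_inv_into[OF tournament_word_tournament tournament_word_tournament g(1)] surj
    by (simp add: h_def)
  have hg: "h (g p) = p" if "p < n" for p
    using that inj by (simp add: h_def)
  have h0: "h 0 = 0"
    using hg[of 0] g(2) False by simp
  have gh: "g (h p) = p" if "p < n" for p
    using that surj by (simp add: h_def f_inv_into_f)
  have le: "p \<le> f p" if "\<And>p q. p < q \<Longrightarrow> q < n \<Longrightarrow> f p < f q" "p < n" for p and f :: "nat \<Rightarrow> nat"
    using that(2)
  proof (induction p)
    case (Suc p)
    then show ?case
      using that(1)[of p "Suc p"] by simp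
  qed simp
  have "p \<le> g p" "p \<le> h p" if "p < n" for p
    using le less_image[OF F g h h0 hg] less_image[OF F h h0 g gh] that by blast+
  then have "g p = p" if "p < n" for p
    using that hg[of p] image_less[OF F g(1,2)] by (metis le_antisym)
  then have *: "p \<in> W \<longleftrightarrow> p \<in> W'" if "p \<in> {1..<n}" for p
    using letter_image[OF F g, of p] that by simp
  have "W = {p \<in> {1..<n}. p \<in> W}" "W' = {p \<in> {1..<n}. p \<in> W'}"
    using W by auto
  then show ?thesis
    using * by blast
qed (use W in auto)

text \<open>Send \<open>W'\<close> to the image of its root under an isomorphism onto the tournament
  of \<open>W\<close>. If two words share this image, one isomorphism followed by the inverse of the
  other fixes the root, and rigidity makes the words equal.\<close>

lemma card_word_class_le:
  assumes F: "word_family F" and n: "n > 0" and W: "W \<subseteq> {1..<n}"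
  shows "card {W'\<in>Pow {1..<n}. word_tournament F W n \<cong>\<^sub>T word_tournament F W' n} \<le> n"
proof -
  let ?T = "\<lambda>W. word_tournament F W n"
  let ?X = "{W'\<in>Pow {1..<n}. ?T W \<cong>\<^sub>T ?T W'}"
  have "\<forall>W'\<in>?X. \<exists>g. embeds (?T W') (?T W) g \<and> g ` {..<n} = {..<n}"
  proof
    fix W' assume "W' \<in> ?X"
    then have "?T W' \<cong>\<^sub>T ?T W"
      using iso_sym tournament_word_tournament by blast
    then show "\<exists>g. embeds (?T W') (?T W) g \<and> g ` {..<n} = {..<n}"
      by (elim iso_embedsE) auto
  qed
  from bchoice[OF this] obtain g
    where "\<forall>W'\<in>?X. embeds (?T W') (?T W) (g W') \<and> g W' ` {..<n} = {..<n}" ..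
  then have g: "embeds (?T W') (?T W) (g W')" "g W' ` {..<n} = {..<n}" if "W' \<in> ?X" for W'
    using that by blast+
  have "inj_on (\<lambda>W'. g W' 0) ?X"
  proof (rule inj_onI)
    fix W1 W2 assume *: "W1 \<in> ?X" "W2 \<in> ?X" "g W1 0 = g W2 0"
    let ?h = "inv_into {..<n} (g W2)"
    note t = tournament_word_tournament
    have h: "embeds (?T W) (?T W2) ?h"
      using embeds_inv_into[OF t t g(1)[OF *(2)]] g(2)[OF *(2)] by simp
    have inj: "inj_on (g W2) {..<n}"
      using embeds_inj_on[OF t t g(1)[OF *(2)]] by simp
    have "embeds (?T W1) (?T W2) (?h \<circ> g W1)"
      by (rule embeds_trans[OF g(1)[OF *(1)] h])
    moreover have "(?h \<circ> g W1) 0 = 0"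
      using inj *(3) n by simp
    moreover have "?h ` {..<n} = {..<n}"
      using inv_into_image_cancel[OF inj subset_refl] g(2)[OF *(2)] by simp
    then have "(?h \<circ> g W1) ` {..<n} = {..<n}"
      using g(2)[OF *(1)] by (metis image_comp)
    ultimately show "W1 = W2"
      using word_tournament_rigid[OF F] *(1,2) by blast
  qed
  moreover have "(\<lambda>W'. g W' 0) ` ?X \<subseteq> {..<n}"
    using g(2) n by blast
  ultimately have "card ?X \<le> card {..<n}"
    by (intro card_inj_on_le) auto
  then show ?thesis
    by simp
qed

lemma power2_le_speed:
  assumes "hereditary P" "word_family F" "\<And>W. word_tournament F W n \<in> P" "n > 0"
  shows "2 ^ (n - 1) \<le> n * speed P n"
  using card_le_mult_speed[OF assms(1), of "Pow {1..<n}" "\<lambda>W. word_tournament F W n" n n]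
    card_word_class_le[OF assms(2,4)] assms(3) by (simp add: card_Pow)

lemma word_tournament_le:
  assumes "hereditary P" "word_tournament F W m \<in> P" "n \<le> m"
  shows "word_tournament F W n \<in> P"
  using assms(1,2) tournament_word_tournament
  by (rule hereditary_embeds[where g = id]) (use assms(3) in \<open>auto simp: embeds_def\<close>)

text \<open>\<open>X i\<close> and \<open>Y i\<close> are the candidates for position
  \<open>i\<close>, inside and outside \<open>W\<close>. Each word uses only one of them, so only
  arcs between different indices are prescribed.\<close>

lemma half_graph_mem:
  assumes P: "hereditary P" "T \<in> P" and r: "r \<in> pverts T"
    and root: "\<And>i. 0 < i \<Longrightarrow> i < n \<Longrightarrow> (r, X i) \<in> parcs T \<and> (Y i, r) \<in> parcs T"
    and X: "\<And>i j. 0 < i \<Longrightarrow> i < j \<Longrightarrow> j < n \<Longrightarrow> (if a then (X i, X j) else (X j, X i)) \<in> parcs T"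
    and Y: "\<And>i j. 0 < i \<Longrightarrow> i < j \<Longrightarrow> j < n \<Longrightarrow> (if b then (Y i, Y j) else (Y j, Y i)) \<in> parcs T"
    and XY: "\<And>i j. 0 < i \<Longrightarrow> i < j \<Longrightarrow> j < n \<Longrightarrow> (if d then (X i, Y j) else (Y j, X i)) \<in> parcs T"
    and YX: "\<And>i j. 0 < i \<Longrightarrow> i < j \<Longrightarrow> j < n \<Longrightarrow> (if d then (Y i, X j) else (X j, Y i)) \<in> parcs T"
  shows "word_tournament (half_graph a b d) W n \<in> P"
proof (rule hereditary_embeds[OF P tournament_word_tournament])
  let ?g = "\<lambda>p. if p = 0 then r else if p \<in> W then X p else Y p"
  have V: "X i \<in> pverts T" "Y i \<in> pverts T" if "0 < i" "i < n" for i
    using root[OF that] tournament_verts[OF hereditary_tournament[OF P]] by blast+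
  show "embeds (word_tournament (half_graph a b d) W n) T ?g"
    unfolding embeds_def
  proof (intro conjI allI impI)
    show "?g ` pverts (word_tournament (half_graph a b d) W n) \<subseteq> pverts T"
      using V r by auto
    fix p q assume "(p, q) \<in> parcs (word_tournament (half_graph a b d) W n)"
    then have pq: "p < n" "q < n" "word_arc (half_graph a b d) W p q"
      by auto
    then consider "p = 0" "q > 0" "q \<in> W" | "p > 0" "q = 0" "p \<notin> W" | "0 < p" "p < q" | "0 < q" "q < p"
      by (auto simp: word_arc_def split: if_splits)
    then show "(?g p, ?g q) \<in> parcs T"
    proof cases
      case 3
      then show ?thesis
        using pq X[of p q] Y[of p q] XY[of p q] YX[of p q]
        by (auto simp: word_arc_def half_graph_def split: if_splits)
    next
      case 4
      then show ?thesis
        using pq X[of q p] Y[of q p] XY[of q p] YX[of q p]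
        by (auto simp: word_arc_def half_graph_def split: if_splits)
    qed (use root pq in auto)
  qed
qed

text \<open>Position \<open>p\<close> outside \<open>W\<close> is represented by
  \<open>Y (Suc p)\<close>. This shift turns the diagonal arc from \<open>X i\<close> to
  \<open>Y i\<close> into an arc between the adjacent positions \<open>i\<close> and
  \<open>i - 1\<close>; it also makes index \<open>n\<close> necessary. The root is
  \<open>X 0\<close>.\<close>

lemma matching_mem:
  assumes P: "hereditary P" "T \<in> P" and n: "n > 0"
    and V: "\<And>i. i \<le> n \<Longrightarrow> X i \<in> pverts T \<and> Y i \<in> pverts T"
    and X: "\<And>i j. i < j \<Longrightarrow> j \<le> n \<Longrightarrow> (X i, X j) \<in> parcs T"
    and Y: "\<And>i j. i < j \<Longrightarrow> j \<le> n \<Longrightarrow> (if c then (Y i, Y j) else (Y j, Y i)) \<in> parcs T"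
    and YX: "\<And>i j. i \<noteq> j \<Longrightarrow> i \<le> n \<Longrightarrow> j \<le> n \<Longrightarrow> (Y i, X j) \<in> parcs T"
    and XY: "\<And>i. 0 < i \<Longrightarrow> i < n \<Longrightarrow> (X i, Y i) \<in> parcs T"
  shows "word_tournament (matching c) W n \<in> P"
proof (rule hereditary_embeds[OF P tournament_word_tournament])
  let ?g = "\<lambda>p. if p = 0 then X 0 else if p \<in> W then X p else Y (Suc p)"
  show "embeds (word_tournament (matching c) W n) T ?g"
    unfolding embeds_def
  proof (intro conjI allI impI)
    show "?g ` pverts (word_tournament (matching c) W n) \<subseteq> pverts T"
      using V n by auto
    fix p q assume "(p, q) \<in> parcs (word_tournament (matching c) W n)"
    then have pq: "p < n" "q < n" "word_arc (matching c) W p q"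
      by auto
    then consider "p = 0" "q > 0" "q \<in> W" | "p > 0" "q = 0" "p \<notin> W" | "0 < p" "p < q" | "0 < q" "q < p"
      by (auto simp: word_arc_def split: if_splits)
    then show "(?g p, ?g q) \<in> parcs T"
    proof cases
      case 1
      then show ?thesis
        using X[of 0 q] pq by simp
    next
      case 2
      then show ?thesis
        using YX[of "Suc p" 0] pq by simp
    next
      case 3
      then show ?thesis
        using pq X[of p q] Y[of "Suc p" "Suc q"] YX[of "Suc p" q] YX[of "Suc q" p] XY[of q]
        by (auto simp: word_arc_def matching_def split: if_splits)
    next
      case 4
      then show ?thesis
        using pq X[of q p] Y[of "Suc q" "Suc p"] YX[of "Suc q" p] YX[of "Suc p" q] XY[of p]
        by (auto simp: word_arc_def matching_def split: if_splits)
    qed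
  qed
qed

subsection \<open>Unavoidable structures\<close>

definition rich :: "nat pair_pre_digraph set \<Rightarrow> nat \<Rightarrow> bool" where
  "rich P n \<longleftrightarrow> (\<exists>F. word_family F \<and> (\<forall>W. word_tournament F W n \<in> P))"

definition distinguishes :: "'a pair_pre_digraph \<Rightarrow> 'a \<Rightarrow> 'a \<Rightarrow> 'a \<Rightarrow> bool" where
  "distinguishes T c x y \<longleftrightarrow>
     (c, x) \<in> parcs T \<and> (y, c) \<in> parcs T \<or> (x, c) \<in> parcs T \<and> (c, y) \<in> parcs T"

definition forward :: "'a pair_pre_digraph \<Rightarrow> nat \<Rightarrow> (nat \<Rightarrow> 'a) \<Rightarrow> (nat \<Rightarrow> 'a) \<Rightarrow> bool" where
  "forward T m x y \<longleftrightarrow> (\<forall>i j. i < j \<longrightarrow> j < m \<longrightarrow> (x i, y j) \<in> parcs T)"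

definition backward :: "'a pair_pre_digraph \<Rightarrow> nat \<Rightarrow> (nat \<Rightarrow> 'a) \<Rightarrow> (nat \<Rightarrow> 'a) \<Rightarrow> bool" where
  "backward T m x y \<longleftrightarrow> (\<forall>i j. i < j \<longrightarrow> j < m \<longrightarrow> (y j, x i) \<in> parcs T)"

text \<open>Equality is a third colour because the extracted sequences may be constant or share
  vertices. The diagonal is left out, being invisible to a colouring of pairs.\<close>

definition uniform :: "'a pair_pre_digraph \<Rightarrow> nat \<Rightarrow> (nat \<Rightarrow> 'a) \<Rightarrow> (nat \<Rightarrow> 'a) \<Rightarrow> bool" where
  "uniform T m x y \<longleftrightarrow>
     forward T m x y \<or> backward T m x y \<or> (\<forall>i j. i < j \<longrightarrow> j < m \<longrightarrow> x i = y j)"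

lemma forwardD: "forward T m x y \<Longrightarrow> i < j \<Longrightarrow> j < m \<Longrightarrow> (x i, y j) \<in> parcs T"
  by (simp add: forward_def)

lemma backwardD: "backward T m x y \<Longrightarrow> i < j \<Longrightarrow> j < m \<Longrightarrow> (y j, x i) \<in> parcs T"
  by (simp add: backward_def)

text \<open>The pairs \<open>{x i, y i}\<close> follow one another. Nothing is prescribed inside a
  pair, so either element can be picked from each.\<close>

definition pair_chain :: "'a pair_pre_digraph \<Rightarrow> nat \<Rightarrow> (nat \<Rightarrow> 'a) \<Rightarrow> (nat \<Rightarrow> 'a) \<Rightarrow> bool" where
  "pair_chain T m x y \<longleftrightarrow>
     forward T m x x \<and> forward T m x y \<and> forward T m y x \<and> forward T m y y"

context
  fixes P :: "nat pair_pre_digraph set" and T :: "nat pair_pre_digraph"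
  assumes P: "hereditary P" "T \<in> P"
begin

private lemma tournament_T: "tournament T"
  using hereditary_tournament P by blast

private lemmas T_irrefl = tournament_irrefl[OF tournament_T]
private lemmas T_asym = tournament_asym[OF tournament_T]
private lemmas T_verts = tournament_verts[OF tournament_T]

lemma rich_half_graph:
  assumes "\<And>W. word_tournament (half_graph a b d) W n \<in> P"
  shows "rich P n"
  using assms unfolding rich_def word_family_def by blast

lemma rich_matching:
  assumes "\<And>W. word_tournament (matching c) W n \<in> P"
  shows "rich P n"
  using assms unfolding rich_def word_family_def by blast

text \<open>In each pair one vertex is dominated by \<open>c\<close> and the other dominates it:
  these are the two letters, and \<open>c\<close> is the root. Since the pairs follow one another,
  all flags are \<open>True\<close>. The offset \<open>l\<close> allows skipping index 0.\<close>

lemma rich_if_distinguishes: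
  assumes "pair_chain T m x y" "l + n \<le> m" "n > 0"
    and dist: "\<And>i. l \<le> i \<Longrightarrow> i < l + n \<Longrightarrow> distinguishes T c (x i) (y i)"
  shows "rich P n"
proof (rule rich_half_graph[of True True True], rule half_graph_mem[OF P, where r = c])
  let ?X = "\<lambda>i. if (c, x (l + i)) \<in> parcs T then x (l + i) else y (l + i)"
  let ?Y = "\<lambda>i. if (c, x (l + i)) \<in> parcs T then y (l + i) else x (l + i)"
  show "c \<in> pverts T"
    using dist[of l] assms(3) T_verts by (auto simp: distinguishes_def)
  show "(c, ?X i) \<in> parcs T \<and> (?Y i, c) \<in> parcs T" if "0 < i" "i < n" for i
    using dist[of "l + i"] that T_asym by (auto simp: distinguishes_def)
  have "(x (l + i), x (l + j)) \<in> parcs T \<and> (x (l + i), y (l + j)) \<in> parcs T \<and>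
        (y (l + i), x (l + j)) \<in> parcs T \<and> (y (l + i), y (l + j)) \<in> parcs T"
    if "i < j" "j < n" for i j
    using assms(1,2) that unfolding pair_chain_def by (simp add: forward_def)
  then show "(if True then (?X i, ?X j) else (?X j, ?X i)) \<in> parcs T"
    "(if True then (?Y i, ?Y j) else (?Y j, ?Y i)) \<in> parcs T"
    "(if True then (?X i, ?Y j) else (?Y j, ?X i)) \<in> parcs T"
    "(if True then (?Y i, ?X j) else (?X j, ?Y i)) \<in> parcs T" if "i < j" "j < n" for i j
    using that by simp_all
qed

text \<open>
  Outside the diagonal, the arcs between a chain \<open>x\<close> and a uniform sequence \<open>c\<close> follow one of eight
  patterns. Only the pattern in which all arcs are forward is not rich; when all arcs between \<open>x\<close>
  and \<open>c\<close> have the same direction, the diagonal has to be known.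
\<close>

lemma rich_forward_backward:
  assumes x: "forward T m x x" and c: "forward T m c x" "forward T m x c" "backward T m c c"
    and n: "0 < n" "n < m"
  shows "rich P n"
proof (rule rich_half_graph[of True False True], rule half_graph_mem[OF P, where r = "c 0" and X = x and Y = c])
  show "c 0 \<in> pverts T"
    using forwardD[OF c(1) n] T_verts by blast
qed (use assms in \<open>auto simp: forward_def backward_def\<close>)

text \<open>All arcs between the sequences run from the larger index to the smaller, hence
  \<open>d = False\<close>. The vertex \<open>x 0\<close> dominates every later \<open>x i\<close>
  and is dominated by every later \<open>c i\<close>.\<close>

lemma rich_backward_forward:
  assumes x: "forward T m x x" and c: "backward T m c x" "backward T m x c" "forward T m c c"
    and n: "0 < n" "n < m"
  shows "rich P n"
proof (rule rich_half_graph[of True True False], rule half_graph_mem[OF P, where r = "x 0" and X = x and Y = c])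
  show "x 0 \<in> pverts T"
    using forwardD[OF x n] T_verts by blast
qed (use assms in \<open>auto simp: forward_def backward_def\<close>)

text \<open>Reading both sequences from the end makes the arcs between them run from smaller to
  larger positions and turns \<open>c\<close> into an increasing chain; \<open>x n\<close> is the
  root.\<close>

lemma rich_backward_backward:
  assumes x: "forward T m x x" and c: "backward T m c x" "backward T m x c" "backward T m c c"
    and n: "0 < n" "n < m"
  shows "rich P n"
proof (rule rich_half_graph[of True False True],
    rule half_graph_mem[OF P, where r = "x n" and X = "\<lambda>i. c (n - i)" and Y = "\<lambda>i. x (n - i)"])
  show "x n \<in> pverts T"
    using forwardD[OF x n] T_verts by blast
qed (use assms in \<open>auto simp: forward_def backward_def\<close>)

text \<open>The diagonal arcs from \<open>x\<close> to \<open>y\<close> oppose all the others and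
  become the exceptional arcs of \<open>matching\<close>. The direction of \<open>y\<close>
  determines the flag.\<close>

lemma rich_matching_if:
  assumes x: "forward T m x x" and y: "uniform T m y y" "\<not> (\<forall>i j. i < j \<longrightarrow> j < m \<longrightarrow> y i = y j)"
    and yx: "\<And>i j. i \<noteq> j \<Longrightarrow> i < m \<Longrightarrow> j < m \<Longrightarrow> (y i, x j) \<in> parcs T"
    and xy: "\<And>i. 0 < i \<Longrightarrow> Suc i < m \<Longrightarrow> (x i, y i) \<in> parcs T"
    and n: "0 < n" "Suc n < m"
  shows "rich P n"
proof -
  have V: "x i \<in> pverts T \<and> y i \<in> pverts T" if "i \<le> n" for i
    using yx[of i "Suc n"] yx[of "Suc n" i] that n T_verts by auto
  consider "forward T m y y" | "backward T m y y"
    using y by (auto simp: uniform_def)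
  then show ?thesis
  proof cases
    case 1
    show ?thesis
    proof (rule rich_matching[of True], rule matching_mem[OF P, where X = x and Y = y])
    qed (use 1 V assms in \<open>auto simp: forward_def\<close>)
  next
    case 2
    show ?thesis
    proof (rule rich_matching[of False], rule matching_mem[OF P, where X = x and Y = y])
    qed (use 2 V assms in \<open>auto simp: forward_def backward_def\<close>)
  qed
qed

text \<open>Now \<open>y\<close> is the dominated sequence and takes the positions in
  \<open>W\<close>, which \<open>matching\<close> orders increasingly. If \<open>y\<close>
  decreases, both sequences are read from the end.\<close>

lemma rich_matching_rev_if:
  assumes x: "forward T m x x" and y: "uniform T m y y" "\<not> (\<forall>i j. i < j \<longrightarrow> j < m \<longrightarrow> y i = y j)"
    and xy: "\<And>i j. i \<noteq> j \<Longrightarrow> i < m \<Longrightarrow> j < m \<Longrightarrow> (x i, y j) \<in> parcs T"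
    and yx: "\<And>i. Suc i < m \<Longrightarrow> (y i, x i) \<in> parcs T"
    and n: "0 < n" "Suc n < m"
  shows "rich P n"
proof -
  have V: "x i \<in> pverts T \<and> y i \<in> pverts T" if "i \<le> n" for i
    using xy[of i "Suc n"] xy[of "Suc n" i] that n T_verts by auto
  consider "forward T m y y" | "backward T m y y"
    using y by (auto simp: uniform_def)
  then show ?thesis
  proof cases
    case 1
    show ?thesis
    proof (rule rich_matching[of True], rule matching_mem[OF P, where X = y and Y = x])
    qed (use 1 V assms in \<open>auto simp: forward_def\<close>)
  next
    case 2
    show ?thesis
    proof (rule rich_matching[of False],
        rule matching_mem[OF P, where X = "\<lambda>i. y (n - i)" and Y = "\<lambda>i. x (n - i)"])
    qed (use 2 V assms in \<open>auto simp: forward_def backward_def\<close>)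
  qed
qed

text \<open>The equality colour would identify two vertices of the chain \<open>x\<close> that are
  joined by an arc.\<close>

lemma uniform_chain_cases:
  assumes "forward T m x x" "uniform T m x c \<and> uniform T m c x" "2 < m"
  shows "forward T m x c \<or> backward T m x c" "forward T m c x \<or> backward T m c x"
proof -
  have "\<not> (\<forall>i j. i < j \<longrightarrow> j < m \<longrightarrow> x i = c j)"
  proof
    assume *: "\<forall>i j. i < j \<longrightarrow> j < m \<longrightarrow> x i = c j"
    have "x 0 = x 1"
      using *[rule_format, of 0 2] *[rule_format, of 1 2] assms(3) by simp
    then show False
      using forwardD[OF assms(1), of 0 1] T_irrefl assms(3) by simp
  qed
  then show "forward T m x c \<or> backward T m x c"
    using assms(2) by (auto simp: uniform_def)
  have "\<not> (\<forall>i j. i < j \<longrightarrow> j < m \<longrightarrow> c i = x j)"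
  proof
    assume *: "\<forall>i j. i < j \<longrightarrow> j < m \<longrightarrow> c i = x j"
    have "c 0 = x 1" "c 0 = x 2"
      using *[rule_format, of 0 1] *[rule_format, of 0 2] assms(3) by simp_all
    then show False
      using forwardD[OF assms(1), of 1 2] T_irrefl assms(3) by simp
  qed
  then show "forward T m c x \<or> backward T m c x"
    using assms(2) by (auto simp: uniform_def)
qed

text \<open>A term of \<open>c\<close> that distinguishes many pairs gives a half graph, so
  otherwise \<open>c\<close> is not constant and treats \<open>x\<close> and \<open>y\<close> alike.
  If the arcs between \<open>c\<close> and \<open>x\<close> follow the indices, only an increasing
  \<open>c\<close> escapes; if they run against the indices, nothing does. If they all run from one
  sequence to the other, \<open>loc\<close> supplies opposite arcs on the diagonal, and a matching
  arises.\<close>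

lemma rich_or_forward:
  assumes xy: "pair_chain T m x y"
    and unif: "uniform T m x c \<and> uniform T m c x" "uniform T m y c \<and> uniform T m c y" "uniform T m c c"
    and loc: "\<And>i. i < m \<Longrightarrow> c i = x i \<or> c i = y i \<or> distinguishes T (c i) (x i) (y i)"
    and n: "0 < n" "n + 2 \<le> m"
  shows "rich P n \<or>
    forward T m c x \<and> forward T m c y \<and> forward T m x c \<and> forward T m y c \<and> forward T m c c"
proof (rule disj_imp[THEN iffD2], rule impI)
  assume nr: "\<not> rich P n"
  have chains: "forward T m x x" "forward T m x y" "forward T m y x" "forward T m y y"
    using xy by (auto simp: pair_chain_def)
  have m: "2 < m"
    using n by simp
  note xc = uniform_chain_cases(1)[OF chains(1) unif(1) m]
  note cx = uniform_chain_cases(2)[OF chains(1) unif(1) m]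
  note yc = uniform_chain_cases(1)[OF chains(4) unif(2) m]
  note cy = uniform_chain_cases(2)[OF chains(4) unif(2) m]
  have c_const: "\<not> (\<forall>i j. i < j \<longrightarrow> j < m \<longrightarrow> c i = c j)"
  proof
    assume eq: "\<forall>i j. i < j \<longrightarrow> j < m \<longrightarrow> c i = c j"
    \<comment> \<open>Index 0 is left out, since uniformity says nothing about the arcs between
      \<open>c 0\<close> and pair 0.\<close>
    have "distinguishes T (c 0) (x i) (y i)" if "1 \<le> i" "i < 1 + n" for i
    proof -
      have "c i = c 0"
        using eq[rule_format, of 0 i] that n by simp
      moreover have "(c 0, x i) \<in> parcs T \<or> (x i, c 0) \<in> parcs T" "(c 0, y i) \<in> parcs T \<or> (y i, c 0) \<in> parcs T"
        using cx cy that n by (auto simp: forward_def backward_def)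
      moreover from this have "c 0 \<noteq> x i" "c 0 \<noteq> y i"
        using T_irrefl by metis+
      ultimately show ?thesis
        using loc[of i] that n by simp
    qed
    then show False
      using rich_if_distinguishes[OF xy, of 1 n] n nr by auto
  qed
  have cxy: "forward T m c x \<longleftrightarrow> forward T m c y"
  proof (rule ccontr)
    assume "\<not> ?thesis"
    then have "distinguishes T (c 0) (x i) (y i)" if "1 \<le> i" "i < 1 + n" for i
      using cx cy that n forwardD[of T m _ _ 0 i] backwardD[of T m _ _ 0 i]
      unfolding distinguishes_def by fastforce
    then show False
      using rich_if_distinguishes[OF xy, of 1 n] n nr by auto
  qed
  have xyc: "forward T m x c \<longleftrightarrow> forward T m y c"
  proof (rule ccontr)
    assume "\<not> ?thesis"
    \<comment> \<open>The last term of \<open>c\<close> is compared with earlier pairs, as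
      \<open>c 0\<close> was with later ones.\<close>
    then have "distinguishes T (c (m - 1)) (x i) (y i)" if "i < n" for i
      using xc yc that n forwardD[of T m _ _ i "m - 1"] backwardD[of T m _ _ i "m - 1"]
      unfolding distinguishes_def by fastforce
    then show False
      using rich_if_distinguishes[OF xy, of 0 n] n nr by auto
  qed
  consider "forward T m c x" "forward T m x c" | "backward T m c x" "backward T m x c"
    | "forward T m c x" "backward T m x c" "\<not> forward T m x c" | "backward T m c x" "forward T m x c" "\<not> forward T m c x"
    using cx xc by blast
  then show "forward T m c x \<and> forward T m c y \<and> forward T m x c \<and> forward T m y c \<and> forward T m c c"
  proof cases
    case 1
    then show ?thesis
      using rich_forward_backward[OF chains(1), of c n] cxy xyc unif(3) c_const n nr
      unfolding uniform_def by auto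
  next
    case 2
    then show ?thesis
      using rich_backward_forward[OF chains(1), of c n] rich_backward_backward[OF chains(1), of c n]
        unif(3) c_const n nr
      unfolding uniform_def by auto
  next
    case 3
    \<comment> \<open>From pair \<open>i\<close> take a vertex that dominates \<open>c i\<close>,
      against the direction of all other arcs. It exists unless \<open>c i\<close> lies in the pair.
      For positive \<open>i\<close> this is impossible: \<open>c i\<close> dominates pair
      \<open>i - 1\<close>, which dominates pair \<open>i\<close>.\<close>
    define u where "u i = (if (x i, c i) \<in> parcs T then x i else y i)" for i
    have u: "forward T m u u" "forward T m c u" "backward T m u c"
      using chains 3 cxy xyc yc by (auto simp: u_def forward_def backward_def)
    have "(u i, c i) \<in> parcs T" if i: "0 < i" "Suc i < m" for i
    proof -
      have "(c i, x (i - 1)) \<in> parcs T" "(c i, y (i - 1)) \<in> parcs T"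
        using 3 xyc yc i by (auto simp: backward_def)
      then have "c i \<noteq> x i" "c i \<noteq> y i"
        using forwardD[OF chains(1), of "i - 1" i] forwardD[OF chains(4), of "i - 1" i] i T_asym by auto
      then show ?thesis
        using loc[of i] i by (auto simp: u_def distinguishes_def)
    qed
    moreover have "(c i, u j) \<in> parcs T" if "i \<noteq> j" "i < m" "j < m" for i j
      using u(2,3) that by (cases "i < j") (auto simp: forward_def backward_def)
    ultimately have "rich P n"
      using rich_matching_if[OF u(1) unif(3) c_const] n by simp
    with nr show ?thesis ..
  next
    case 4
    \<comment> \<open>The mirror image: \<open>u i\<close> is dominated by \<open>c i\<close>, and
      \<open>c i\<close> is outside its pair because the next pair dominates \<open>c i\<close> but
      is dominated by pair \<open>i\<close>.\<close>
    define u where "u i = (if (c i, x i) \<in> parcs T then x i else y i)" for i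
    have u: "forward T m u u" "backward T m c u" "forward T m u c"
      using chains 4 cxy xyc cy by (auto simp: u_def forward_def backward_def)
    have "(c i, u i) \<in> parcs T" if i: "Suc i < m" for i
    proof -
      have "(x (Suc i), c i) \<in> parcs T" "(y (Suc i), c i) \<in> parcs T"
        using 4 cxy cy i by (auto simp: backward_def)
      then have "c i \<noteq> x i" "c i \<noteq> y i"
        using forwardD[OF chains(1), of i "Suc i"] forwardD[OF chains(4), of i "Suc i"] i T_asym by auto
      then show ?thesis
        using loc[of i] i by (auto simp: u_def distinguishes_def)
    qed
    moreover have "(u i, c j) \<in> parcs T" if "i \<noteq> j" "i < m" "j < m" for i j
      using u(2,3) that by (cases "i < j") (auto simp: forward_def backward_def)
    ultimately have "rich P n"
      using rich_matching_rev_if[OF u(1) unif(3) c_const] n by simp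
    with nr show ?thesis ..
  qed
qed

text \<open>
  If the arcs between two sequences inserted into a chain of pairs were not all forward, then an
  end of one of them would distinguish many pairs.
\<close>

lemma rich_or_forward_between:
  assumes ab: "pair_chain T m a b"
    and c: "forward T m c a" "forward T m c b" "forward T m a c" "forward T m b c" "forward T m c c"
    and d: "forward T m d a" "forward T m d b" "forward T m a d" "forward T m b d" "forward T m d d"
    and unif: "uniform T m c d \<and> uniform T m d c"
    and n: "0 < n" "n + 2 \<le> m"
  shows "rich P n \<or> forward T m c d"
proof (rule disj_imp[THEN iffD2], rule impI)
  assume nr: "\<not> rich P n"
  have "\<not> backward T m c d"
  proof
    assume bw: "backward T m c d"
    have "distinguishes T (d (m - 1)) (a i) (c i)" if "i < n" for i
      using forwardD[OF d(3), of i "m - 1"] backwardD[OF bw, of i "m - 1"] that n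
      by (simp add: distinguishes_def)
    moreover have "pair_chain T m a c"
      using ab c by (simp add: pair_chain_def)
    ultimately show False
      using rich_if_distinguishes[of m a c 0 n "d (m - 1)"] n nr by simp
  qed
  then show "forward T m c d"
    using uniform_chain_cases(1)[OF c(5) unif] n by simp
qed

text \<open>\<open>c i\<close> and \<open>d i\<close> lie between \<open>a i\<close> and
  \<open>b i\<close>, so they are placed relative to that chain of pairs. \<open>w i\<close> need
  not lie there, but it distinguishes \<open>c i\<close> from \<open>d i\<close>, so it is placed
  relative to the new chain of pairs formed by \<open>c\<close> and \<open>d\<close>.\<close>

lemma rich_or_cyclic_chain:
  assumes ab: "pair_chain T m a b"
    and loc: "\<And>i. i < m \<Longrightarrow> c i = a i \<or> c i = b i \<or> distinguishes T (c i) (a i) (b i)"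
      "\<And>i. i < m \<Longrightarrow> d i = a i \<or> d i = b i \<or> distinguishes T (d i) (a i) (b i)"
    and cyc: "\<And>i. i < m \<Longrightarrow> (d i, w i) \<in> parcs T \<and> (w i, c i) \<in> parcs T"
    and unif: "\<And>x y. x \<in> {a, b, c, d, w} \<Longrightarrow> y \<in> {a, b, c, d, w} \<Longrightarrow> uniform T m x y"
    and n: "0 < n" "n + 2 \<le> m"
  shows "rich P n \<or> (\<forall>x\<in>{c, d, w}. \<forall>y\<in>{c, d, w}. forward T m x y)"
proof (rule disj_imp[THEN iffD2], rule impI)
  assume nr: "\<not> rich P n"
  have c: "forward T m c a" "forward T m c b" "forward T m a c" "forward T m b c" "forward T m c c"
    using rich_or_forward[OF ab _ _ _ loc(1) n] unif nr by auto
  have d: "forward T m d a" "forward T m d b" "forward T m a d" "forward T m b d" "forward T m d d"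
    using rich_or_forward[OF ab _ _ _ loc(2) n] unif nr by auto
  have "forward T m c d" "forward T m d c"
    using rich_or_forward_between[OF ab c d _ n] rich_or_forward_between[OF ab d c _ n] unif nr by auto
  then have cd: "pair_chain T m c d"
    using c d by (simp add: pair_chain_def)
  have "w i = c i \<or> w i = d i \<or> distinguishes T (w i) (c i) (d i)" if "i < m" for i
    using cyc[OF that] by (simp add: distinguishes_def)
  then have "forward T m w c \<and> forward T m w d \<and> forward T m c w \<and> forward T m d w \<and> forward T m w w"
    using rich_or_forward[OF cd _ _ _ _ n] unif nr by simp
  with cd show "\<forall>x\<in>{c, d, w}. \<forall>y\<in>{c, d, w}. forward T m x y"
    by (simp add: pair_chain_def)
qed

end

subsection \<open>Transitive modules\<close>

text \<open>In a tournament, the absence of cyclic triangles is equivalent to transitivity.\<close>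

definition acyclic_on :: "'a pair_pre_digraph \<Rightarrow> 'a set \<Rightarrow> bool" where
  "acyclic_on T B \<longleftrightarrow>
     (\<forall>x\<in>B. \<forall>y\<in>B. \<forall>z\<in>B. (x, y) \<in> parcs T \<longrightarrow> (y, z) \<in> parcs T \<longrightarrow> (z, x) \<notin> parcs T)"

definition transitive_module :: "'a pair_pre_digraph \<Rightarrow> 'a set \<Rightarrow> bool" where
  "transitive_module T B \<longleftrightarrow> B \<subseteq> pverts T \<and> acyclic_on T B \<and>
     (\<forall>w\<in>pverts T - B. \<forall>x\<in>B. \<forall>y\<in>B. (w, x) \<in> parcs T \<longrightarrow> (w, y) \<in> parcs T)"

definition block_rel :: "'a pair_pre_digraph \<Rightarrow> ('a \<times> 'a) set" where
  "block_rel T = {(x, y). \<exists>B. transitive_module T B \<and> x \<in> B \<and> y \<in> B}"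

definition blocks :: "'a pair_pre_digraph \<Rightarrow> 'a set set" where
  "blocks T = pverts T // block_rel T"

context
  fixes T :: "'a pair_pre_digraph"
  assumes T: "tournament T"
begin

private lemmas total = tournament_total[OF T]
private lemmas asym = tournament_asym[OF T]
private lemmas irrefl = tournament_irrefl[OF T]
private lemmas verts = tournament_verts[OF T]

lemma transitive_moduleD:
  assumes "transitive_module T B" "w \<in> pverts T" "w \<notin> B" "x \<in> B" "y \<in> B"
  shows "(w, x) \<in> parcs T \<longleftrightarrow> (w, y) \<in> parcs T" "(x, w) \<in> parcs T \<longleftrightarrow> (y, w) \<in> parcs T"
proof -
  show *: "(w, x) \<in> parcs T \<longleftrightarrow> (w, y) \<in> parcs T"
    using assms unfolding transitive_module_def by blast
  have "x \<in> pverts T" "y \<in> pverts T" "x \<noteq> w" "y \<noteq> w"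
    using assms unfolding transitive_module_def by blast+
  with * show "(x, w) \<in> parcs T \<longleftrightarrow> (y, w) \<in> parcs T"
    using total assms(2) asym by metis
qed

lemma transitive_module_singleton: "x \<in> pverts T \<Longrightarrow> transitive_module T {x}"
  using irrefl by (auto simp: transitive_module_def acyclic_on_def)

text \<open>A third vertex outside the module would dominate \<open>x\<close> and be dominated by
  \<open>y\<close>, and so distinguish them.\<close>

lemma cyclic_triangle_module:
  assumes "transitive_module T B" "x \<in> B" "y \<in> B"
    and "(x, y) \<in> parcs T" "(y, z) \<in> parcs T" "(z, x) \<in> parcs T"
  shows False
proof (cases "z \<in> B")
  case True
  then show False
    using assms unfolding transitive_module_def acyclic_on_def by blast
next
  case False
  then show False
    using transitive_moduleD(1)[OF assms(1), of z x y] assms verts asym by blast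
qed

text \<open>Two of the three vertices of a cyclic triangle in the union lie in the same module. An
  outside vertex treats every element like the common vertex \<open>x\<close>.\<close>

lemma transitive_module_Un:
  assumes A: "transitive_module T A" and B: "transitive_module T B" and x: "x \<in> A" "x \<in> B"
  shows "transitive_module T (A \<union> B)"
  unfolding transitive_module_def
proof (intro conjI ballI impI)
  show "A \<union> B \<subseteq> pverts T"
    using A B by (auto simp: transitive_module_def)
  show "acyclic_on T (A \<union> B)"
    unfolding acyclic_on_def
  proof (intro ballI impI notI)
    fix u v w
    assume *: "(u, v) \<in> parcs T" "(v, w) \<in> parcs T" "(w, u) \<in> parcs T"
      and "u \<in> A \<union> B" "v \<in> A \<union> B" "w \<in> A \<union> B"
    then obtain C where "C = A \<or> C = B" "u \<in> C \<and> v \<in> C \<or> v \<in> C \<and> w \<in> C \<or> w \<in> C \<and> u \<in> C"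
      by blast
    then show False
      using cyclic_triangle_module[of C] A B * by blast
  qed
  fix w u v
  assume w: "w \<in> pverts T - (A \<union> B)" and uv: "u \<in> A \<union> B" "v \<in> A \<union> B" and "(w, u) \<in> parcs T"
  then have "(w, x) \<in> parcs T"
    using transitive_moduleD(1)[OF A, of w u x] transitive_moduleD(1)[OF B, of w u x] x by blast
  then show "(w, v) \<in> parcs T"
    using transitive_moduleD(1)[OF A, of w x v] transitive_moduleD(1)[OF B, of w x v] x w uv by blast
qed

lemma equiv_block_rel: "equiv (pverts T) (block_rel T)"
proof (rule equivI)
  show "block_rel T \<subseteq> pverts T \<times> pverts T"
    by (auto simp: block_rel_def transitive_module_def)
  show "refl_on (pverts T) (block_rel T)"
    using transitive_module_singleton by (auto simp: refl_on_def block_rel_def transitive_module_def)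
  show "sym (block_rel T)"
    by (auto simp: sym_def block_rel_def)
  show "trans (block_rel T)"
  proof (rule transI)
    fix x y z assume "(x, y) \<in> block_rel T" "(y, z) \<in> block_rel T"
    then obtain A B where "transitive_module T A" "x \<in> A" "y \<in> A" "transitive_module T B" "y \<in> B" "z \<in> B"
      by (auto simp: block_rel_def)
    then show "(x, z) \<in> block_rel T"
      using transitive_module_Un[of A B y] by (auto simp: block_rel_def)
  qed
qed

text \<open>If no cyclic triangle had two vertices in the interval \<open>I\<close> from
  \<open>a\<close> to \<open>b\<close>, then \<open>I\<close> would be a transitive module
  containing both. The third vertex \<open>w\<close> may lie outside \<open>I\<close>.\<close>

lemma ex_cyclic_between:
  assumes ab: "(a, b) \<in> parcs T" "(a, b) \<notin> block_rel T"
  defines "I \<equiv> {a, b} \<union> {z. (a, z) \<in> parcs T \<and> (z, b) \<in> parcs T}"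
  shows "\<exists>c d w. c \<in> I \<and> d \<in> I \<and> (c, d) \<in> parcs T \<and> (d, w) \<in> parcs T \<and> (w, c) \<in> parcs T"
    (is ?thesis)
proof (rule ccontr)
  assume "\<not> ?thesis"
  then have none: "\<not> ((c, d) \<in> parcs T \<and> (d, w) \<in> parcs T \<and> (w, c) \<in> parcs T)"
    if "c \<in> I" "d \<in> I" for c d w
    using that by blast
  have a: "a \<in> I" and b: "b \<in> I" and V: "I \<subseteq> pverts T"
    using ab verts unfolding I_def by blast+
  have "transitive_module T I"
    unfolding transitive_module_def
  proof (intro conjI ballI impI V)
    show "acyclic_on T I"
      using none unfolding acyclic_on_def by blast
    fix w x y assume w: "w \<in> pverts T - I" and xy: "x \<in> I" "y \<in> I" "(w, x) \<in> parcs T"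
    have wI: "(w, z) \<in> parcs T \<or> (z, w) \<in> parcs T" if "z \<in> I" for z
      using total[of w z] w that V by blast
    show "(w, y) \<in> parcs T"
    proof (rule ccontr)
      assume "(w, y) \<notin> parcs T"
      then have yw: "(y, w) \<in> parcs T"
        using wI xy by blast
      have le: "z = a \<or> (a, z) \<in> parcs T" "z = b \<or> (z, b) \<in> parcs T" if "z \<in> I" for z
        using that ab unfolding I_def by blast+
      show False
      \<comment> \<open>If \<open>w\<close> dominates \<open>a\<close>, the forbidden triangle is on
        \<open>a\<close>, \<open>y\<close>, \<open>w\<close>. Otherwise \<open>b\<close> dominates
        \<open>w\<close>, as \<open>w\<close> is outside \<open>I\<close>, and the triangle is on
        \<open>x\<close>, \<open>b\<close>, \<open>w\<close>.\<close>
      proof (cases "(w, a) \<in> parcs T")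
        case True
        then have "(w, b) \<in> parcs T"
          using none[OF a b, of w] ab(1) wI[OF b] by blast
        then have "(a, y) \<in> parcs T"
          using le(1)[OF xy(2)] True yw asym by blast
        then show False
          using none[OF a xy(2), of w] True yw by blast
      next
        case False
        then have "(b, w) \<in> parcs T" "(a, w) \<in> parcs T"
          using wI[OF a] wI[OF b] w unfolding I_def by blast+
        then have "(x, b) \<in> parcs T"
          using le(2)[OF xy(1)] xy(3) asym by blast
        then show False
          using none[OF xy(1) b, of w] xy(3) \<open>(b, w) \<in> parcs T\<close> by blast
      qed
    qed
  qed
  then show False
    using ab(2) a b by (auto simp: block_rel_def)
qed

end

section \<open>Extracting uniform sequences with Ramsey's theorem\<close>

lemma ramsey_pairs:
  fixes m :: nat
  assumes "finite C"
  shows "\<exists>N::nat. \<forall>col. (\<forall>i j. i < j \<longrightarrow> j < N \<longrightarrow> col i j \<in> C) \<longrightarrow>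
    (\<exists>g c. (\<forall>i<m. g i < N) \<and> (\<forall>i j. i < j \<longrightarrow> j < m \<longrightarrow> g i < g j \<and> col (g i) (g j) = (c::'c)))"
proof -
  obtain e where e: "bij_betw e C {..<card C}"
    using ex_bij_betw_finite_nat[OF assms] by (auto simp: atLeast0LessThan)
  obtain N :: nat where N: "partn_lst {..<N} (replicate (card C) m) 2"
    using ramsey_full by blast
  show ?thesis
  proof (rule exI, intro allI impI)
    fix col :: "nat \<Rightarrow> nat \<Rightarrow> 'c"
    assume col: "\<forall>i j. i < j \<longrightarrow> j < N \<longrightarrow> col i j \<in> C"
    \<comment> \<open>A two-element set stands for the ordered pair of its minimum and maximum;
      \<open>e\<close> numbers the colours.\<close>
    define f where "f X = e (col (Min X) (Max X))" for X
    have "f \<in> nsets {..<N} 2 \<rightarrow> {..<card C}"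
    proof
      fix X assume X: "X \<in> nsets {..<N} 2"
      then obtain x y where "X = {x, y}" "x < y" "y < N"
        unfolding ordered_nsets_2_eq by auto
      then show "f X \<in> {..<card C}"
        using col e by (auto simp: f_def bij_betw_def)
    qed
    then obtain i H where i: "i < card C" and H: "H \<in> nsets {..<N} m" "f ` nsets H 2 \<subseteq> {i}"
      using N unfolding partn_lst_def monochromatic_def by fastforce
    then have H': "finite H" "card H = m" "H \<subseteq> {..<N}"
      by (auto simp: nsets_def)
    define g where "g k = sorted_list_of_set H ! k" for k
    have len: "length (sorted_list_of_set H) = m"
      using H' by simp
    have gH: "g k \<in> H" if "k < m" for k
      using that len H'(1) nth_mem[of k "sorted_list_of_set H"] by (simp add: g_def)
    have gless: "g k < g l" if "k < l" "l < m" for k l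
      using that len sorted_wrt_nth_less[OF strict_sorted_list_of_set, of k l H] by (simp add: g_def)
    have "g k < g l \<and> col (g k) (g l) = inv_into C e i" if kl: "k < l" "l < m" for k l
    proof -
      have lt: "g k < g l"
        by (rule gless[OF kl])
      have "{g k, g l} \<in> nsets H 2"
        using gH[of k] gH[of l] kl lt by simp
      then have "f {g k, g l} = i"
        using H(2) by blast
      then have "e (col (g k) (g l)) = i"
        using lt by (simp add: f_def min_def max_def)
      moreover have "col (g k) (g l) \<in> C"
        using col lt gH[of l] kl H'(3) by blast
      ultimately show ?thesis
        using lt e by (metis bij_betw_inv_into_left)
    qed
    moreover have "\<forall>k<m. g k < N"
      using gH H'(3) by blast
    ultimately show "\<exists>g c. (\<forall>i<m. g i < N) \<and> (\<forall>i j. i < j \<longrightarrow> j < m \<longrightarrow> g i < g j \<and> col (g i) (g j) = c)"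
      by blast
  qed
qed

text \<open>Pairs of block representatives are coloured by the direction of their arc. A
  monochromatic sequence is a chain, possibly after reversal.\<close>

lemma ex_chain_of_representatives:
  "\<exists>N. \<forall>T :: nat pair_pre_digraph. tournament T \<longrightarrow> N \<le> card (blocks T) \<longrightarrow>
    (\<exists>v. forward T m v v \<and> (\<forall>i j. i < j \<longrightarrow> j < m \<longrightarrow> (v i, v j) \<notin> block_rel T))"
proof -
  obtain N :: nat where N: "\<forall>col. (\<forall>i j. i < j \<longrightarrow> j < N \<longrightarrow> col i j \<in> (UNIV :: bool set)) \<longrightarrow>
    (\<exists>g c. (\<forall>i<m. g i < N) \<and> (\<forall>i j. i < j \<longrightarrow> j < m \<longrightarrow> g i < g j \<and> col (g i) (g j) = c))"
    using ramsey_pairs[of "UNIV :: bool set" m] by auto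
  show ?thesis
  proof (rule exI, intro allI impI)
    fix T :: "nat pair_pre_digraph" assume T: "tournament T" and card: "N \<le> card (blocks T)"
    note eq = equiv_block_rel[OF T]
    have fin: "finite (blocks T)"
      using finite_quotient[OF _ equiv_type[OF eq]] tournament_finite[OF T] by (simp add: blocks_def)
    obtain B where B: "bij_betw B {..<card (blocks T)} (blocks T)"
      using ex_bij_betw_nat_finite[OF fin] by (auto simp: atLeast0LessThan)
    define r where "r i = (SOME x. x \<in> B i)" for i
    have BQ: "B i \<in> pverts T // block_rel T" if "i < N" for i
      using B that card by (auto simp: bij_betw_def blocks_def)
    have r: "r i \<in> B i" if "i < N" for i
      using in_quotient_imp_non_empty[OF eq BQ[OF that]] unfolding r_def by (simp add: some_in_eq)
    have rV: "r i \<in> pverts T" if "i < N" for i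
      using r[OF that] in_quotient_imp_subset[OF eq BQ[OF that]] by blast
    have ne: "(r i, r j) \<notin> block_rel T" if "i < N" "j < N" "i \<noteq> j" for i j
    proof
      assume "(r i, r j) \<in> block_rel T"
      then have "B i = B j"
        using quotient_eqI[OF eq BQ[OF that(1)] BQ[OF that(2)]] r that by blast
      then show False
        using B that card by (auto simp: bij_betw_def inj_on_def)
    qed
    from N[rule_format, of "\<lambda>i j. (r i, r j) \<in> parcs T"]
    obtain g c where g: "\<forall>i<m. g i < N"
      "\<forall>i j. i < j \<longrightarrow> j < m \<longrightarrow> g i < g j \<and> ((r (g i), r (g j)) \<in> parcs T) = c"
      by auto
    have g_ne: "(r (g i), r (g j)) \<notin> block_rel T" if "i < m" "j < m" "i \<noteq> j" for i j
      using ne[of "g i" "g j"] g that by (metis nat_neq_iff)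
    have "r (g i) \<noteq> r (g j)" if "i < m" "j < m" "i \<noteq> j" for i j
      using g_ne[OF that] rV[of "g i"] g(1) that eq by (metis equivE refl_onD)
    then have tot: "(r (g i), r (g j)) \<in> parcs T \<or> (r (g j), r (g i)) \<in> parcs T" if "i < j" "j < m" for i j
      using tournament_total[OF T, of "r (g i)" "r (g j)"] rV[of "g i"] rV[of "g j"] g(1) that by simp
    show "\<exists>v. forward T m v v \<and> (\<forall>i j. i < j \<longrightarrow> j < m \<longrightarrow> (v i, v j) \<notin> block_rel T)"
    proof (cases c)
      case True
      then have "forward T m (\<lambda>i. r (g i)) (\<lambda>i. r (g i))"
        using g(2) by (simp add: forward_def)
      with g_ne show ?thesis
        by (intro exI[of _ "\<lambda>i. r (g i)"]) auto
    next
      case False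
      define v where "v i = r (g (m - Suc i))" for i
      have "forward T m v v"
        unfolding forward_def v_def
      proof (intro allI impI)
        fix i j assume "i < j" "j < m"
        then show "(r (g (m - Suc i)), r (g (m - Suc j))) \<in> parcs T"
          using g(2)[rule_format, of "m - Suc j" "m - Suc i"] tot[of "m - Suc j" "m - Suc i"] False by auto
      qed
      moreover have "(v i, v j) \<notin> block_rel T" if "i < j" "j < m" for i j
        unfolding v_def using that by (intro g_ne) auto
      ultimately show ?thesis
        by blast
    qed
  qed
qed

text \<open>Colour 2 means that no arc joins the two vertices, hence by totality that they are
  equal.\<close>

lemma uniform_if_const_col:
  assumes "\<And>i j. i < j \<Longrightarrow> j < m \<Longrightarrow>
    (if (x i, y j) \<in> parcs T then 0 else if (y j, x i) \<in> parcs T then 1 else 2::nat) = c"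
    and "tournament T" "\<And>i. i < m \<Longrightarrow> x i \<in> pverts T \<and> y i \<in> pverts T"
  shows "uniform T m x y"
proof -
  consider "c = 0" | "c = 1" | "c \<noteq> 0" "c \<noteq> 1"
    by blast
  then show ?thesis
  proof cases
    case 1
    then have "forward T m x y"
      using assms(1) unfolding forward_def by (metis zero_neq_one zero_neq_numeral)
    then show ?thesis by (simp add: uniform_def)
  next
    case 2
    then have "backward T m x y"
      using assms(1) unfolding backward_def by (metis zero_neq_one numeral_eq_one_iff num.distinct(1))
    then show ?thesis by (simp add: uniform_def)
  next
    case 3
    have "x i = y j" if "i < j" "j < m" for i j
      using assms(1)[OF that] 3 tournament_total[OF assms(2), of "x i" "y j"] assms(3)[of i] assms(3)[of j] that
      by (auto split: if_splits)
    then show ?thesis by (simp add: uniform_def)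
  qed
qed

text \<open>The colour of \<open>i < j\<close> is the whole table of relations between the
  \<open>i\<close>-th and \<open>j\<close>-th terms of all \<open>d\<close> sequences. One
  application of Ramsey's theorem thus makes every pair of sequences uniform, including each with
  itself.\<close>

lemma ex_uniform_subsequence:
  fixes d m :: nat
  shows
  "\<exists>N::nat. \<forall>T :: nat pair_pre_digraph. \<forall>s. tournament T \<longrightarrow> (\<forall>k<d. \<forall>i<N. s k i \<in> pverts T) \<longrightarrow>
    (\<exists>g. (\<forall>i<m. g i < N) \<and> (\<forall>i j. i < j \<longrightarrow> j < m \<longrightarrow> g i < g j) \<and>
      (\<forall>k<d. \<forall>l<d. uniform T m (s k \<circ> g) (s l \<circ> g)))"
proof -
  let ?C = "{..<d} \<times> {..<d} \<rightarrow>\<^sub>E {..2::nat}"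
  have "finite ?C"
    by (intro finite_PiE) auto
  from ramsey_pairs[OF this, of m] obtain N :: nat where N: "\<forall>col. (\<forall>i j. i < j \<longrightarrow> j < N \<longrightarrow> col i j \<in> ?C) \<longrightarrow>
    (\<exists>g c. (\<forall>i<m. g i < N) \<and> (\<forall>i j. i < j \<longrightarrow> j < m \<longrightarrow> g i < g j \<and> col (g i) (g j) = c))"
    by (rule exE)
  show ?thesis
  proof (rule exI, intro allI impI)
    fix T :: "nat pair_pre_digraph" and s
    assume T: "tournament T" and s: "\<forall>k<d. \<forall>i<N. s k i \<in> pverts T"
    define col where "col i j = restrict (\<lambda>(k, l). if (s k i, s l j) \<in> parcs T then 0
      else if (s l j, s k i) \<in> parcs T then 1 else 2::nat) ({..<d} \<times> {..<d})" for i j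
    have "\<forall>i j. i < j \<longrightarrow> j < N \<longrightarrow> col i j \<in> ?C"
      unfolding col_def by auto
    from mp[OF spec[OF N] this] obtain g c where g: "\<forall>i<m. g i < N"
      "\<forall>i j. i < j \<longrightarrow> j < m \<longrightarrow> g i < g j \<and> col (g i) (g j) = c"
      by (elim exE conjE)
    have "uniform T m (s k \<circ> g) (s l \<circ> g)" if "k < d" "l < d" for k l
    proof (rule uniform_if_const_col[OF _ T])
      fix i j assume "i < j" "j < m"
      then have "col (g i) (g j) (k, l) = c (k, l)"
        using g(2) by simp
      then show "(if ((s k \<circ> g) i, (s l \<circ> g) j) \<in> parcs T then 0
        else if ((s l \<circ> g) j, (s k \<circ> g) i) \<in> parcs T then 1 else 2) = c (k, l)"
        using that by (auto simp: col_def split: if_splits)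
    qed (use s g that in auto)
    with g show "\<exists>g. (\<forall>i<m. g i < N) \<and> (\<forall>i j. i < j \<longrightarrow> j < m \<longrightarrow> g i < g j) \<and>
      (\<forall>k<d. \<forall>l<d. uniform T m (s k \<circ> g) (s l \<circ> g))"
      by blast
  qed
qed

text \<open>This is a copy of \<open>T(3, ..., 3)\<close> with \<open>m\<close> blocks inside
  \<open>T\<close>.\<close>

definition cyclic_chain :: "'a pair_pre_digraph \<Rightarrow> nat \<Rightarrow> (nat \<Rightarrow> 'a) \<Rightarrow> (nat \<Rightarrow> 'a) \<Rightarrow> (nat \<Rightarrow> 'a) \<Rightarrow> bool" where
  "cyclic_chain T m c d w \<longleftrightarrow> (\<forall>x\<in>{c, d, w}. \<forall>y\<in>{c, d, w}. forward T m x y) \<and>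
     (\<forall>i<m. (c i, d i) \<in> parcs T \<and> (d i, w i) \<in> parcs T \<and> (w i, c i) \<in> parcs T)"

lemma rich_or_cyclic_chain_if_many_blocks:
  assumes "n > 0"
  shows "\<exists>N. \<forall>P. \<forall>T\<in>P. hereditary P \<longrightarrow> N \<le> card (blocks T) \<longrightarrow> rich P n \<or> (\<exists>c d w. cyclic_chain T n c d w)"
proof -
  \<comment> \<open>A matching for words of length \<open>n\<close> needs \<open>Suc n < m\<close>,
    hence two spare indices.\<close>
  let ?m = "n + 2"
  from ex_uniform_subsequence[of 5 ?m] obtain M :: nat where
    M: "\<forall>T :: nat pair_pre_digraph. \<forall>s. tournament T \<longrightarrow> (\<forall>k<5::nat. \<forall>i<M. s k i \<in> pverts T) \<longrightarrow>
    (\<exists>g. (\<forall>i<?m. g i < M) \<and> (\<forall>i j. i < j \<longrightarrow> j < ?m \<longrightarrow> g i < g j) \<and>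
      (\<forall>k<5. \<forall>l<5. uniform T ?m (s k \<circ> g) (s l \<circ> g)))"
    by (rule exE)
  from ex_chain_of_representatives[of "2 * M"] obtain N where
    N: "\<forall>T :: nat pair_pre_digraph. tournament T \<longrightarrow> N \<le> card (blocks T) \<longrightarrow>
    (\<exists>v. forward T (2 * M) v v \<and> (\<forall>i j. i < j \<longrightarrow> j < 2 * M \<longrightarrow> (v i, v j) \<notin> block_rel T))"
    by (rule exE)
  show ?thesis
  proof (rule exI, intro allI ballI impI)
    fix P :: "nat pair_pre_digraph set" and T
    assume P: "hereditary P" "T \<in> P" and card: "N \<le> card (blocks T)"
    have T: "tournament T"
      using hereditary_tournament P by blast
    obtain v where v: "forward T (2 * M) v v" "\<And>i j. i < j \<Longrightarrow> j < 2 * M \<Longrightarrow> (v i, v j) \<notin> block_rel T"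
      using mp[OF mp[OF spec[OF N] T] card] by blast
    \<comment> \<open>Disjoint consecutive pairs give every pair its own obstruction, which is why
      the chain has length \<open>2 * M\<close>.\<close>
    define a where "a i = v (2 * i)" for i
    define b where "b i = v (2 * i + 1)" for i
    have ab: "pair_chain T M a b"
      using v(1) by (auto simp: pair_chain_def forward_def a_def b_def)
    let ?I = "\<lambda>i. {a i, b i} \<union> {z. (a i, z) \<in> parcs T \<and> (z, b i) \<in> parcs T}"
    have abi: "(a i, b i) \<in> parcs T" if "i < M" for i
      using forwardD[OF v(1)] that by (simp add: a_def b_def)
    let ?Q = "\<lambda>i c d w. c \<in> ?I i \<and> d \<in> ?I i \<and> (c, d) \<in> parcs T \<and> (d, w) \<in> parcs T \<and> (w, c) \<in> parcs T"
    have "\<forall>i. \<exists>p. i < M \<longrightarrow> ?Q i (fst p) (fst (snd p)) (snd (snd p))"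
    proof
      fix i
      have ex: "\<exists>c d w. ?Q i c d w" if "i < M"
        by (rule ex_cyclic_between[OF T abi[OF that]]) (use v(2) that in \<open>simp add: a_def b_def\<close>)
      show "\<exists>p. i < M \<longrightarrow> ?Q i (fst p) (fst (snd p)) (snd (snd p))"
      proof (cases "i < M")
        case True
        then obtain c d w where Q: "?Q i c d w"
          using ex by blast
        show ?thesis
          by (rule exI[of _ "(c, d, w)"], rule impI, unfold fst_conv snd_conv, rule Q)
      qed simp
    qed
    from choice[OF this] obtain p where p: "\<forall>i. i < M \<longrightarrow> ?Q i (fst (p i)) (fst (snd (p i))) (snd (snd (p i)))" ..
    define c where "c i = fst (p i)" for i
    define d where "d i = fst (snd (p i))" for i
    define w where "w i = snd (snd (p i))" for i
    have cdw: "?Q i (c i) (d i) (w i)" if "i < M" for i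
      using p that unfolding c_def d_def w_def by blast
    define s where "s k = [a, b, c, d, w] ! k" for k
    have sV: "\<forall>k<5::nat. \<forall>i<M. s k i \<in> pverts T"
    proof (intro allI impI)
      fix k i :: nat assume "k < 5" "i < M"
      moreover have "a i \<in> pverts T" "b i \<in> pverts T" "c i \<in> pverts T" "d i \<in> pverts T" "w i \<in> pverts T"
        using tournament_verts[OF T] abi[OF \<open>i < M\<close>] cdw[OF \<open>i < M\<close>] by blast+
      ultimately show "s k i \<in> pverts T"
        by (auto simp: s_def less_Suc_eq numeral_eq_Suc)
    qed
    from mp[OF mp[OF spec[OF spec[OF M]] T] sV] obtain g where g: "\<And>i. i < ?m \<Longrightarrow> g i < M" "\<And>i j. i < j \<Longrightarrow> j < ?m \<Longrightarrow> g i < g j"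
      and unif: "\<And>k l. k < 5 \<Longrightarrow> l < 5 \<Longrightarrow> uniform T ?m (s k \<circ> g) (s l \<circ> g)"
      by blast
    have "rich P n \<or> (\<forall>x\<in>{c \<circ> g, d \<circ> g, w \<circ> g}. \<forall>y\<in>{c \<circ> g, d \<circ> g, w \<circ> g}. forward T ?m x y)"
    proof (rule rich_or_cyclic_chain[OF P, of ?m "a \<circ> g" "b \<circ> g"])
      show "pair_chain T ?m (a \<circ> g) (b \<circ> g)"
        using ab g unfolding pair_chain_def forward_def by simp
      have mem: "\<exists>k<5. x = s k \<circ> g" if "x \<in> {a \<circ> g, b \<circ> g, c \<circ> g, d \<circ> g, w \<circ> g}" for x
      proof -
        have "s 0 = a" "s 1 = b" "s 2 = c" "s 3 = d" "s 4 = w"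
          by (simp_all add: s_def numeral_eq_Suc)
        moreover have "(0::nat) < 5" "(1::nat) < 5" "(2::nat) < 5" "(3::nat) < 5" "(4::nat) < 5"
          by simp_all
        ultimately show ?thesis
          using that by (metis insertE singletonD)
      qed
      show "uniform T ?m x y" if "x \<in> {a \<circ> g, b \<circ> g, c \<circ> g, d \<circ> g, w \<circ> g}"
        "y \<in> {a \<circ> g, b \<circ> g, c \<circ> g, d \<circ> g, w \<circ> g}" for x y
        using mem[OF that(1)] mem[OF that(2)] unif by blast
      show "(c \<circ> g) i = (a \<circ> g) i \<or> (c \<circ> g) i = (b \<circ> g) i \<or> distinguishes T ((c \<circ> g) i) ((a \<circ> g) i) ((b \<circ> g) i)"
        if "i < ?m" for i
        using cdw[OF g(1)[OF that]] by (auto simp: distinguishes_def)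
      show "(d \<circ> g) i = (a \<circ> g) i \<or> (d \<circ> g) i = (b \<circ> g) i \<or> distinguishes T ((d \<circ> g) i) ((a \<circ> g) i) ((b \<circ> g) i)"
        if "i < ?m" for i
        using cdw[OF g(1)[OF that]] by (auto simp: distinguishes_def)
    qed (use cdw g assms in auto)
    moreover have "((c \<circ> g) i, (d \<circ> g) i) \<in> parcs T \<and> ((d \<circ> g) i, (w \<circ> g) i) \<in> parcs T \<and> ((w \<circ> g) i, (c \<circ> g) i) \<in> parcs T"
      if "i < n" for i
      using cdw g that by simp
    ultimately show "rich P n \<or> (\<exists>c d w. cyclic_chain T n c d w)"
      unfolding cyclic_chain_def forward_def by (metis trans_less_add1)
  qed
qed

subsection \<open>Block tournaments\<close>

definition block :: "('a \<times> 'a) set \<Rightarrow> nat \<Rightarrow> 'a set \<Rightarrow> bool" where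
  "block A k B \<longleftrightarrow> k = 1 \<and> (\<exists>x. B = {x}) \<or>
     k = 3 \<and> (\<exists>x y z. distinct [x, y, z] \<and> B = {x, y, z} \<and> (x, y) \<in> A \<and> (y, z) \<in> A \<and> (z, x) \<in> A)"

text \<open>A form of \<open>T(as)\<close> without coordinates: blocks are peeled off, each
  dominating what remains. Subsets and uniqueness can then be treated by induction on
  \<open>as\<close>.\<close>

fun block_seq :: "('a \<times> 'a) set \<Rightarrow> nat list \<Rightarrow> 'a set \<Rightarrow> bool" where
  "block_seq A [] V \<longleftrightarrow> V = {}"
| "block_seq A (k # as) V \<longleftrightarrow>
     (\<exists>B\<subseteq>V. block A k B \<and> (\<forall>x\<in>B. \<forall>y\<in>V - B. (x, y) \<in> A) \<and> block_seq A as (V - B))"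

lemma block_card: "block A k B \<Longrightarrow> card B = k \<and> finite B \<and> k \<in> {1, 3}"
  by (auto simp: block_def)

lemma block_seq_set: "block_seq A as V \<Longrightarrow> set as \<subseteq> {1, 3}"
  by (induction as arbitrary: V) (auto dest: block_card)

lemma block_image:
  assumes "block A k B" "inj_on g B" "\<And>x y. x \<in> B \<Longrightarrow> y \<in> B \<Longrightarrow> (x, y) \<in> A \<Longrightarrow> (g x, g y) \<in> A'"
  shows "block A' k (g ` B)"
  using assms(1) unfolding block_def
proof (elim disjE conjE exE)
  fix x y z assume *: "k = 3" "distinct [x, y, z]" "B = {x, y, z}" "(x, y) \<in> A" "(y, z) \<in> A" "(z, x) \<in> A"
  then have "distinct [g x, g y, g z]" "g ` B = {g x, g y, g z}" "(g x, g y) \<in> A'" "(g y, g z) \<in> A'" "(g z, g x) \<in> A'"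
    using assms(2,3) by (auto simp: inj_on_def)
  with * show "k = 1 \<and> (\<exists>x. g ` B = {x}) \<or> k = 3 \<and> (\<exists>x y z. distinct [x, y, z] \<and> g ` B = {x, y, z} \<and>
      (x, y) \<in> A' \<and> (y, z) \<in> A' \<and> (z, x) \<in> A')"
    by blast
qed auto

lemma block_seq_image:
  assumes "block_seq A as V" "inj_on g V" "\<And>x y. x \<in> V \<Longrightarrow> y \<in> V \<Longrightarrow> (x, y) \<in> A \<Longrightarrow> (g x, g y) \<in> A'"
  shows "block_seq A' as (g ` V)"
  using assms
proof (induction as arbitrary: V)
  case (Cons k as)
  then obtain B where B: "B \<subseteq> V" "block A k B" "\<forall>x\<in>B. \<forall>y\<in>V - B. (x, y) \<in> A" "block_seq A as (V - B)"
    by auto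
  have gV: "g ` V - g ` B = g ` (V - B)"
    using inj_on_image_set_diff[OF Cons.prems(2), of V B] B(1) by auto
  have "block_seq A' as (g ` (V - B))"
    by (rule Cons.IH[OF B(4) inj_on_diff[OF Cons.prems(2)]]) (use Cons.prems(3) in blast)
  moreover have "block A' k (g ` B)"
    by (rule block_image[OF B(2) inj_on_subset[OF Cons.prems(2) B(1)]]) (use Cons.prems(3) B(1) in blast)
  moreover have "\<forall>x\<in>g ` B. \<forall>y\<in>g ` (V - B). (x, y) \<in> A'"
    using B(1,3) Cons.prems(3) by blast
  moreover have "g ` B \<subseteq> g ` V"
    using B(1) by blast
  ultimately show ?case
    unfolding block_seq.simps gV[symmetric] by blast
qed simp

lemma block_seq_mono:
  "block_seq A as V \<Longrightarrow> A \<inter> V \<times> V \<subseteq> A' \<Longrightarrow> block_seq A' as V"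
  using block_seq_image[of A as V id A'] by auto

context
  fixes T :: "'a pair_pre_digraph"
  assumes T: "tournament T"
begin

lemma block_subset_cases:
  assumes "block (parcs T) k B" "C \<subseteq> B"
  shows "C = {} \<or> (\<exists>p. C = {p}) \<or> (\<exists>p q. C = {p, q} \<and> (p, q) \<in> parcs T) \<or> C = B"
  using assms(1) unfolding block_def
proof (elim disjE conjE exE)
  fix x y z assume "B = {x, y, z}" and *: "(x, y) \<in> parcs T" "(y, z) \<in> parcs T" "(z, x) \<in> parcs T"
  then have "C \<in> Pow {x, y, z}"
    using assms(2) by blast
  then consider "C = {}" | "C = {x}" | "C = {y}" | "C = {z}" | "C = {x, y}" | "C = {y, z}" | "C = {z, x}" | "C = B"
    using \<open>B = {x, y, z}\<close> by (auto simp: Pow_insert insert_commute)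
  then show ?thesis
    using * by cases blast+
qed (use assms(2) in auto)

lemma block_seq_insert:
  assumes "block_seq (parcs T) as (U - {p})" "p \<in> U" "\<And>y. y \<in> U \<Longrightarrow> y \<noteq> p \<Longrightarrow> (p, y) \<in> parcs T"
  shows "block_seq (parcs T) (1 # as) U"
  using assms by (auto simp: block_def intro!: exI[of _ "{p}"])

text \<open>The trace of \<open>U\<close> on a cyclic triangle is empty, a vertex, an arc or the
  triangle, and contributes the blocks \<open>[]\<close>, \<open>[1]\<close>, \<open>[1, 1]\<close>
  or \<open>[3]\<close>.\<close>

lemma ex_block_seq_subset:
  "block_seq (parcs T) as V \<Longrightarrow> U \<subseteq> V \<Longrightarrow> \<exists>bs. block_seq (parcs T) bs U"
proof (induction as arbitrary: U V)
  case Nil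
  then show ?case
    by (intro exI[of _ "[]"]) simp
next
  case (Cons k as)
  then obtain B where B: "B \<subseteq> V" "block (parcs T) k B" "\<forall>x\<in>B. \<forall>y\<in>V - B. (x, y) \<in> parcs T"
    "block_seq (parcs T) as (V - B)"
    by auto
  obtain bs where bs: "block_seq (parcs T) bs (U - B)"
    using Cons.IH[OF B(4), of "U - B"] Cons.prems(2) by blast
  have dom: "(x, y) \<in> parcs T" if "x \<in> B" "y \<in> U - B" for x y
    using that B(3) Cons.prems(2) by blast
  consider "U \<inter> B = {}" | p where "U \<inter> B = {p}" | p q where "U \<inter> B = {p, q}" "(p, q) \<in> parcs T" | "U \<inter> B = B"
    using block_subset_cases[OF B(2), of "U \<inter> B"] by blast
  then show ?case
  proof cases
    case 1
    then have "U - B = U"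
      by blast
    with bs show ?thesis by auto
  next
    case (2 p)
    then have "U - B = U - {p}" and p: "p \<in> U" "p \<in> B"
      by blast+
    moreover have "(p, y) \<in> parcs T" if "y \<in> U" "y \<noteq> p" for y
      using dom[OF p(2), of y] that 2 by blast
    ultimately have "block_seq (parcs T) (1 # bs) U"
      using block_seq_insert[of bs U p] bs by metis
    then show ?thesis ..
  next
    case (3 p q)
    have "p \<noteq> q"
      using 3 tournament_irrefl[OF T] by blast
    have U: "U - B = U - {p} - {q}" and pq: "p \<in> U" "q \<in> U" "p \<in> B" "q \<in> B"
      using 3 by blast+
    have "block_seq (parcs T) (1 # bs) (U - {p})"
    proof (rule block_seq_insert)
      show "block_seq (parcs T) bs (U - {p} - {q})"
        using bs U by simp
      show "(q, y) \<in> parcs T" if "y \<in> U - {p}" "y \<noteq> q" for y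
        using dom[OF pq(4), of y] that 3 by blast
    qed (use pq \<open>p \<noteq> q\<close> in blast)
    then have "block_seq (parcs T) (1 # 1 # bs) U"
    proof (rule block_seq_insert[OF _ pq(1)])
      show "(p, y) \<in> parcs T" if "y \<in> U" "y \<noteq> p" for y
        using dom[OF pq(3), of y] that 3 by blast
    qed
    then show ?thesis ..
  next
    case 4
    then have "block_seq (parcs T) (k # bs) U"
      unfolding block_seq.simps using bs B(2) dom by blast
    then show ?thesis ..
  qed
qed

text \<open>A single vertex and a cyclic triangle are both strongly connected.\<close>

lemma block_dominating_subset:
  assumes "block (parcs T) k C" "B \<subseteq> C" "B \<noteq> {}" "\<And>b c. b \<in> B \<Longrightarrow> c \<in> C - B \<Longrightarrow> (b, c) \<in> parcs T"
  shows "B = C"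
  using assms(1) unfolding block_def
proof (elim disjE conjE exE)
  fix x y z assume C: "C = {x, y, z}" and *: "(x, y) \<in> parcs T" "(y, z) \<in> parcs T" "(z, x) \<in> parcs T"
  have "x \<in> B \<Longrightarrow> z \<in> B" "z \<in> B \<Longrightarrow> y \<in> B" "y \<in> B \<Longrightarrow> x \<in> B"
    using assms(4)[of x z] assms(4)[of z y] assms(4)[of y x] C * tournament_asym[OF T] by blast+
  then show ?thesis
    using assms(2,3) C by blast
qed (use assms in blast)

text \<open>The first blocks of two decompositions are nested, since otherwise two vertices would
  dominate each other. Being strongly connected, they are then equal.\<close>

lemma block_seq_unique:
  "block_seq (parcs T) as V \<Longrightarrow> block_seq (parcs T) bs V \<Longrightarrow> as = bs"
proof (induction as arbitrary: bs V)
  case Nil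
  then show ?case
    by (cases bs) (auto simp: block_def)
next
  case (Cons k as)
  then obtain B where B: "B \<subseteq> V" "block (parcs T) k B" "\<forall>x\<in>B. \<forall>y\<in>V - B. (x, y) \<in> parcs T"
    "block_seq (parcs T) as (V - B)"
    by auto
  have neB: "B \<noteq> {}"
    using B(2) by (auto simp: block_def)
  with B(1) Cons.prems(2) obtain l bs' where bs: "bs = l # bs'"
    by (cases bs) auto
  with Cons.prems(2) obtain C where C: "C \<subseteq> V" "block (parcs T) l C" "\<forall>x\<in>C. \<forall>y\<in>V - C. (x, y) \<in> parcs T"
    "block_seq (parcs T) bs' (V - C)"
    by auto
  have neC: "C \<noteq> {}"
    using C(2) by (auto simp: block_def)
  have "B \<subseteq> C \<or> C \<subseteq> B"
  proof (rule ccontr)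
    assume "\<not> ?thesis"
    then obtain b c where "b \<in> B - C" "c \<in> C - B"
      by blast
    then have "(b, c) \<in> parcs T" "(c, b) \<in> parcs T"
      using B(1,3) C(1,3) by blast+
    then show False
      using tournament_asym[OF T] by blast
  qed
  then have "B = C"
    using block_dominating_subset[OF C(2) _ neB] block_dominating_subset[OF B(2) _ neC] B(1,3) C(1,3)
    by blast
  moreover from this have "k = l"
    using block_card[OF B(2)] block_card[OF C(2)] by simp
  ultimately show ?case
    using Cons.IH[OF B(4)] C(4) bs by simp
qed

end

lemma block_tournament_simps [simp]:
  "(i, j) \<in> pverts (block_tournament as) \<longleftrightarrow> i < length as \<and> j < as ! i"
  "((i, j), (k, l)) \<in> parcs (block_tournament as) \<longleftrightarrow>
     i < length as \<and> j < as ! i \<and> k < length as \<and> l < as ! k \<and>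
     (i < k \<or> i = k \<and> (int l - int j) mod 3 = 1)"
  by (auto simp: block_tournament_def Let_def)

lemma cyclic_order_mod_3:
  fixes j l :: nat
  assumes "j < 3" "l < 3"
  shows "(int l - int j) mod 3 = 1 \<longleftrightarrow> (j, l) \<in> {(0, 1), (1, 2), (2, 0)}"
    and "\<not> ((j, l) \<in> {(0, 1), (1, 2), (2, 0)} \<and> (l, j) \<in> {(0, 1), (1, 2), (2, 0)})"
    and "j = l \<or> (j, l) \<in> {(0, 1), (1, 2), (2, 0)} \<or> (l, j) \<in> {(0, 1), (1, 2), (2, 0)}"
proof -
  have *: "j = 0 \<or> j = 1 \<or> j = 2" "l = 0 \<or> l = 1 \<or> l = 2"
    using assms by linarith+
  then show "(int l - int j) mod 3 = 1 \<longleftrightarrow> (j, l) \<in> {(0, 1), (1, 2), (2, 0)}"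
    by (elim disjE) simp_all
  from * show "\<not> ((j, l) \<in> {(0, 1), (1, 2), (2, 0)} \<and> (l, j) \<in> {(0, 1), (1, 2), (2, 0)})"
    by (elim disjE) simp_all
  from * show "j = l \<or> (j, l) \<in> {(0, 1), (1, 2), (2, 0)} \<or> (l, j) \<in> {(0, 1), (1, 2), (2, 0)}"
    by (elim disjE) simp_all
qed

lemma nth_le_3:
  assumes "set as \<subseteq> {1, 3}" "i < length as"
  shows "as ! i \<le> (3::nat)"
proof -
  have "as ! i \<in> {1, 3}"
    using assms nth_mem by blast
  then show ?thesis
    by auto
qed

lemma tournament_block_tournament:
  assumes "set as \<subseteq> {1, 3}"
  shows "tournament (block_tournament as)"
proof (rule tournamentI)
  have "pverts (block_tournament as) \<subseteq> {..<length as} \<times> {..<3}"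
    using nth_le_3[OF assms] by (fastforce simp: block_tournament_def Let_def)
  then show "finite (pverts (block_tournament as))"
    using finite_subset by blast
  show "parcs (block_tournament as) \<subseteq> pverts (block_tournament as) \<times> pverts (block_tournament as)"
    by auto
  show "(v, u) \<notin> parcs (block_tournament as)" if "(u, v) \<in> parcs (block_tournament as)" for u v
  proof -
    obtain i j k l where uv: "u = (i, j)" "v = (k, l)"
      by (cases u, cases v)
    then have jl: "j < 3" "l < 3"
      using that nth_le_3[OF assms] by fastforce+
    show ?thesis
      using that cyclic_order_mod_3(2)[OF jl] less_asym[of i k] less_irrefl[of i]
      unfolding uv block_tournament_simps cyclic_order_mod_3(1)[OF jl] cyclic_order_mod_3(1)[OF jl(2,1)] by blast
  qed
  show "(u, v) \<in> parcs (block_tournament as) \<or> (v, u) \<in> parcs (block_tournament as)"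
    if "u \<in> pverts (block_tournament as)" "v \<in> pverts (block_tournament as)" "u \<noteq> v" for u v
  proof -
    obtain i j k l where uv: "u = (i, j)" "v = (k, l)"
      by (cases u, cases v)
    then have jl: "j < 3" "l < 3"
      using that nth_le_3[OF assms] by fastforce+
    show ?thesis
      using that cyclic_order_mod_3(3)[OF jl] linorder_less_linear[of i k]
      unfolding uv block_tournament_simps cyclic_order_mod_3(1)[OF jl] cyclic_order_mod_3(1)[OF jl(2,1)] by blast
  qed
qed

text \<open>The vertices with first coordinate 0 form the first block; lowering the first coordinate
  identifies the rest with the shorter tournament.\<close>

lemma block_seq_block_tournament:
  "set as \<subseteq> {1, 3} \<Longrightarrow> block_seq (parcs (block_tournament as)) as (pverts (block_tournament as))"
proof (induction as)
  case Nil
  then show ?case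
    by (auto simp: block_tournament_def)
next
  case (Cons k as)
  let ?V = "pverts (block_tournament (k # as))" and ?A = "parcs (block_tournament (k # as))"
  let ?s = "\<lambda>(i, j). (Suc i, j :: nat)"
  define B where "B = Pair (0::nat) ` {..<k}"
  have VB: "?V - B = ?s ` pverts (block_tournament as)"
  proof (intro subset_antisym subsetI)
    fix v assume "v \<in> ?V - B"
    then obtain i j where "v = (Suc i, j)" "(i, j) \<in> pverts (block_tournament as)"
      by (cases v; cases "fst v") (auto simp: B_def)
    then show "v \<in> ?s ` pverts (block_tournament as)"
      by force
  qed (auto simp: B_def)
  have "block_seq ?A as (?s ` pverts (block_tournament as))"
  proof (rule block_seq_image[OF Cons.IH])
    show "inj_on ?s (pverts (block_tournament as))"
      by (auto simp: inj_on_def)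
  qed (use Cons.prems in auto)
  moreover have "block ?A k B"
  proof -
    consider "k = 1" | "k = 3"
      using Cons.prems by auto
    then show ?thesis
    proof cases
      case 2
      have "{..<3} = {0, 1, 2::nat}"
        by auto
      then have "B = {(0, 0), (0, 1), (0, 2)}"
        using 2 by (simp add: B_def)
      moreover have "((0, 0), (0, 1)) \<in> ?A" "((0, 1), (0, 2)) \<in> ?A" "((0, 2), (0, 0)) \<in> ?A"
        using 2 by simp_all
      moreover have "distinct [(0, 0), (0, 1), (0, 2) :: nat \<times> nat]"
        by simp
      ultimately show ?thesis
        unfolding block_def using 2 by blast
    qed (auto simp: block_def B_def)
  qed
  moreover have "B \<subseteq> ?V" "\<forall>x\<in>B. \<forall>y\<in>?V - B. (x, y) \<in> ?A"
    unfolding VB by (auto simp: B_def)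
  ultimately show ?case
    unfolding block_seq.simps VB[symmetric] by blast
qed

lemma card_block_seq:
  "block_seq A as V \<Longrightarrow> finite V \<Longrightarrow> card V = sum_list as"
proof (induction as arbitrary: V)
  case (Cons k as)
  then obtain B where B: "B \<subseteq> V" "block A k B" "block_seq A as (V - B)"
    by auto
  then have "card V = card B + card (V - B)"
    using Cons.prems(2) by (metis card_Diff_subset card_mono finite_subset le_add_diff_inverse)
  then show ?case
    using Cons.IH[OF B(3)] Cons.prems(2) block_card[OF B(2)] by simp
qed simp

text \<open>The first block is labelled along its cycle and the rest by recursion. Only arcs and the
  image are tracked, since between tournaments arc preservation yields injectivity.\<close>

lemma ex_labelling:
  "block_seq A as V \<Longrightarrow> \<exists>g. g ` pverts (block_tournament as) = V \<and>
     (\<forall>u v. (u, v) \<in> parcs (block_tournament as) \<longrightarrow> (g u, g v) \<in> A)"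
proof (induction as arbitrary: V)
  case Nil
  then show ?case
    by (auto simp: block_tournament_def)
next
  case (Cons k as)
  then obtain B where B: "B \<subseteq> V" "block A k B" "\<forall>x\<in>B. \<forall>y\<in>V - B. (x, y) \<in> A" "block_seq A as (V - B)"
    by auto
  obtain g where g: "g ` pverts (block_tournament as) = V - B"
    "\<And>u v. (u, v) \<in> parcs (block_tournament as) \<Longrightarrow> (g u, g v) \<in> A"
    using Cons.IH[OF B(4)] by blast
  obtain b where b: "b ` {..<k} = B" "\<And>j l. j < k \<Longrightarrow> l < k \<Longrightarrow> (int l - int j) mod 3 = 1 \<Longrightarrow> (b j, b l) \<in> A"
  proof -
    have "\<exists>b. b ` {..<k} = B \<and> (\<forall>j l. j < k \<longrightarrow> l < k \<longrightarrow> (int l - int j) mod 3 = 1 \<longrightarrow> (b j, b l) \<in> A)"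
      using B(2) unfolding block_def
    proof (elim disjE conjE exE)
      fix x assume "k = 1" "B = {x}"
      then show ?thesis
        by (intro exI[of _ "\<lambda>_. x"]) auto
    next
      fix x y z assume *: "k = 3" "B = {x, y, z}" "(x, y) \<in> A" "(y, z) \<in> A" "(z, x) \<in> A"
      have "{..<3} = {0, 1, 2::nat}"
        by auto
      with * show ?thesis
        by (intro exI[of _ "\<lambda>j::nat. if j = 0 then x else if j = 1 then y else z"])
          (auto simp: cyclic_order_mod_3(1))
    qed
    with that show thesis
      by blast
  qed
  define h where "h p = (case fst p of 0 \<Rightarrow> b (snd p) | Suc i \<Rightarrow> g (i, snd p))" for p
  have h: "h (0, j) = b j" "h (Suc i, j) = g (i, j)" for i j
    by (simp_all add: h_def)
  have gV: "g (i, j) \<in> V - B" if "i < length as" "j < as ! i" for i j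
    using g(1) that by auto
  have bB: "b j \<in> B" if "j < k" for j
    using b(1) that by blast
  have "h ` pverts (block_tournament (k # as)) = V"
  proof (intro subset_antisym subsetI)
    fix x assume "x \<in> h ` pverts (block_tournament (k # as))"
    then obtain i j where "x = h (i, j)" "i < length (k # as)" "j < (k # as) ! i"
      by auto
    then show "x \<in> V"
      using gV bB B(1) by (cases i) (auto simp: h)
  next
    fix x assume "x \<in> V"
    show "x \<in> h ` pverts (block_tournament (k # as))"
    proof (cases "x \<in> B")
      case True
      then obtain j where "j < k" "x = b j"
        using b(1) by blast
      then show ?thesis
        by (intro image_eqI[of _ _ "(0, j)"]) (simp_all add: h)
    next
      case False
      with \<open>x \<in> V\<close> g(1) have "x \<in> g ` pverts (block_tournament as)"
        by blast
      then obtain i j where "x = g (i, j)" "i < length as" "j < as ! i"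
        by auto
      then show ?thesis
        by (intro image_eqI[of _ _ "(Suc i, j)"]) (simp_all add: h)
    qed
  qed
  moreover have "(h u, h v) \<in> A" if uv: "(u, v) \<in> parcs (block_tournament (k # as))" for u v
  proof -
    obtain i j i' j' where eq: "u = (i, j)" "v = (i', j')"
      by (cases u, cases v)
    show ?thesis
    proof (cases i; cases i')
      assume i: "i = 0" "i' = 0"
      then have "j < k" "j' < k" "(int j' - int j) mod 3 = 1"
        using uv unfolding eq block_tournament_simps by simp_all
      then show ?thesis
        unfolding eq i h by (rule b(2))
    next
      fix l' assume i: "i = 0" "i' = Suc l'"
      then have "j < k" "l' < length as" "j' < as ! l'"
        using uv unfolding eq block_tournament_simps by simp_all
      then show ?thesis
        unfolding eq i h using B(3) bB gV by blast
    next
      fix l assume "i = Suc l" "i' = 0"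
      then show ?thesis
        using uv unfolding eq block_tournament_simps by simp
    next
      fix l l' assume i: "i = Suc l" "i' = Suc l'"
      then have "((l, j), (l', j')) \<in> parcs (block_tournament as)"
        using uv unfolding eq block_tournament_simps by simp
      then show ?thesis
        unfolding eq i h by (rule g(2))
    qed
  qed
  ultimately show ?case
    by blast
qed

lemma block_tournament_iso_iff:
  assumes "set as \<subseteq> {1, 3}" "tournament T"
  shows "block_tournament as \<cong>\<^sub>T T \<longleftrightarrow> block_seq (parcs T) as (pverts T)"
proof
  assume "block_tournament as \<cong>\<^sub>T T"
  then obtain g where g: "embeds (block_tournament as) T g" "pverts T = g ` pverts (block_tournament as)"
    "inj_on g (pverts (block_tournament as))"
    by (rule iso_embedsE)
  show "block_seq (parcs T) as (pverts T)"
    unfolding g(2)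
    by (rule block_seq_image[OF block_seq_block_tournament[OF assms(1)] g(3)])
      (use g(1) in \<open>auto simp: embeds_def\<close>)
next
  assume "block_seq (parcs T) as (pverts T)"
  from ex_labelling[OF this] obtain g where g: "g ` pverts (block_tournament as) = pverts T"
    "\<forall>u v. (u, v) \<in> parcs (block_tournament as) \<longrightarrow> (g u, g v) \<in> parcs T"
    by blast
  then have "embeds (block_tournament as) T g"
    unfolding embeds_def by blast
  then show "block_tournament as \<cong>\<^sub>T T"
    using iso_tournamentI[OF tournament_block_tournament[OF assms(1)] assms(2)] g(1) by metis
qed

lemma block_tournaments_iff:
  "T \<in> block_tournaments \<longleftrightarrow> tournament T \<and> (\<exists>as. block_seq (parcs T) as (pverts T))"
proof
  assume "T \<in> block_tournaments"
  then obtain as where as: "set as \<subseteq> {1, 3}" "block_tournament as \<cong>\<^sub>T T"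
    by (auto simp: block_tournaments_def)
  then have "tournament T"
    using iso_tournament tournament_block_tournament by blast
  with as show "tournament T \<and> (\<exists>as. block_seq (parcs T) as (pverts T))"
    using block_tournament_iso_iff by blast
next
  assume "tournament T \<and> (\<exists>as. block_seq (parcs T) as (pverts T))"
  then show "T \<in> block_tournaments"
    unfolding block_tournaments_def using block_tournament_iso_iff block_seq_set by blast
qed

lemma hereditary_block_tournaments: "hereditary block_tournaments"
  unfolding hereditary_def tournament_property_def
proof (intro conjI ballI allI impI)
  fix T assume "T \<in> block_tournaments"
  then show "tournament T"
    by (simp add: block_tournaments_iff)
next
  fix S T :: "nat pair_pre_digraph"
  assume S: "S \<in> block_tournaments" and iso: "S \<cong>\<^sub>T T"
  from S obtain as where as: "set as \<subseteq> {1, 3}" "block_tournament as \<cong>\<^sub>T S"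
    by (auto simp: block_tournaments_def)
  then have "block_tournament as \<cong>\<^sub>T T"
    using iso_trans[OF as(2) iso] tournament_block_tournament by blast
  with as(1) show "T \<in> block_tournaments"
    by (auto simp: block_tournaments_def)
next
  fix S T :: "nat pair_pre_digraph"
  assume T: "T \<in> block_tournaments" and sub: "induced_subgraph (with_proj S) (with_proj T)"
  then obtain as where tT: "tournament T" and as: "block_seq (parcs T) as (pverts T)"
    by (auto simp: block_tournaments_iff)
  have V: "pverts S \<subseteq> pverts T"
    using sub by (auto simp: induced_subgraph_def subgraph_def)
  have A: "parcs S = {e \<in> parcs T. fst e \<in> pverts S \<and> snd e \<in> pverts S}"
    using sub by (simp add: induced_subgraph_def)
  have "parcs S = parcs T \<inter> pverts S \<times> pverts S"
    unfolding A by auto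
  then have "T \<restriction>\<^sub>T pverts S = S"
    by simp
  with tournament_restrict[OF tT V] have tS: "tournament S"
    by metis
  obtain bs where "block_seq (parcs T) bs (pverts S)"
    using ex_block_seq_subset[OF tT as V] by blast
  then have "block_seq (parcs S) bs (pverts S)"
    by (rule block_seq_mono) (auto simp: A)
  with tS show "S \<in> block_tournaments"
    unfolding block_tournaments_iff by blast
qed

section \<open>Counting block tournaments by compositions into parts 1 and 3\<close>

definition compositions :: "nat \<Rightarrow> nat list set" where
  "compositions n = {as. set as \<subseteq> {1, 3} \<and> sum_list as = n}"

lemma finite_compositions: "finite (compositions n)"
proof -
  have "length as \<le> sum_list as" if "set as \<subseteq> {1, 3::nat}" for as
    using that by (induction as) auto
  then have "compositions n \<subseteq> {as. set as \<subseteq> {1, 3} \<and> length as \<le> n}"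
    unfolding compositions_def by blast
  then show ?thesis
    by (rule finite_subset) (simp add: finite_lists_length_le)
qed

text \<open>Deleting the first part, 1 or 3, reproduces the recursion of
  \<open>Fstar\<close>.\<close>

lemma card_compositions: "card (compositions n) = Fstar n"
proof (induction n rule: Fstar.induct)
  case 1
  have "compositions 0 = {[]}"
  proof (intro subset_antisym subsetI)
    fix as assume "as \<in> compositions 0"
    then show "as \<in> {[]}"
      by (cases as) (auto simp: compositions_def)
  qed (simp add: compositions_def)
  then show ?case by simp
next
  case 2
  have "compositions (Suc 0) = {[1]}"
  proof (intro subset_antisym subsetI)
    fix as assume "as \<in> compositions (Suc 0)"
    then show "as \<in> {[1]}"
      by (cases as; cases "tl as") (auto simp: compositions_def)
  qed (simp add: compositions_def)
  then show ?case by simp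
next
  case 3
  have "compositions (Suc (Suc 0)) = {[1, 1]}"
  proof (intro subset_antisym subsetI)
    fix as assume "as \<in> compositions (Suc (Suc 0))"
    then show "as \<in> {[1, 1]}"
      by (cases as; cases "tl as"; cases "tl (tl as)") (auto simp: compositions_def)
  qed (simp add: compositions_def)
  then show ?case by simp
next
  case (4 n)
  let ?A = "(#) 1 ` compositions (Suc (Suc n))" and ?B = "(#) 3 ` compositions n"
  have "compositions (Suc (Suc (Suc n))) = ?A \<union> ?B"
  proof (intro subset_antisym subsetI)
    fix as assume "as \<in> compositions (Suc (Suc (Suc n)))"
    then show "as \<in> ?A \<union> ?B"
      by (cases as) (auto simp: compositions_def)
  qed (auto simp: compositions_def)
  moreover have "?A \<inter> ?B = {}"
    by auto
  ultimately have "card (compositions (Suc (Suc (Suc n)))) = card ?A + card ?B"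
    using card_Un_disjoint[of ?A ?B] finite_compositions by simp
  then show ?case
    using 4 by (simp add: card_image)
qed

text \<open>The sequence of block sizes is a complete invariant: coordinates show that it determines
  the tournament, and uniqueness of the block sequence that it is determined by it.\<close>

lemma speed_block_tournaments: "speed block_tournaments n = Fstar n"
proof (rule antisym)
  show "speed block_tournaments n \<le> Fstar n"
    unfolding card_compositions[symmetric]
  proof (rule speed_le_card[OF hereditary_block_tournaments finite_compositions])
    fix T assume T: "T \<in> block_tournaments" "card (pverts T) = n"
    then obtain as where as: "tournament T" "block_seq (parcs T) as (pverts T)"
      by (auto simp: block_tournaments_iff)
    then have "as \<in> compositions n"
      using T(2) card_block_seq[OF as(2) tournament_finite] block_seq_set[OF as(2)]
      by (simp add: compositions_def)
    with as(2) show "\<exists>as\<in>compositions n. block_seq (parcs T) as (pverts T)" ..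
  next
    fix as and S T :: "nat pair_pre_digraph"
    assume "as \<in> compositions n" and ST: "S \<in> block_tournaments" "T \<in> block_tournaments"
      and S: "block_seq (parcs S) as (pverts S)" and T: "block_seq (parcs T) as (pverts T)"
    then have as: "set as \<subseteq> {1, 3}"
      by (simp add: compositions_def)
    have tS: "tournament S" and tT: "tournament T"
      using ST by (simp_all add: block_tournaments_iff)
    have "S \<cong>\<^sub>T block_tournament as"
      using block_tournament_iso_iff[OF as tS] S iso_sym tournament_block_tournament[OF as] by blast
    moreover have "block_tournament as \<cong>\<^sub>T T"
      using block_tournament_iso_iff[OF as tT] T by blast
    ultimately show "S \<cong>\<^sub>T T"
      using tS by (rule iso_trans)
  qed
  \<comment> \<open>\<open>block_tournament\<close> has pairs as vertices, so a copy with vertices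
    in \<open>nat\<close> is chosen.\<close>
  define f where "f as = (SOME S :: nat pair_pre_digraph. block_tournament as \<cong>\<^sub>T S)" for as
  have f: "block_tournament as \<cong>\<^sub>T f as" if "set as \<subseteq> {1, 3}" for as
  proof -
    have "\<exists>S :: nat pair_pre_digraph. block_tournament as \<cong>\<^sub>T S"
      using ex_iso_nat[OF tournament_block_tournament[OF that],
          of "{..<card (pverts (block_tournament as))} :: nat set"] by auto
    then show ?thesis
      unfolding f_def by (rule someI_ex)
  qed
  have tf: "tournament (f as)" and bf: "block_seq (parcs (f as)) as (pverts (f as))" if "set as \<subseteq> {1, 3}" for as
  proof -
    show "tournament (f as)"
      by (rule iso_tournament[OF f[OF that] tournament_block_tournament[OF that]])
    then show "block_seq (parcs (f as)) as (pverts (f as))"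
      using f[OF that] block_tournament_iso_iff[OF that] by blast
  qed
  show "Fstar n \<le> speed block_tournaments n"
    unfolding card_compositions[symmetric]
  proof (rule card_le_speed[OF hereditary_block_tournaments finite_compositions, of _ f])
    fix as assume "as \<in> compositions n"
    then have as: "set as \<subseteq> {1, 3}" "sum_list as = n"
      by (auto simp: compositions_def)
    show "f as \<in> block_tournaments \<and> card (pverts (f as)) = n"
      using tf[OF as(1)] bf[OF as(1)] card_block_seq[OF bf[OF as(1)] tournament_finite[OF tf[OF as(1)]]] as(2)
      unfolding block_tournaments_iff by blast
  next
    fix as bs assume "as \<in> compositions n" "bs \<in> compositions n" and iso: "f as \<cong>\<^sub>T f bs"
    then have as: "set as \<subseteq> {1, 3}" and bs: "set bs \<subseteq> {1, 3}"
      by (auto simp: compositions_def)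
    have "block_tournament as \<cong>\<^sub>T f bs"
      by (rule iso_trans[OF f[OF as] iso tournament_block_tournament[OF as]])
    then have "block_seq (parcs (f bs)) as (pverts (f bs))"
      using block_tournament_iso_iff[OF as tf[OF bs]] by blast
    then show "as = bs"
      by (rule block_seq_unique[OF tf[OF bs] _ bf[OF bs]])
  qed
qed

text \<open>With \<open>length as\<close> consecutive triangles available, a block of size 1 uses
  only \<open>c i\<close>, and a block of size 3 uses \<open>c i\<close>, \<open>d i\<close> and
  \<open>w i\<close>.\<close>

lemma block_tournaments_subset_if_cyclic_chains:
  assumes P: "hereditary P" and chains: "\<And>n. \<exists>T\<in>P. \<exists>c d w. cyclic_chain T n c d w"
  shows "block_tournaments \<subseteq> P"
proof
  fix S assume S: "S \<in> block_tournaments"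
  then have tS: "tournament S"
    by (simp add: block_tournaments_iff)
  obtain as where as: "set as \<subseteq> {1, 3}" "block_tournament as \<cong>\<^sub>T S"
    using S by (auto simp: block_tournaments_def)
  obtain h where h: "embeds S (block_tournament as) h"
    using iso_sym[OF as(2) tournament_block_tournament[OF as(1)]] by (rule iso_embedsE)
  obtain T c d w where T: "T \<in> P" and chain: "cyclic_chain T (length as) c d w"
    using chains by blast
  let ?g = "\<lambda>(i, j::nat). (if j = 0 then c else if j = 1 then d else w) i"
  have fwd: "((if j = 0 then c else if j = 1 then d else w) i, (if l = 0 then c else if l = 1 then d else w) k) \<in> parcs T"
    if "i < k" "k < length as" for i k and j l :: nat
    using chain that unfolding cyclic_chain_def forward_def by simp
  have cyc: "(c i, d i) \<in> parcs T" "(d i, w i) \<in> parcs T" "(w i, c i) \<in> parcs T" if "i < length as" for i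
    using chain that unfolding cyclic_chain_def by blast+
  have "embeds (block_tournament as) T ?g"
    unfolding embeds_def
  proof (intro conjI allI impI)
    have "c i \<in> pverts T" "d i \<in> pverts T" "w i \<in> pverts T" if "i < length as" for i
      using tournament_verts[OF hereditary_tournament[OF P T]] cyc[OF that] by blast+
    then show "?g ` pverts (block_tournament as) \<subseteq> pverts T"
      by auto
    fix u v assume uv: "(u, v) \<in> parcs (block_tournament as)"
    obtain i j k l where eq: "u = (i, j)" "v = (k, l)"
      by (cases u, cases v)
    have jl: "j < 3" "l < 3"
      using uv eq nth_le_3[OF as(1), of i] nth_le_3[OF as(1), of k] by auto
    consider "i < k" "k < length as" | "i = k" "k < length as" "(j, l) \<in> {(0, 1), (1, 2), (2, 0)}"
      using uv eq cyclic_order_mod_3(1)[OF jl] by auto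
    then show "(?g u, ?g v) \<in> parcs T"
    proof cases
      case 1
      then show ?thesis
        using fwd eq by simp
    next
      case 2
      then show ?thesis
        using cyc[of k] eq by auto
    qed
  qed
  then show "S \<in> P"
    using hereditary_embeds[OF P T tS] embeds_trans[OF h] by blast
qed

subsection \<open>Blocks of subtournaments\<close>

context
  fixes T :: "'a pair_pre_digraph"
  assumes T: "tournament T"
begin

lemma finite_blocks: "finite (blocks T)"
  unfolding blocks_def
  by (rule finite_quotient[OF tournament_finite[OF T] equiv_type[OF equiv_block_rel[OF T]]])

lemma block_subset: "B \<in> blocks T \<Longrightarrow> B \<subseteq> pverts T"
  unfolding blocks_def by (rule in_quotient_imp_subset[OF equiv_block_rel[OF T]])

lemma finite_block: "B \<in> blocks T \<Longrightarrow> finite B"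
  using block_subset tournament_finite[OF T] finite_subset by blast

lemma block_nonempty: "B \<in> blocks T \<Longrightarrow> B \<noteq> {}"
  unfolding blocks_def by (rule in_quotient_imp_non_empty[OF equiv_block_rel[OF T]])

lemma Union_blocks: "\<Union>(blocks T) = pverts T"
  unfolding blocks_def by (rule Union_quotient[OF equiv_block_rel[OF T]])

lemma blocks_disjoint: "B \<in> blocks T \<Longrightarrow> C \<in> blocks T \<Longrightarrow> B \<noteq> C \<Longrightarrow> B \<inter> C = {}"
  unfolding blocks_def using quotient_disj[OF equiv_block_rel[OF T]] by blast

lemma block_rel_if_block: "B \<in> blocks T \<Longrightarrow> x \<in> B \<Longrightarrow> y \<in> B \<Longrightarrow> (x, y) \<in> block_rel T"
  unfolding blocks_def using in_quotient_imp_in_rel[OF equiv_block_rel[OF T]] by blast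

lemma in_block_if_block_rel: "B \<in> blocks T \<Longrightarrow> x \<in> B \<Longrightarrow> (x, y) \<in> block_rel T \<Longrightarrow> y \<in> B"
  unfolding blocks_def using in_quotient_imp_closed[OF equiv_block_rel[OF T]] by blast

lemma transitive_module_subset_block:
  assumes "transitive_module T C" "B \<in> blocks T" "x \<in> B" "x \<in> C"
  shows "C \<subseteq> B"
proof
  fix y assume "y \<in> C"
  with assms(1,4) have "(x, y) \<in> block_rel T"
    unfolding block_rel_def by blast
  then show "y \<in> B"
    by (rule in_block_if_block_rel[OF assms(2,3)])
qed

text \<open>By finiteness there is a maximal transitive module through \<open>x\<close>. Closure
  under unions makes it contain every other one through \<open>x\<close>, so it is the class of
  \<open>x\<close>.\<close>

lemma transitive_module_block:
  assumes B: "B \<in> blocks T"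
  shows "transitive_module T B"
proof -
  obtain x where x: "x \<in> B"
    using block_nonempty[OF B] by blast
  then have xV: "x \<in> pverts T"
    using block_subset[OF B] by blast
  let ?M = "{C. transitive_module T C \<and> x \<in> C}"
  have "?M \<subseteq> Pow (pverts T)"
    unfolding transitive_module_def by blast
  then have fin: "finite ?M"
    using finite_subset tournament_finite[OF T] by blast
  moreover have "?M \<noteq> {}"
    using transitive_module_singleton[OF T xV] by blast
  ultimately obtain C where C: "C \<in> ?M" and max: "\<And>D. D \<in> ?M \<Longrightarrow> C \<subseteq> D \<Longrightarrow> C = D"
    using finite_has_maximal[of ?M] by blast
  have "B \<subseteq> C"
  proof
    fix y assume "y \<in> B"
    then have "(x, y) \<in> block_rel T"
      by (rule block_rel_if_block[OF B x])
    then obtain D where D: "transitive_module T D" "x \<in> D" "y \<in> D"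
      unfolding block_rel_def by blast
    then have "C \<union> D \<in> ?M"
      using transitive_module_Un[OF T _ D(1), of C x] C by blast
    then show "y \<in> C"
      using max[of "C \<union> D"] D(3) by blast
  qed
  moreover have "C \<subseteq> B"
    using transitive_module_subset_block[OF _ B x] C by blast
  ultimately have "C = B"
    by (rule subset_antisym[rotated])
  then show ?thesis
    using C by simp
qed

text \<open>Maximality avoids the equivalence relation and is the form that transfers to
  sub-tournaments and along isomorphisms.\<close>

lemma blocks_iff_maximal:
  "B \<in> blocks T \<longleftrightarrow> transitive_module T B \<and> B \<noteq> {} \<and> (\<forall>C. transitive_module T C \<longrightarrow> B \<subseteq> C \<longrightarrow> C = B)"
proof
  assume B: "B \<in> blocks T"
  have "C = B" if "transitive_module T C" "B \<subseteq> C" for C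
    using transitive_module_subset_block[OF that(1) B] block_nonempty[OF B] that(2) by blast
  then show "transitive_module T B \<and> B \<noteq> {} \<and> (\<forall>C. transitive_module T C \<longrightarrow> B \<subseteq> C \<longrightarrow> C = B)"
    using transitive_module_block[OF B] block_nonempty[OF B] by blast
next
  assume R: "transitive_module T B \<and> B \<noteq> {} \<and> (\<forall>C. transitive_module T C \<longrightarrow> B \<subseteq> C \<longrightarrow> C = B)"
  then obtain x where x: "x \<in> B"
    by blast
  then have "x \<in> pverts T"
    using R unfolding transitive_module_def by blast
  then obtain C where C: "C \<in> blocks T" "x \<in> C"
    using Union_blocks by blast
  have "B \<subseteq> C"
    using transitive_module_subset_block[OF _ C x] R by blast
  then have "C = B"
    using R transitive_module_block[OF C(1)] by blast
  with C show "B \<in> blocks T" by blast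
qed

lemma block_arcs:
  assumes "B \<in> blocks T" "C \<in> blocks T" "B \<noteq> C" "b \<in> B" "b' \<in> B" "c \<in> C" "c' \<in> C"
  shows "(b, c) \<in> parcs T \<longleftrightarrow> (b', c') \<in> parcs T"
proof -
  have "b \<notin> C" "b' \<notin> C" "c \<notin> B" "c' \<notin> B" and V: "b \<in> pverts T" "c' \<in> pverts T"
    using blocks_disjoint[OF assms(1-3)] assms block_subset by blast+
  then show ?thesis
    using transitive_moduleD(1)[OF T transitive_module_block[OF assms(2)] V(1), of c c']
      transitive_moduleD(2)[OF T transitive_module_block[OF assms(1)] V(2), of b b'] assms(4-7) by blast
qed

lemma transitive_module_restrict:
  assumes "transitive_module T B" "U \<subseteq> pverts T"
  shows "transitive_module (T \<restriction>\<^sub>T U) (B \<inter> U)"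
proof -
  have "acyclic_on (T \<restriction>\<^sub>T U) (B \<inter> U)"
    using assms(1) unfolding transitive_module_def acyclic_on_def pair_pre_digraph.simps by blast
  moreover have "(w, y) \<in> parcs (T \<restriction>\<^sub>T U)" if "w \<in> U - B \<inter> U" "x \<in> B \<inter> U" "y \<in> B \<inter> U" "(w, x) \<in> parcs (T \<restriction>\<^sub>T U)" for w x y
    using transitive_moduleD(1)[OF T assms(1), of w x y] that assms(2) by auto
  ultimately show ?thesis
    unfolding transitive_module_def pair_pre_digraph.simps by blast
qed

text \<open>A cyclic triangle in the union has its vertices in three different blocks, since each
  block is a transitive module. They can be replaced by representatives in \<open>C\<close>, as arcs
  between blocks depend only on the blocks. An outside vertex is replaced by a representative in
  \<open>U\<close>, which meets every block.\<close>

lemma transitive_module_saturate: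
  assumes U: "U \<subseteq> pverts T" "\<And>B. B \<in> blocks T \<Longrightarrow> B \<inter> U \<noteq> {}"
    and C: "transitive_module (T \<restriction>\<^sub>T U) C"
  shows "transitive_module T (\<Union>{B \<in> blocks T. B \<inter> C \<noteq> {}})"
  unfolding transitive_module_def
proof (intro conjI ballI impI)
  let ?D = "\<Union>{B \<in> blocks T. B \<inter> C \<noteq> {}}"
  have CU: "C \<subseteq> U"
    using C by (simp add: transitive_module_def)
  show "?D \<subseteq> pverts T"
    using block_subset by blast
  show "acyclic_on T ?D"
    unfolding acyclic_on_def
  proof (intro ballI impI notI)
    fix x y z assume xyz: "(x, y) \<in> parcs T" "(y, z) \<in> parcs T" "(z, x) \<in> parcs T"
      and D: "x \<in> ?D" "y \<in> ?D" "z \<in> ?D"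
    then obtain X Y Z where X: "X \<in> blocks T" "x \<in> X" "X \<inter> C \<noteq> {}" and Y: "Y \<in> blocks T" "y \<in> Y" "Y \<inter> C \<noteq> {}"
      and Z: "Z \<in> blocks T" "z \<in> Z" "Z \<inter> C \<noteq> {}"
      by blast
    note cyc = cyclic_triangle_module[OF T transitive_module_block]
    have ne: "X \<noteq> Y" "Y \<noteq> Z" "Z \<noteq> X"
      using cyc[OF X(1,2), of y z] cyc[OF Y(1,2), of z x] cyc[OF Z(1,2), of x y] X Y Z xyz by blast+
    obtain x' y' z' where x': "x' \<in> X" "x' \<in> C" and y': "y' \<in> Y" "y' \<in> C" and z': "z' \<in> Z" "z' \<in> C"
      using X(3) Y(3) Z(3) by blast
    have "(x', y') \<in> parcs T" "(y', z') \<in> parcs T" "(z', x') \<in> parcs T"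
      using block_arcs[OF X(1) Y(1) ne(1) X(2) x'(1) Y(2) y'(1)] block_arcs[OF Y(1) Z(1) ne(2) Y(2) y'(1) Z(2) z'(1)]
        block_arcs[OF Z(1) X(1) ne(3) Z(2) z'(1) X(2) x'(1)] xyz by blast+
    then have "(x', y') \<in> parcs (T \<restriction>\<^sub>T U)" "(y', z') \<in> parcs (T \<restriction>\<^sub>T U)" "(z', x') \<in> parcs (T \<restriction>\<^sub>T U)"
      using CU x'(2) y'(2) z'(2) by auto
    then show False
      using C x'(2) y'(2) z'(2) unfolding transitive_module_def acyclic_on_def by blast
  qed
  fix w x y assume w: "w \<in> pverts T - ?D" and x: "x \<in> ?D" and y: "y \<in> ?D" and wx: "(w, x) \<in> parcs T"
  obtain W X Y where W: "W \<in> blocks T" "w \<in> W" and X: "X \<in> blocks T" "x \<in> X" "X \<inter> C \<noteq> {}"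
    and Y: "Y \<in> blocks T" "y \<in> Y" "Y \<inter> C \<noteq> {}"
    using w x y Union_blocks by blast
  have WC: "W \<inter> C = {}"
    using w W by blast
  then have ne: "W \<noteq> X" "W \<noteq> Y"
    using X(3) Y(3) by blast+
  obtain w' x' y' where w': "w' \<in> W" "w' \<in> U" and x': "x' \<in> X" "x' \<in> C" and y': "y' \<in> Y" "y' \<in> C"
    using U(2)[OF W(1)] X(3) Y(3) by blast
  have "(w', x') \<in> parcs T"
    using block_arcs[OF W(1) X(1) ne(1) W(2) w'(1) X(2) x'(1)] wx by blast
  then have "(w', x') \<in> parcs (T \<restriction>\<^sub>T U)"
    using CU x'(2) w'(2) by auto
  moreover have "w' \<in> pverts (T \<restriction>\<^sub>T U)" "w' \<notin> C"
    using w' WC by auto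
  ultimately have "(w', y') \<in> parcs (T \<restriction>\<^sub>T U)"
    using C x'(2) y'(2) unfolding transitive_module_def by blast
  then have "(w', y') \<in> parcs T"
    by simp
  then show "(w, y) \<in> parcs T"
    using block_arcs[OF W(1) Y(1) ne(2) W(2) w'(1) Y(2) y'(1)] by blast
qed

end

text \<open>A transitive module of the restriction containing the trace of \<open>B\<close>
  saturates to one of \<open>T\<close> containing \<open>B\<close>, hence to \<open>B\<close>.
  Shrinking blocks without emptying them therefore never merges them.\<close>

lemma blocks_restrict:
  assumes T: "tournament T" and U: "U \<subseteq> pverts T" "\<And>B. B \<in> blocks T \<Longrightarrow> B \<inter> U \<noteq> {}"
  shows "blocks (T \<restriction>\<^sub>T U) = (\<lambda>B. B \<inter> U) ` blocks T"
proof -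
  have tU: "tournament (T \<restriction>\<^sub>T U)"
    by (rule tournament_restrict[OF T U(1)])
  have mem: "B \<inter> U \<in> blocks (T \<restriction>\<^sub>T U)" if B: "B \<in> blocks T" for B
    unfolding blocks_iff_maximal[OF tU]
  proof (intro conjI allI impI)
    show "transitive_module (T \<restriction>\<^sub>T U) (B \<inter> U)"
      by (rule transitive_module_restrict[OF T transitive_module_block[OF T B] U(1)])
    show "B \<inter> U \<noteq> {}"
      by (rule U(2)[OF B])
    fix C assume C: "transitive_module (T \<restriction>\<^sub>T U) C" "B \<inter> U \<subseteq> C"
    let ?D = "\<Union>{B \<in> blocks T. B \<inter> C \<noteq> {}}"
    have "B \<inter> C \<noteq> {}"
      using U(2)[OF B] C(2) by blast
    then have "B \<subseteq> ?D"
      using B by blast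
    then have "?D = B"
      using transitive_module_saturate[OF T U C(1)] B blocks_iff_maximal[OF T] by blast
    moreover have CU: "C \<subseteq> U"
      using C(1) by (simp add: transitive_module_def)
    then have "C \<subseteq> ?D"
      using Union_blocks[OF T] U(1) by blast
    ultimately show "C = B \<inter> U"
      using C(2) CU by blast
  qed
  moreover have "D \<in> (\<lambda>B. B \<inter> U) ` blocks T" if D: "D \<in> blocks (T \<restriction>\<^sub>T U)" for D
  proof -
    obtain x where x: "x \<in> D"
      using block_nonempty[OF tU D] by blast
    then have xU: "x \<in> U"
      using block_subset[OF tU D] by auto
    then obtain B where B: "B \<in> blocks T" "x \<in> B"
      using U(1) Union_blocks[OF T] by blast
    then have "D = B \<inter> U"
      using blocks_disjoint[OF tU D mem[OF B(1)]] x xU by blast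
    with B(1) show ?thesis by blast
  qed
  ultimately show ?thesis
    by blast
qed

lemma transitive_module_image:
  assumes S: "tournament S" and T: "tournament T" and g: "embeds S T g" "pverts T = g ` pverts S"
    and B: "transitive_module S B"
  shows "transitive_module T (g ` B)"
  unfolding transitive_module_def
proof (intro conjI ballI impI)
  have BV: "B \<subseteq> pverts S"
    using B by (simp add: transitive_module_def)
  then show "g ` B \<subseteq> pverts T"
    using g(2) by blast
  note iff = embeds_iff[OF S T g(1)]
  show "acyclic_on T (g ` B)"
    unfolding acyclic_on_def
  proof (intro ballI impI)
    fix x y z assume "x \<in> g ` B" "y \<in> g ` B" "z \<in> g ` B" and xyz: "(x, y) \<in> parcs T" "(y, z) \<in> parcs T"
    then obtain a b c where abc: "x = g a" "a \<in> B" "y = g b" "b \<in> B" "z = g c" "c \<in> B"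
      by blast
    then have V: "a \<in> pverts S" "b \<in> pverts S" "c \<in> pverts S"
      using BV by blast+
    have "(c, a) \<notin> parcs S"
      using xyz abc iff[OF V(1,2)] iff[OF V(2,3)] B unfolding transitive_module_def acyclic_on_def by blast
    then show "(z, x) \<notin> parcs T"
      using abc iff[OF V(3,1)] by blast
  qed
  fix w x y assume "w \<in> pverts T - g ` B" "x \<in> g ` B" "y \<in> g ` B" and wx: "(w, x) \<in> parcs T"
  then obtain a b c where abc: "w = g a" "a \<in> pverts S" "a \<notin> B" "x = g b" "b \<in> B" "y = g c" "c \<in> B"
    using g(2) by blast
  then have V: "b \<in> pverts S" "c \<in> pverts S"
    using BV by blast+
  have "(a, c) \<in> parcs S"
    using wx abc iff[OF abc(2) V(1)] transitive_moduleD(1)[OF S B abc(2,3,5,7)] by blast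
  then show "(w, y) \<in> parcs T"
    using abc iff[OF abc(2) V(2)] by blast
qed

text \<open>The set of block sizes is the invariant behind the lower bound. Isomorphisms and their
  inverses carry transitive modules to transitive modules, hence maximal ones to maximal
  ones.\<close>

lemma block_sizes_subset:
  assumes S: "tournament S" and iso: "S \<cong>\<^sub>T T"
  shows "card ` blocks S \<subseteq> card ` blocks T"
proof
  have T: "tournament T"
    by (rule iso_tournament[OF iso S])
  obtain g where g: "embeds S T g" "pverts T = g ` pverts S" "inj_on g (pverts S)"
    using iso by (rule iso_embedsE)
  let ?h = "inv_into (pverts S) g"
  have h: "embeds T S ?h" "pverts S = ?h ` pverts T"
    using embeds_inv_into[OF S T g(1,2)] g(2,3) by (simp_all add: inv_into_image_cancel)
  fix k assume "k \<in> card ` blocks S"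
  then obtain B where B: "B \<in> blocks S" "k = card B"
    by blast
  have BV: "B \<subseteq> pverts S"
    by (rule block_subset[OF S B(1)])
  have "g ` B \<in> blocks T"
    unfolding blocks_iff_maximal[OF T]
  proof (intro conjI allI impI)
    show "transitive_module T (g ` B)"
      by (rule transitive_module_image[OF S T g(1,2) transitive_module_block[OF S B(1)]])
    show "g ` B \<noteq> {}"
      using block_nonempty[OF S B(1)] by blast
    fix C assume C: "transitive_module T C" "g ` B \<subseteq> C"
    have CV: "C \<subseteq> g ` pverts S"
      using C(1) g(2) by (simp add: transitive_module_def)
    have "B = ?h ` g ` B"
      using inv_into_image_cancel[OF g(3) BV] by simp
    then have "B \<subseteq> ?h ` C"
      using C(2) by blast
    then have "?h ` C = B"
      using transitive_module_image[OF T S h C(1)] B(1) blocks_iff_maximal[OF S] by blast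
    then show "C = g ` B"
      using image_inv_into_cancel[OF refl CV] by simp
  qed
  moreover have "card (g ` B) = k"
    using B(2) card_image[OF inj_on_subset[OF g(3) BV]] by simp
  ultimately show "k \<in> card ` blocks T"
    by blast
qed

lemma iso_block_sizes:
  assumes "tournament S" "S \<cong>\<^sub>T T"
  shows "card ` blocks S = card ` blocks T"
  using block_sizes_subset[OF assms] block_sizes_subset[OF iso_tournament[OF assms(2,1)] iso_sym[OF assms(2,1)]]
  by blast

subsection \<open>Tournaments with boundedly many blocks\<close>

text \<open>The rank counts predecessors inside \<open>B\<close>. Along an arc, transitivity keeps
  all predecessors and the tail is a new one, so the rank grows strictly.\<close>

lemma ex_rank:
  assumes T: "tournament T" and B: "acyclic_on T B" "B \<subseteq> pverts T"
  defines "r \<equiv> \<lambda>v. card {u \<in> B. (u, v) \<in> parcs T}"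
  shows "\<And>u v. u \<in> B \<Longrightarrow> v \<in> B \<Longrightarrow> (u, v) \<in> parcs T \<longleftrightarrow> r u < r v" and "bij_betw r B {..<card B}"
proof -
  have fin: "finite B"
    using B(2) tournament_finite[OF T] finite_subset by blast
  have less: "r u < r v" if uv: "u \<in> B" "v \<in> B" "(u, v) \<in> parcs T" for u v
  proof -
    have "{w \<in> B. (w, u) \<in> parcs T} \<subset> {w \<in> B. (w, v) \<in> parcs T}"
    proof (intro psubsetI subsetI)
      fix w assume w: "w \<in> {w \<in> B. (w, u) \<in> parcs T}"
      then have "w \<noteq> v" "(v, w) \<notin> parcs T"
        using uv B(1) tournament_asym[OF T] unfolding acyclic_on_def by blast+
      then show "w \<in> {w \<in> B. (w, v) \<in> parcs T}"
        using w uv B(2) tournament_total[OF T, of w v] by blast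
    next
      show "{w \<in> B. (w, u) \<in> parcs T} \<noteq> {w \<in> B. (w, v) \<in> parcs T}"
        using uv tournament_irrefl[OF T] by blast
    qed
    then show ?thesis
      unfolding r_def using fin by (intro psubset_card_mono) auto
  qed
  show iff: "(u, v) \<in> parcs T \<longleftrightarrow> r u < r v" if uv: "u \<in> B" "v \<in> B" for u v
  proof
    assume "r u < r v"
    then have "u \<noteq> v" "(v, u) \<notin> parcs T"
      using less[OF uv(2,1)] by auto
    then show "(u, v) \<in> parcs T"
      using tournament_total[OF T, of u v] uv B(2) by blast
  qed (use less uv in blast)
  have inj: "inj_on r B"
  proof (rule inj_onI)
    fix u v assume uv: "u \<in> B" "v \<in> B" "r u = r v"
    then have "(u, v) \<notin> parcs T" "(v, u) \<notin> parcs T"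
      using iff[of u v] iff[of v u] by simp_all
    then show "u = v"
      using tournament_total[OF T, of u v] uv B(2) by blast
  qed
  moreover have "r ` B \<subseteq> {..<card B}"
  proof
    fix k assume "k \<in> r ` B"
    then obtain v where v: "v \<in> B" "k = r v"
      by blast
    then have "{u \<in> B. (u, v) \<in> parcs T} \<subset> B"
      using tournament_irrefl[OF T] by blast
    then show "k \<in> {..<card B}"
      unfolding v(2) r_def using fin psubset_card_mono by blast
  qed
  then have "r ` B = {..<card B}"
    by (rule card_subset_eq[OF finite_lessThan]) (simp add: card_image[OF inj])
  ultimately show "bij_betw r B {..<card B}"
    by (simp add: bij_betw_def)
qed

text \<open>\<open>T\<close> arises from \<open>m\<close> vertices with arcs \<open>R\<close> by replacing vertex \<open>i\<close> by a chain of length \<open>s i\<close>.\<close>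

definition blow_up :: "nat \<Rightarrow> (nat \<times> nat) set \<Rightarrow> (nat \<Rightarrow> nat) \<Rightarrow> 'a pair_pre_digraph \<Rightarrow> bool" where
  "blow_up m R s T \<longleftrightarrow> (\<exists>h. inj_on h (pverts T) \<and> h ` pverts T = Sigma {..<m} (\<lambda>i. {..<s i}) \<and>
     (\<forall>u\<in>pverts T. \<forall>v\<in>pverts T. (u, v) \<in> parcs T \<longleftrightarrow>
        (if fst (h u) = fst (h v) then snd (h u) < snd (h v) else (fst (h u), fst (h v)) \<in> R)))"

lemma blow_up_iso:
  assumes S: "tournament S" "blow_up m R s S" and T: "tournament T" "blow_up m R s T"
  shows "S \<cong>\<^sub>T T"
proof -
  let ?arc = "\<lambda>p q. if fst p = fst q then snd p < snd q else (fst p, fst q) \<in> R"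
  from S(2) obtain h where h: "h ` pverts S = Sigma {..<m} (\<lambda>i. {..<s i})"
    "\<And>u v. u \<in> pverts S \<Longrightarrow> v \<in> pverts S \<Longrightarrow> (u, v) \<in> parcs S \<longleftrightarrow> ?arc (h u) (h v)"
    unfolding blow_up_def by blast
  from T(2) obtain k where k: "inj_on k (pverts T)" "k ` pverts T = Sigma {..<m} (\<lambda>i. {..<s i})"
    "\<And>u v. u \<in> pverts T \<Longrightarrow> v \<in> pverts T \<Longrightarrow> (u, v) \<in> parcs T \<longleftrightarrow> ?arc (k u) (k v)"
    unfolding blow_up_def by blast
  define g where "g u = inv_into (pverts T) k (h u)" for u
  have g: "g u \<in> pverts T" "k (g u) = h u" if "u \<in> pverts S" for u
  proof -
    have "h u \<in> k ` pverts T"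
      using that h(1) k(2) by blast
    then show "g u \<in> pverts T" "k (g u) = h u"
      unfolding g_def by (rule inv_into_into, rule f_inv_into_f)
  qed
  have "embeds S T g"
    unfolding embeds_def
  proof (intro conjI allI impI)
    show "g ` pverts S \<subseteq> pverts T"
      using g(1) by blast
    fix u v assume uv: "(u, v) \<in> parcs S"
    then have V: "u \<in> pverts S" "v \<in> pverts S"
      using tournament_verts[OF S(1)] by blast+
    show "(g u, g v) \<in> parcs T"
      using uv unfolding k(3)[OF g(1)[OF V(1)] g(1)[OF V(2)]] h(2)[OF V] g(2)[OF V(1)] g(2)[OF V(2)] .
  qed
  moreover have "pverts T \<subseteq> g ` pverts S"
  proof
    fix v assume v: "v \<in> pverts T"
    then obtain u where u: "u \<in> pverts S" "h u = k v"
      using h(1) k(2) by (metis (no_types, lifting) imageE imageI)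
    then have "g u = v"
      using inj_onD[OF k(1) _ g(1)[OF u(1)] v] g(2)[OF u(1)] by simp
    with u(1) show "v \<in> g ` pverts S"
      by blast
  qed
  moreover have "g ` pverts S \<subseteq> pverts T"
    using g(1) by blast
  ultimately show ?thesis
    using iso_tournamentI[OF S(1) T(1)] by blast
qed

lemma ex_blow_up:
  assumes T: "tournament T"
  obtains R s where "R \<subseteq> {..<card (blocks T)} \<times> {..<card (blocks T)}"
    and "blow_up (card (blocks T)) R s T"
    and "sum s {..<card (blocks T)} = card (pverts T)"
    and "\<And>N. card {i \<in> {..<card (blocks T)}. N \<le> s i} = card {B \<in> blocks T. N \<le> card B}"
proof -
  let ?m = "card (blocks T)"
  obtain e where e: "bij_betw e (blocks T) {..<?m}"
    using ex_bij_betw_finite_nat[OF finite_blocks[OF T]] by (auto simp: atLeast0LessThan)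
  define b where "b = inv_into (blocks T) e"
  have b: "bij_betw b {..<?m} (blocks T)"
    unfolding b_def by (rule bij_betw_inv_into[OF e])
  have be: "b (e B) = B" if "B \<in> blocks T" for B
    unfolding b_def using e that by (simp add: bij_betw_def)
  define s where "s i = card (b i)" for i
  \<comment> \<open>\<open>R\<close> also contains diagonal pairs of blocks with an inner arc. These
    are harmless, since \<open>blow_up\<close> orders vertices of the same block by rank.\<close>
  define R where "R = {(e B, e C) | B C. B \<in> blocks T \<and> C \<in> blocks T \<and> (\<exists>x\<in>B. \<exists>y\<in>C. (x, y) \<in> parcs T)}"
  define bl where "bl v = (THE B. B \<in> blocks T \<and> v \<in> B)" for v
  have bl_eq: "bl v = B" if "B \<in> blocks T" "v \<in> B" for B v
    unfolding bl_def by (rule the_equality) (use that blocks_disjoint[OF T] in blast)+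
  have bl: "bl v \<in> blocks T" "v \<in> bl v" if v: "v \<in> pverts T" for v
  proof -
    obtain B where "B \<in> blocks T" "v \<in> B"
      using v Union_blocks[OF T] by blast
    then show "bl v \<in> blocks T" "v \<in> bl v"
      using bl_eq by simp_all
  qed
  define r where "r v = card {u \<in> bl v. (u, v) \<in> parcs T}" for v
  have r: "bij_betw r B {..<card B}" "\<And>u v. u \<in> B \<Longrightarrow> v \<in> B \<Longrightarrow> (u, v) \<in> parcs T \<longleftrightarrow> r u < r v"
    if B: "B \<in> blocks T" for B
  proof -
    have m: "acyclic_on T B" "B \<subseteq> pverts T"
      using transitive_module_block[OF T B] by (simp_all add: transitive_module_def)
    have eq: "r v = card {u \<in> B. (u, v) \<in> parcs T}" if "v \<in> B" for v
      by (simp add: r_def bl_eq[OF B that])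
    show "bij_betw r B {..<card B}"
      using ex_rank(2)[OF T m] bij_betw_cong[of B r, OF eq] by blast
    show "(u, v) \<in> parcs T \<longleftrightarrow> r u < r v" if "u \<in> B" "v \<in> B" for u v
      using ex_rank(1)[OF T m that] eq that by simp
  qed
  define h where "h v = (e (bl v), r v)" for v
  have e_inj: "e B = e C \<longleftrightarrow> B = C" if "B \<in> blocks T" "C \<in> blocks T" for B C
    using e that by (auto simp: bij_betw_def inj_on_def)
  have "inj_on h (pverts T)"
  proof (rule inj_onI)
    fix u v assume uv: "u \<in> pverts T" "v \<in> pverts T" "h u = h v"
    then have "bl u = bl v" "r u = r v"
      using e_inj[OF bl(1) bl(1)] by (simp_all add: h_def)
    then show "u = v"
      using r(1)[OF bl(1)[OF uv(1)]] bl(2)[OF uv(1)] bl(2)[OF uv(2)] unfolding bij_betw_def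
      by (metis inj_onD)
  qed
  moreover have "h ` pverts T = Sigma {..<?m} (\<lambda>i. {..<s i})"
  proof (intro subset_antisym subsetI)
    fix p assume "p \<in> h ` pverts T"
    then obtain v where v: "v \<in> pverts T" "p = h v"
      by blast
    have "e (bl v) < ?m"
      using e bl(1)[OF v(1)] by (auto simp: bij_betw_def)
    moreover have "r v < s (e (bl v))"
      using r(1)[OF bl(1)[OF v(1)]] bl(2)[OF v(1)] unfolding s_def be[OF bl(1)[OF v(1)]] bij_betw_def by blast
    ultimately show "p \<in> Sigma {..<?m} (\<lambda>i. {..<s i})"
      by (simp add: v(2) h_def)
  next
    fix p assume "p \<in> Sigma {..<?m} (\<lambda>i. {..<s i})"
    then obtain i j where p: "p = (i, j)" "i < ?m" "j < card (b i)"
      by (auto simp: s_def)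
    then have B: "b i \<in> blocks T"
      using b by (auto simp: bij_betw_def)
    then have "j \<in> r ` b i"
      using r(1)[OF B] p(3) by (simp add: bij_betw_def)
    then obtain v where v: "v \<in> b i" "j = r v"
      by blast
    have "e (b i) = i"
      unfolding b_def using bij_betw_inv_into_right[OF e] p(2) by simp
    then have "p = h v"
      using v p(1) bl_eq[OF B v(1)] by (simp add: h_def)
    moreover have "v \<in> pverts T"
      using block_subset[OF T B] v(1) by blast
    ultimately show "p \<in> h ` pverts T"
      by blast
  qed
  moreover have "(u, v) \<in> parcs T \<longleftrightarrow>
      (if fst (h u) = fst (h v) then snd (h u) < snd (h v) else (fst (h u), fst (h v)) \<in> R)"
    if uv: "u \<in> pverts T" "v \<in> pverts T" for u v
  proof (cases "bl u = bl v")
    case True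
    then show ?thesis
      using r(2)[OF bl(1)[OF uv(1)], of u v] bl(2)[OF uv(1)] bl(2)[OF uv(2)] by (simp add: h_def)
  next
    case False
    have "(e (bl u), e (bl v)) \<in> R \<longleftrightarrow> (\<exists>x\<in>bl u. \<exists>y\<in>bl v. (x, y) \<in> parcs T)"
      unfolding R_def using e_inj bl(1)[OF uv(1)] bl(1)[OF uv(2)] by auto
    also have "\<dots> \<longleftrightarrow> (u, v) \<in> parcs T"
      using block_arcs[OF T bl(1)[OF uv(1)] bl(1)[OF uv(2)] False] bl(2)[OF uv(1)] bl(2)[OF uv(2)] by blast
    finally show ?thesis
      using False e_inj[OF bl(1)[OF uv(1)] bl(1)[OF uv(2)]] by (simp add: h_def)
  qed
  ultimately have "blow_up ?m R s T"
    unfolding blow_up_def by blast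
  moreover have "R \<subseteq> {..<?m} \<times> {..<?m}"
    using e by (auto simp: R_def bij_betw_def)
  moreover have "sum s {..<?m} = card (pverts T)"
  proof -
    have "sum s {..<?m} = sum card (blocks T)"
      unfolding s_def using sum.reindex_bij_betw[OF b, of card] by simp
    also have "\<dots> = card (\<Union>(blocks T))"
      by (rule card_Union_disjoint[symmetric])
        (use blocks_disjoint[OF T] finite_block[OF T] in \<open>auto simp: pairwise_def disjnt_def\<close>)
    finally show ?thesis
      by (simp add: Union_blocks[OF T])
  qed
  moreover have "card {i \<in> {..<?m}. N \<le> s i} = card {B \<in> blocks T. N \<le> card B}" for N
  proof (rule bij_betw_same_card[of b])
    show "bij_betw b {i \<in> {..<?m}. N \<le> s i} {B \<in> blocks T. N \<le> card B}"
    proof (rule bij_betw_imageI)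
      show "inj_on b {i \<in> {..<?m}. N \<le> s i}"
        using b by (auto simp: bij_betw_def inj_on_def)
      have "B \<in> b ` {i \<in> {..<?m}. N \<le> s i}" if B: "B \<in> blocks T" "N \<le> card B" for B
      proof -
        obtain i where "i < ?m" "B = b i"
          using bij_betw_imp_surj_on[OF b] B(1) by blast
        with B(2) show ?thesis
          by (simp add: s_def)
      qed
      moreover have "b i \<in> blocks T" if "i < ?m" for i
        using bij_betwE[OF b] that by blast
      ultimately show "b ` {i \<in> {..<?m}. N \<le> s i} = {B \<in> blocks T. N \<le> card B}"
        by (auto simp: s_def)
    qed
  qed
  ultimately show thesis
    using that by blast
qed

section \<open>Upper bound on the speed from descriptions by blocks\<close>

lemma prod_size_bounds_le:
  fixes J I :: "nat set"
  assumes "finite J" "card J \<le> M" "card (J \<inter> I) \<le> c"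
  shows "(\<Prod>i\<in>J. if i \<in> I then Suc n else N) \<le> Suc n ^ c * Suc N ^ M"
proof -
  have "(\<Prod>i\<in>J. if i \<in> I then Suc n else N) = Suc n ^ card (J \<inter> I) * N ^ card (J \<inter> - I)"
    using prod.If_cases[OF assms(1), of "\<lambda>i. i \<in> I" "\<lambda>_. Suc n" "\<lambda>_. N"] by simp
  also have "\<dots> \<le> Suc n ^ c * Suc N ^ M"
  proof (rule mult_le_mono)
    show "Suc n ^ card (J \<inter> I) \<le> Suc n ^ c"
      using assms(3) by (intro power_increasing) auto
    have "card (J \<inter> - I) \<le> M"
      using assms(1,2) card_mono[of J "J \<inter> - I"] by auto
    \<comment> \<open>Passing to \<open>Suc N\<close> keeps the bound valid for
      \<open>N = 0\<close>, where powers are not monotone in the exponent.\<close>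
    then have "Suc N ^ card (J \<inter> - I) \<le> Suc N ^ M"
      by (intro power_increasing) auto
    moreover have "N ^ card (J \<inter> - I) \<le> Suc N ^ card (J \<inter> - I)"
      by (intro power_mono) auto
    ultimately show "N ^ card (J \<inter> - I) \<le> Suc N ^ M"
      by linarith
  qed
  finally show ?thesis .
qed

text \<open>One large size is determined by the others and the total, which saves a factor \<open>n\<close>.\<close>

lemma card_sizes_le:
  fixes m n d M N :: nat
  assumes m: "m \<le> M" and n: "M * N < n"
  defines "X \<equiv> {s \<in> {..<m} \<rightarrow>\<^sub>E {..n}. sum s {..<m} = n \<and> card {i \<in> {..<m}. N \<le> s i} \<le> d}"
  shows "finite X" "card X \<le> 2 ^ M * (Suc n ^ (d - 1) * Suc N ^ M)"
proof -
  have finE: "finite ({..<m} \<rightarrow>\<^sub>E {..n})"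
    by (intro finite_PiE) auto
  show fin: "finite X"
    unfolding X_def by (rule finite_subset[OF _ finE]) blast
  \<comment> \<open>The sizes are split by the set \<open>I\<close> of indices with size at least
    \<open>N\<close>. There are at most \<open>2 ^ M\<close> such sets, and a size outside
    \<open>I\<close> has at most \<open>N\<close> values.\<close>
  define Y where "Y I = {s \<in> X. {i \<in> {..<m}. N \<le> s i} = I}" for I
  have Y: "card (Y I) \<le> Suc n ^ (d - 1) * Suc N ^ M" if I: "I \<subseteq> {..<m}" for I
  proof (cases "Y I = {}")
    case False
    then obtain s where s: "s \<in> X" "{i \<in> {..<m}. N \<le> s i} = I"
      unfolding Y_def by blast
    then have cI: "card I \<le> d" and sn: "sum s {..<m} = n"
      unfolding X_def by auto
    \<comment> \<open>Were all sizes below \<open>N\<close>, the total would be at most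
      \<open>M * N < n\<close>. So there is a large size, at \<open>i0\<close>, which can be left to
      the total.\<close>
    have "I \<noteq> {}"
    proof
      assume "I = {}"
      then have "s i \<le> N" if "i < m" for i
      proof -
        have "\<not> N \<le> s i"
          using s(2) \<open>I = {}\<close> that by blast
        then show ?thesis by simp
      qed
      then have "sum s {..<m} \<le> of_nat (card {..<m}) * N"
        by (intro sum_bounded_above) simp
      then show False
        using sn n m mult_le_mono1[OF m, of N] by simp
    qed
    then obtain i0 where i0: "i0 \<in> I"
      by blast
    let ?J = "{..<m} - {i0}"
    let ?F = "\<lambda>i. if i \<in> I then {..n} else {..<N}"
    have i0m: "i0 < m"
      using i0 I by blast
    have split: "sum s {..<m} = s i0 + sum s ?J" for s :: "nat \<Rightarrow> nat"
      using i0m by (simp add: sum.remove)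
    have "inj_on (\<lambda>s. restrict s ?J) (Y I)"
    proof (rule inj_onI)
      fix s t assume st: "s \<in> Y I" "t \<in> Y I" and eq: "restrict s ?J = restrict t ?J"
      then have sE: "s \<in> {..<m} \<rightarrow>\<^sub>E {..n}" "t \<in> {..<m} \<rightarrow>\<^sub>E {..n}" and sums: "sum s {..<m} = n" "sum t {..<m} = n"
        unfolding Y_def X_def by auto
      have J: "s i = t i" if "i \<in> ?J" for i
        using fun_cong[OF eq, of i] that by (simp only: restrict_apply' if_True)
      then have "sum s ?J = sum t ?J"
        by (intro sum.cong) auto
      then have "s i0 = t i0"
        using sums split[of s] split[of t] by linarith
      with J have "s i = t i" if "i \<in> {..<m}" for i
        using that by (cases "i = i0") blast+
      with sE show "s = t"
        by (rule PiE_ext)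
    qed
    moreover have "(\<lambda>s. restrict s ?J) ` Y I \<subseteq> PiE ?J ?F"
    proof (intro image_subsetI restrict_PiE_iff[THEN iffD2] ballI)
      fix s i assume sY: "s \<in> Y I" and i: "i \<in> ?J"
      have "s i \<le> n"
        using sY i PiE_mem[of s "{..<m}" "\<lambda>_. {..n}" i] unfolding Y_def X_def by simp
      moreover have "N \<le> s i \<longleftrightarrow> i \<in> I"
        using sY i unfolding Y_def by blast
      ultimately show "s i \<in> ?F i"
        by auto
    qed
    moreover have "finite (PiE ?J ?F)"
      by (intro finite_PiE) auto
    ultimately have "card (Y I) \<le> card (PiE ?J ?F)"
      by (rule card_inj_on_le)
    also have "\<dots> = (\<Prod>i\<in>?J. if i \<in> I then Suc n else N)"
      by (subst card_PiE) (simp_all add: if_distrib[of card] cong: if_cong)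
    also have "\<dots> \<le> Suc n ^ (d - 1) * Suc N ^ M"
    proof (rule prod_size_bounds_le)
      show "card ?J \<le> M"
        using m card_mono[of "{..<m}" ?J] by auto
      have finI: "finite I"
        using I finite_subset by blast
      have "?J \<inter> I \<subseteq> I - {i0}"
        by blast
      then have "card (?J \<inter> I) \<le> card (I - {i0})"
        using finI by (intro card_mono) auto
      then show "card (?J \<inter> I) \<le> d - 1"
        using cI i0 finI by (simp add: card_Diff_singleton)
    qed simp
    finally show ?thesis .
  qed simp
  have "X \<subseteq> (\<Union>I\<in>Pow {..<m}. Y I)"
  proof
    fix s assume "s \<in> X"
    then have "s \<in> Y {i \<in> {..<m}. N \<le> s i}"
      unfolding Y_def by blast
    moreover have "{i \<in> {..<m}. N \<le> s i} \<in> Pow {..<m}"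
      by blast
    ultimately show "s \<in> (\<Union>I\<in>Pow {..<m}. Y I)"
      by blast
  qed
  moreover have "finite (Y I)" for I
    unfolding Y_def using fin by simp
  then have "finite (\<Union>I\<in>Pow {..<m}. Y I)"
    by simp
  ultimately have "card X \<le> card (\<Union>I\<in>Pow {..<m}. Y I)"
    by (rule card_mono[rotated])
  also have "\<dots> \<le> (\<Sum>I\<in>Pow {..<m}. card (Y I))"
    by (rule card_UN_le) simp
  also have "\<dots> \<le> of_nat (card (Pow {..<m})) * (Suc n ^ (d - 1) * Suc N ^ M)"
    by (rule sum_bounded_above) (use Y in blast)
  also have "\<dots> \<le> 2 ^ M * (Suc n ^ (d - 1) * Suc N ^ M)"
    using m by (simp add: card_Pow power_increasing)
  finally show "card X \<le> 2 ^ M * (Suc n ^ (d - 1) * Suc N ^ M)" .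
qed

text \<open>The number \<open>m\<close> of blocks, the arcs \<open>R\<close> between them and the
  sizes \<open>s\<close> determine the tournament. The first two have boundedly many values, so only
  the sizes contribute a power of \<open>n\<close>.\<close>

lemma speed_upper_bound:
  assumes P: "hereditary P" and M: "\<And>T. T \<in> P \<Longrightarrow> card (blocks T) \<le> M"
    and d: "\<And>T. T \<in> P \<Longrightarrow> card {B \<in> blocks T. N \<le> card B} \<le> d" and n: "M * N < n"
  shows "speed P n \<le> Suc M * 2 ^ (M * M) * 2 ^ M * Suc N ^ M * Suc n ^ (d - 1)"
proof -
  let ?S = "\<lambda>m. {s \<in> {..<m} \<rightarrow>\<^sub>E {..n}. sum s {..<m} = n \<and> card {i \<in> {..<m}. N \<le> s i} \<le> d}"
  let ?X = "Sigma {..M} (\<lambda>m. Pow ({..<M} \<times> {..<M}) \<times> ?S m)"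
  let ?c = "2 ^ M * (Suc n ^ (d - 1) * Suc N ^ M)"
  have fin: "finite (?S m)" "card (?S m) \<le> ?c" if "m \<le> M" for m
    by (rule card_sizes_le[OF that n])+
  have "speed P n \<le> card ?X"
  proof (rule speed_le_card[OF P, of ?X n "\<lambda>(m, R, s). blow_up m R s"])
    show "finite ?X"
      using fin(1) by (intro finite_SigmaI) auto
    fix T assume T: "T \<in> P" "card (pverts T) = n"
    have tT: "tournament T"
      by (rule hereditary_tournament[OF P T(1)])
    let ?m = "card (blocks T)"
    obtain R s where R: "R \<subseteq> {..<?m} \<times> {..<?m}" and b: "blow_up ?m R s T" and s: "sum s {..<?m} = card (pverts T)"
      and big: "\<And>N. card {i \<in> {..<?m}. N \<le> s i} = card {B \<in> blocks T. N \<le> card B}"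
      using ex_blow_up[OF tT] by blast
    \<comment> \<open>Values of \<open>s\<close> beyond the last block are irrelevant; fixing them
      places \<open>s\<close> in a finite set of extensional functions.\<close>
    let ?s = "restrict s {..<?m}"
    have "Sigma {..<?m} (\<lambda>i. {..<?s i}) = Sigma {..<?m} (\<lambda>i. {..<s i})"
      by (rule Sigma_cong) auto
    then have "blow_up ?m R ?s T"
      using b unfolding blow_up_def by simp
    moreover have "?s \<in> ?S ?m"
    proof -
      have "s i \<le> n" if "i < ?m" for i
        using member_le_sum[of i "{..<?m}" s] that s T(2) by simp
      moreover have "{i \<in> {..<?m}. N \<le> ?s i} = {i \<in> {..<?m}. N \<le> s i}"
        by auto
      ultimately show ?thesis
        using s T(2) big[of N] d[OF T(1)] by auto
    qed
    moreover have "R \<in> Pow ({..<M} \<times> {..<M})"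
      using R M[OF T(1)] by fastforce
    ultimately show "\<exists>x\<in>?X. (case x of (m, R, s) \<Rightarrow> blow_up m R s) T"
      using M[OF T(1)] by (intro bexI[of _ "(?m, R, ?s)"]) simp_all
  next
    fix x and S T :: "nat pair_pre_digraph"
    assume ST: "S \<in> P" "T \<in> P"
      and b: "(case x of (m, R, s) \<Rightarrow> blow_up m R s) S" "(case x of (m, R, s) \<Rightarrow> blow_up m R s) T"
    obtain m R s where x: "x = (m, R, s)"
      by (cases x)
    then have "blow_up m R s S" "blow_up m R s T"
      using b by simp_all
    then show "S \<cong>\<^sub>T T"
      using blow_up_iso[OF hereditary_tournament[OF P ST(1)] _ hereditary_tournament[OF P ST(2)]] by blast
  qed
  also have "\<dots> = (\<Sum>m\<le>M. 2 ^ (M * M) * card (?S m))"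
    using fin(1) by (subst card_SigmaI) (simp_all add: card_cartesian_product card_Pow)
  also have "\<dots> \<le> of_nat (card {..M}) * (2 ^ (M * M) * ?c)"
    by (rule sum_bounded_above) (use fin(2) in simp)
  also have "\<dots> = Suc M * 2 ^ (M * M) * 2 ^ M * Suc N ^ M * Suc n ^ (d - 1)"
    by (simp add: algebra_simps)
  finally show ?thesis .
qed

section \<open>Lower bound on the speed from large blocks\<close>

lemma ex_restrict_block_sizes:
  assumes T: "tournament T" and z: "\<And>B. B \<in> blocks T \<Longrightarrow> 0 < z B \<and> z B \<le> card B"
  obtains U where "U \<subseteq> pverts T" "card U = sum z (blocks T)" "card ` blocks (T \<restriction>\<^sub>T U) = z ` blocks T"
proof -
  have "\<forall>B\<in>blocks T. \<exists>A. A \<subseteq> B \<and> card A = z B"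
    using z obtain_subset_with_card_n by metis
  from bchoice[OF this] obtain \<sigma> where "\<forall>B\<in>blocks T. \<sigma> B \<subseteq> B \<and> card (\<sigma> B) = z B" ..
  then have \<sigma>: "\<sigma> B \<subseteq> B" "card (\<sigma> B) = z B" if "B \<in> blocks T" for B
    using that by blast+
  define U where "U = (\<Union>B\<in>blocks T. \<sigma> B)"
  have BU: "B \<inter> U = \<sigma> B" if B: "B \<in> blocks T" for B
  proof (intro subset_antisym subsetI)
    fix x assume "x \<in> B \<inter> U"
    then obtain C where C: "C \<in> blocks T" "x \<in> \<sigma> C" "x \<in> B"
      unfolding U_def by blast
    then have "C = B"
      using blocks_disjoint[OF T C(1) B] \<sigma>(1)[OF C(1)] by blast
    with C(2) show "x \<in> \<sigma> B"
      by simp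
  qed (use \<sigma>(1)[OF B] B in \<open>auto simp: U_def\<close>)
  have UV: "U \<subseteq> pverts T"
    unfolding U_def using \<sigma>(1) block_subset[OF T] by blast
  moreover have "card U = sum z (blocks T)"
  proof -
    have "card U = (\<Sum>B\<in>blocks T. card (\<sigma> B))"
      unfolding U_def
    proof (rule card_UN_disjoint[OF finite_blocks[OF T]])
      show "\<forall>B\<in>blocks T. finite (\<sigma> B)"
        using \<sigma>(1) finite_block[OF T] finite_subset by blast
      show "\<forall>B\<in>blocks T. \<forall>C\<in>blocks T. B \<noteq> C \<longrightarrow> \<sigma> B \<inter> \<sigma> C = {}"
        using \<sigma>(1) blocks_disjoint[OF T] by blast
    qed
    then show ?thesis
      using \<sigma>(2) by simp
  qed
  moreover have "card ` blocks (T \<restriction>\<^sub>T U) = z ` blocks T"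
  proof -
    \<comment> \<open>No block is emptied, so the chosen subsets are exactly the blocks of the
      restriction.\<close>
    have "B \<inter> U \<noteq> {}" if "B \<in> blocks T" for B
      using BU[OF that] \<sigma>(2)[OF that] z[OF that] by (metis card.empty less_irrefl)
    then have "blocks (T \<restriction>\<^sub>T U) = (\<lambda>B. B \<inter> U) ` blocks T"
      by (rule blocks_restrict[OF T UV])
    also have "\<dots> = \<sigma> ` blocks T"
      using BU by (intro image_cong) simp_all
    finally show ?thesis
      using \<sigma>(2) by (simp add: image_image)
  qed
  ultimately show thesis
    using that by blast
qed

text \<open>
  With \<open>d\<close> blocks of size at least \<open>n\<close>, choose the sizes of the first \<open>d - 1\<close> of them freely in the
  disjoint windows \<open>{(i + 1) q..<(i + 2) q}\<close>, let the last one fill up and take one vertex from every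
  other block: the windows make the choice visible in the set of block sizes.
\<close>

lemma speed_lower_bound:
  assumes P: "hereditary P" "T \<in> P" and M: "card (blocks T) \<le> M" and d: "1 \<le> d"
    and big: "d \<le> card {B \<in> blocks T. n \<le> card B}" and q: "2 \<le> q" "(d * d + M) * q \<le> n"
  shows "q ^ (d - 1) \<le> speed P n"
proof -
  have T: "tournament T"
    by (rule hereditary_tournament[OF P])
  obtain D where D: "D \<subseteq> {B \<in> blocks T. n \<le> card B}" "card D = d" "finite D"
    using obtain_subset_with_card_n[OF big] by blast
  obtain e where e: "bij_betw e D {..<d}"
    using ex_bij_betw_finite_nat[OF D(3)] D(2) by (auto simp: atLeast0LessThan)
  have Dm: "d \<le> card (blocks T)"
    using card_mono[OF finite_blocks[OF T], of D] D(1,2) by auto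
  define small where "small = card (blocks T) - d"
  define w where "w t i = (i + 1) * q + t i" for t :: "nat \<Rightarrow> nat" and i
  \<comment> \<open>The last large block takes what the windows and the \<open>small\<close> other
    blocks leave. That the truncated subtraction cuts nothing off follows from the bound on
    \<open>q\<close>.\<close>
  define L where "L t = n - small - sum (w t) {..<d - 1}" for t
  define s where "s t i = (if i = d - 1 then L t else w t i)" for t i
  define z where "z t B = (if B \<in> D then s t (e B) else 1)" for t B
  define X where "X = {..<d - 1} \<rightarrow>\<^sub>E {..<q}"
  have tq: "t i < q" if "t \<in> X" "i < d - 1" for t i
    using that unfolding X_def by auto
  have wd: "w t i \<le> d * q" if "t \<in> X" "i < d - 1" for t i
  proof -
    have "w t i \<le> (i + 2) * q"
      using tq[OF that] by (simp add: w_def algebra_simps)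
    also have "\<dots> \<le> d * q"
      using that(2) by (intro mult_le_mono1) simp
    finally show ?thesis .
  qed
  have dn: "d * q \<le> n"
  proof -
    have "d * q \<le> (d * d + M) * q"
      using d by (intro mult_le_mono1) (simp add: trans_le_add1)
    then show ?thesis
      using q(2) by (rule le_trans)
  qed
  have L: "d * q \<le> L t" "L t \<le> n" "L t + sum (w t) {..<d - 1} + small = n" if t: "t \<in> X" for t
  proof -
    \<comment> \<open>The windows use at most \<open>(d - 1) * d * q\<close> vertices and the other
      blocks at most \<open>M * q\<close>. So \<open>(d * d + M) * q \<le> n\<close> leaves at least
      \<open>d * q\<close> for \<open>L t\<close>, which puts it above every window.\<close>
    have "sum (w t) {..<d - 1} \<le> of_nat (card {..<d - 1}) * (d * q)"
      by (rule sum_bounded_above) (use wd[OF t] in simp)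
    then have "sum (w t) {..<d - 1} + d * q \<le> (d - 1) * (d * q) + d * q"
      by simp
    also have "\<dots> = d * d * q"
      using d by (cases d) (simp_all add: algebra_simps)
    finally have "sum (w t) {..<d - 1} + d * q + small \<le> d * d * q + M"
      using M by (simp add: small_def)
    also have "\<dots> \<le> d * d * q + M * q"
      using q(1) by simp
    also have "\<dots> \<le> n"
      using q(2) by (simp add: algebra_simps)
    finally show "d * q \<le> L t" "L t \<le> n" "L t + sum (w t) {..<d - 1} + small = n"
      unfolding L_def by linarith+
  qed
  have z: "0 < z t B \<and> z t B \<le> card B" if t: "t \<in> X" and B: "B \<in> blocks T" for t B
  proof (cases "B \<in> D")
    case True
    then have "e B < d" "n \<le> card B"
      using e D(1) by (auto simp: bij_betw_def)
    moreover have "0 < L t"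
      by (rule less_le_trans[OF _ L(1)[OF t]]) (use d q(1) in simp)
    moreover have "0 < w t i" for i
      using q(1) by (simp add: w_def)
    moreover have "w t (e B) \<le> d * q" if "e B \<noteq> d - 1"
      using wd[OF t, of "e B"] that \<open>e B < d\<close> by simp
    moreover have "w t (e B) \<le> n" if "e B \<noteq> d - 1"
      using calculation(5)[OF that] dn by (rule le_trans)
    ultimately have "0 < s t (e B) \<and> s t (e B) \<le> card B"
      using L(2)[OF t] by (cases "e B = d - 1") (auto simp: s_def)
    with True show ?thesis
      by (simp add: z_def)
  next
    case False
    have "0 < card B"
      using block_nonempty[OF T B] finite_block[OF T B] by (simp add: card_gt_0_iff)
    with False show ?thesis
      by (simp add: z_def)
  qed
  have sum_z: "sum (z t) (blocks T) = n" if t: "t \<in> X" for t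
  proof -
    have "sum (z t) (blocks T) = sum (z t) D + sum (z t) (blocks T - D)"
      using sum.subset_diff[of D "blocks T" "z t"] D(1) finite_blocks[OF T] by (simp add: add.commute subset_iff)
    also have "sum (z t) (blocks T - D) = small"
      using card_Diff_subset[OF D(3), of "blocks T"] D(1,2) by (simp add: z_def small_def subset_iff)
    also have "sum (z t) D = sum (\<lambda>B. s t (e B)) D"
      by (simp add: z_def)
    also have "\<dots> = sum (s t) {..<d}"
      by (rule sum.reindex_bij_betw[OF e])
    also have "\<dots> = sum (s t) {..<d - 1} + s t (d - 1)"
      using d by (cases d) simp_all
    also have "\<dots> = sum (w t) {..<d - 1} + L t"
      by (simp add: s_def)
    finally show ?thesis
      using L(3)[OF t] by simp
  qed
  have "\<forall>t\<in>X. \<exists>U. U \<subseteq> pverts T \<and> card U = n \<and> card ` blocks (T \<restriction>\<^sub>T U) = z t ` blocks T"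
  proof
    fix t assume t: "t \<in> X"
    show "\<exists>U. U \<subseteq> pverts T \<and> card U = n \<and> card ` blocks (T \<restriction>\<^sub>T U) = z t ` blocks T"
      using ex_restrict_block_sizes[OF T z[OF t]] sum_z[OF t] by metis
  qed
  from bchoice[OF this] obtain U
    where "\<forall>t\<in>X. U t \<subseteq> pverts T \<and> card (U t) = n \<and> card ` blocks (T \<restriction>\<^sub>T U t) = z t ` blocks T" ..
  then have U: "U t \<subseteq> pverts T" "card (U t) = n" "card ` blocks (T \<restriction>\<^sub>T U t) = z t ` blocks T" if "t \<in> X" for t
    using that by blast+
  \<comment> \<open>A size in window \<open>i\<close> can only be \<open>w t i\<close>: size 1 is
    below all windows because \<open>q \<ge> 2\<close>, \<open>L t\<close> is above them, and
    different windows are disjoint.\<close>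
  have window: "k = w t i" if t: "t \<in> X" and i: "i < d - 1" and k: "k \<in> z t ` blocks T"
    and kw: "(i + 1) * q \<le> k" "k < (i + 2) * q" for t i k
  proof -
    obtain B where B: "k = z t B"
      using k by blast
    have "k \<noteq> 1"
      using kw(1) q(1) mult_le_mono1[of 1 "i + 1" q] by auto
    then have BD: "B \<in> D"
      using B by (simp add: z_def split: if_splits)
    then have "e B < d"
      using e by (auto simp: bij_betw_def)
    have "(i + 2) * q \<le> d * q"
      using i by (intro mult_le_mono1) simp
    then have "e B \<noteq> d - 1"
      using kw(2) L(1)[OF t] B BD by (auto simp: z_def s_def)
    then have eB: "e B < d - 1" "k = w t (e B)"
      using \<open>e B < d\<close> B BD by (auto simp: z_def s_def)
    have "(e B + 1) * q \<le> k" "k < (e B + 2) * q"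
      using eB(2) tq[OF t eB(1)] by (simp_all add: w_def)
    then have "(e B + 1) * q < (i + 2) * q" "(i + 1) * q < (e B + 2) * q"
      using kw by linarith+
    then have "e B = i"
      unfolding mult_less_cancel2 by simp
    with eB(2) show ?thesis
      by simp
  qed
  have "card X \<le> speed P n"
  proof (rule card_le_speed[OF P(1), of X "\<lambda>t. T \<restriction>\<^sub>T U t"])
    show "finite X"
      unfolding X_def by (intro finite_PiE) auto
    show "T \<restriction>\<^sub>T U t \<in> P \<and> card (pverts (T \<restriction>\<^sub>T U t)) = n" if "t \<in> X" for t
      using hereditary_restrict[OF P U(1)[OF that]] U(2)[OF that] by simp
    fix t t' assume t: "t \<in> X" "t' \<in> X" and iso: "T \<restriction>\<^sub>T U t \<cong>\<^sub>T T \<restriction>\<^sub>T U t'"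
    have eq: "z t ` blocks T = z t' ` blocks T"
      using iso_block_sizes[OF tournament_restrict[OF T U(1)[OF t(1)]] iso] U(3)[OF t(1)] U(3)[OF t(2)] by simp
    have "t i = t' i" if i: "i \<in> {..<d - 1}" for i
    proof -
      have "i < d"
        using i by simp
      then have "i \<in> e ` D"
        using bij_betw_imp_surj_on[OF e] by simp
      then obtain B where B: "B \<in> D" "e B = i"
        by blast
      then have "z t B = w t i"
        using i by (simp add: z_def s_def)
      moreover have "B \<in> blocks T"
        using B(1) D(1) by blast
      ultimately have "w t i \<in> z t' ` blocks T"
        using eq by (metis imageI)
      moreover have "(i + 1) * q \<le> w t i" "w t i < (i + 2) * q"
        using tq[OF t(1), of i] i by (simp_all add: w_def)
      ultimately have "w t i = w t' i"
        using window[OF t(2)] i by blast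
      then show ?thesis
        by (simp add: w_def)
    qed
    then show "t = t'"
      using t unfolding X_def by (intro PiE_ext[of t "{..<d - 1}" "\<lambda>_. {..<q}" t']) auto
  qed
  moreover have "card X = q ^ (d - 1)"
    unfolding X_def by (simp add: card_PiE)
  ultimately show ?thesis
    by simp
qed

lemma speed_bigtheta_power:
  assumes lower: "\<And>n. n0 \<le> n \<Longrightarrow> n ^ k \<le> c * speed P n"
    and upper: "\<And>n. n0 \<le> n \<Longrightarrow> speed P n \<le> C * n ^ k"
  shows "(\<lambda>n. real (speed P n)) \<in> \<Theta>(\<lambda>n. real n ^ k)"
proof (rule bigthetaI)
  show "(\<lambda>n. real (speed P n)) \<in> O(\<lambda>n. real n ^ k)"
  proof (rule bigoI[of _ "real C"])
    show "\<forall>\<^sub>F n in sequentially. norm (real (speed P n)) \<le> real C * norm (real n ^ k)"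
      using eventually_ge_at_top[of n0]
    proof eventually_elim
      case (elim n)
      have "real (speed P n) \<le> real (C * n ^ k)"
        using upper[OF elim] by (simp only: of_nat_le_iff)
      then show ?case by simp
    qed
  qed
  show "(\<lambda>n. real (speed P n)) \<in> \<Omega>(\<lambda>n. real n ^ k)"
    unfolding bigomega_iff_bigo
  proof (rule bigoI[of _ "real c"])
    show "\<forall>\<^sub>F n in sequentially. norm (real n ^ k) \<le> real c * norm (real (speed P n))"
      using eventually_ge_at_top[of n0]
    proof eventually_elim
      case (elim n)
      have "real (n ^ k) \<le> real (c * speed P n)"
        using lower[OF elim] by (simp only: of_nat_le_iff)
      then show ?case by simp
    qed
  qed
qed

text \<open>If \<open>d = 0\<close>, all blocks are smaller than a fixed \<open>N\<close>, so the
  tournaments have bounded size and the levels are eventually empty. Otherwise the exponent is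
  \<open>d - 1\<close>: the upper bound uses that at most \<open>d\<close> blocks reach the fixed
  size \<open>N\<close>, the lower bound that some member has \<open>d\<close> blocks of size at
  least \<open>n\<close>.\<close>

lemma polynomial_speed_if_boundedly_many_blocks:
  assumes P: "hereditary P" and M: "\<And>T. T \<in> P \<Longrightarrow> card (blocks T) \<le> M"
  shows "(\<forall>\<^sub>F n in sequentially. level P n = {}) \<or>
    (\<exists>k. (\<lambda>n. real (speed P n)) \<in> \<Theta>(\<lambda>n. real n ^ k))"
proof (cases "P = {}")
  case True
  then show ?thesis
    by (simp add: level_empty_iff)
next
  case False
  define big where "big N T = card {B \<in> blocks T. N \<le> card B}" for N and T :: "nat pair_pre_digraph"
  have bigM: "big N T \<le> M" if "T \<in> P" for N T
    using card_mono[OF finite_blocks[OF hereditary_tournament[OF P that]], of "{B \<in> blocks T. N \<le> card B}"] M[OF that]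
    by (auto simp: big_def)
  define D where "D = {d. \<forall>N. \<exists>T\<in>P. d \<le> big N T}"
  define d where "d = Max D"
  have "D \<subseteq> {..M}"
    using bigM unfolding D_def by (blast intro: le_trans)
  then have finD: "finite D"
    using finite_subset by blast
  have "0 \<in> D"
    using False by (auto simp: D_def)
  then have dD: "d \<in> D"
    unfolding d_def using Max_in[OF finD] by blast
  have "Suc d \<notin> D"
    using Max_ge[OF finD, of "Suc d"] by (auto simp: d_def)
  then obtain N where N: "\<And>T. T \<in> P \<Longrightarrow> big N T \<le> d"
    unfolding D_def by (auto simp: not_less_eq_eq)
  show ?thesis
  proof (cases "d = 0")
    case True
    have "card (pverts T) \<le> M * N" if T: "T \<in> P" for T
    proof -
      have tT: "tournament T"
        by (rule hereditary_tournament[OF P T])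
      have "{B \<in> blocks T. N \<le> card B} = {}"
        using N[OF T] True finite_blocks[OF tT] by (simp add: big_def)
      then have small: "card B \<le> N" if "B \<in> blocks T" for B
        using that by (metis (mono_tags, lifting) empty_Collect_eq linorder_le_cases)
      have "card (pverts T) \<le> (\<Sum>B\<in>blocks T. card B)"
        using card_Union_le_sum_card[of "blocks T"] Union_blocks[OF tT] finite_block[OF tT] by simp
      also have "\<dots> \<le> of_nat (card (blocks T)) * N"
        by (rule sum_bounded_above) (use small in blast)
      also have "\<dots> \<le> M * N"
        using M[OF T] by simp
      finally show ?thesis .
    qed
    then have "level P n = {}" if "M * N < n" for n
      using that by (auto simp: level_empty_iff dest: leD)
    then show ?thesis
      by (intro disjI1 eventually_mono[OF eventually_gt_at_top[of "M * N"]])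
  next
    case False
    let ?k = "d - 1" and ?K = "d * d + M"
    let ?C = "Suc M * 2 ^ (M * M) * 2 ^ M * Suc N ^ M"
    \<comment> \<open>This ensures both \<open>M * N < n\<close> for the upper bound and
      \<open>n div ?K \<ge> 2\<close> for the lower bound.\<close>
    let ?n0 = "Suc (M * N) + 2 * ?K"
    have "(\<lambda>n. real (speed P n)) \<in> \<Theta>(\<lambda>n. real n ^ ?k)"
    proof (rule speed_bigtheta_power)
      fix n assume n: "?n0 \<le> n"
      have "speed P n \<le> ?C * Suc n ^ ?k"
        by (rule speed_upper_bound[OF P M]) (use N n in \<open>simp_all add: big_def\<close>)
      also have "\<dots> \<le> ?C * (2 * n) ^ ?k"
        using n by (intro mult_le_mono2 power_mono) auto
      also have "\<dots> = ?C * 2 ^ ?k * n ^ ?k"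
        by (simp only: power_mult_distrib mult.assoc)
      finally show "speed P n \<le> ?C * 2 ^ ?k * n ^ ?k" .
      obtain T where T: "T \<in> P" "d \<le> big n T"
        using dD unfolding D_def by blast
      define q where "q = n div ?K"
      have K: "0 < ?K"
        using False by simp
      have q: "2 \<le> q" "?K * q \<le> n" "n \<le> 2 * ?K * q"
      proof -
        show q2: "2 \<le> q"
          unfolding q_def less_eq_div_iff_mult_less_eq[OF K] using n by simp
        show "?K * q \<le> n"
          by (simp add: q_def)
        have "?K \<le> ?K * q"
          using q2 by simp
        then have "n mod ?K \<le> ?K * q"
          by (rule less_imp_le[OF less_le_trans[OF mod_less_divisor[OF K]]])
        then have "?K * q + n mod ?K \<le> ?K * q + ?K * q"
          by (rule add_left_mono)
        then have "n \<le> ?K * q + ?K * q"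
          unfolding q_def by (simp only: mult_div_mod_eq)
        then show "n \<le> 2 * ?K * q"
          by (simp only: mult_2 distrib_right)
      qed
      have "q ^ ?k \<le> speed P n"
        by (rule speed_lower_bound[OF P T(1) M[OF T(1)]]) (use False T(2) q in \<open>simp_all add: big_def\<close>)
      have "n ^ ?k \<le> (2 * ?K * q) ^ ?k"
        using q(3) by (intro power_mono) auto
      also have "\<dots> = (2 * ?K) ^ ?k * q ^ ?k"
        by (simp only: power_mult_distrib)
      also have "\<dots> \<le> (2 * ?K) ^ ?k * speed P n"
        using \<open>q ^ ?k \<le> speed P n\<close> by (rule mult_le_mono2)
      finally show "n ^ ?k \<le> (2 * ?K) ^ ?k * speed P n" .
    qed
    then show ?thesis by blast
  qed
qed

section \<open>Unboundedly many blocks: all block tournaments or exponentially many words\<close>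

lemma cyclic_chain_le: "cyclic_chain T m c d w \<Longrightarrow> n \<le> m \<Longrightarrow> cyclic_chain T n c d w"
  unfolding cyclic_chain_def forward_def by (meson less_le_trans)

lemma block_tournaments_or_exponential:
  assumes P: "hereditary P" and unbounded: "\<And>K. \<exists>T\<in>P. K \<le> card (blocks T)"
  shows "block_tournaments \<subseteq> P \<or> (\<forall>n>0. 2 ^ (n - 1) \<le> n * speed P n)"
proof (rule disj_imp[THEN iffD2], intro impI allI)
  fix n :: nat
  assume "\<not> block_tournaments \<subseteq> P" and n: "0 < n"
  then obtain n0 where n0: "\<not> (\<exists>T\<in>P. \<exists>c d w. cyclic_chain T n0 c d w)"
    using block_tournaments_subset_if_cyclic_chains[OF P] by blast
  \<comment> \<open>\<open>n0\<close> rules out the cyclic chain and \<open>n\<close> is the desired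
    length; words of length \<open>?m\<close> restrict to words of length \<open>n\<close>.\<close>
  let ?m = "max n n0"
  have "0 < ?m"
    using n by simp
  from rich_or_cyclic_chain_if_many_blocks[OF this] obtain N
    where N: "\<forall>P. \<forall>T\<in>P. hereditary P \<longrightarrow> N \<le> card (blocks T) \<longrightarrow> rich P ?m \<or> (\<exists>c d w. cyclic_chain T ?m c d w)" ..
  obtain T where T: "T \<in> P" "N \<le> card (blocks T)"
    using unbounded by blast
  have "\<not> cyclic_chain T ?m c d w" for c d w
    using cyclic_chain_le[of T ?m c d w n0] n0 T(1) by auto
  then have "rich P ?m"
    using N P T by blast
  then obtain F where F: "word_family F" "\<And>W. word_tournament F W ?m \<in> P"
    unfolding rich_def by blast
  have "word_tournament F W n \<in> P" for W
    by (rule word_tournament_le[OF P F(2)]) simp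
  then show "2 ^ (n - 1) \<le> n * speed P n"
    by (rule power2_le_speed[OF P F(1) _ n])
qed

subsection \<open>The sequence \<open>Fstar\<close>\<close>

lemma Fstar_pos: "0 < Fstar n"
  by (induction n rule: Fstar.induct) simp_all

text \<open>With the recursion this bounds the growth of \<open>Fstar\<close> by a factor 3/2 per
  step from index 3 on. As \<open>n + 1 \<le> 4/3 * n\<close> there, \<open>n * Fstar n\<close> at
  most doubles.\<close>

lemma twice_Fstar_le: "2 * Fstar (Suc n) \<le> Fstar (Suc (Suc (Suc n)))"
  by (induction n rule: Fstar.induct) simp_all

lemma mult_Fstar_le: "7 \<le> n \<Longrightarrow> n * Fstar n \<le> 2 ^ (n - 1)"
proof (induction n rule: nat_induct_at_least)
  \<comment> \<open>The start is tight: \<open>7 * 9 = 63 \<le> 64\<close>.\<close>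
  case base
  then show ?case
    by (simp add: numeral_eq_Suc)
next
  case (Suc n)
  have "n = Suc (Suc (Suc (n - 3)))"
    using Suc.hyps by simp
  then obtain j where j: "n = Suc (Suc (Suc j))"
    by blast
  have "2 * Fstar (Suc n) \<le> 3 * Fstar n"
    using twice_Fstar_le[of j] by (simp add: j)
  then have "Suc n * (2 * Fstar (Suc n)) \<le> Suc n * (3 * Fstar n)"
    by (rule mult_le_mono2)
  also have "\<dots> = (Suc n * 3) * Fstar n"
    by (simp only: mult.assoc)
  also have "\<dots> \<le> (4 * n) * Fstar n"
    using Suc.hyps by (intro mult_le_mono1) simp
  also have "\<dots> \<le> 4 * 2 ^ (n - 1)"
    using Suc.IH by simp
  also have "\<dots> = 2 * 2 ^ (Suc n - 1)"
    using j by simp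
  finally show ?case
    by simp
qed

text \<open>For \<open>n\<close> = 1, 2, 3, 5, 6, rounding up the quotient of
  \<open>2 ^ (n - 1)\<close> by \<open>n\<close> gives 1, 1, 2, 4, 6, exactly the values of
  \<open>Fstar\<close>.\<close>

lemma Fstar_le_if_exponential:
  assumes "2 ^ (n - 1) \<le> n * s" "n > 0" "n \<noteq> 4"
  shows "Fstar n \<le> s"
proof (cases "7 \<le> n")
  case True
  then have "n * Fstar n \<le> n * s"
    using mult_Fstar_le assms(1) by (meson le_trans)
  then show ?thesis
    using assms(2) by simp
next
  case False
  then consider "n = 1" | "n = 2" | "n = 3" | "n = 5" | "n = 6"
    using assms(2,3) by linarith
  then show ?thesis
    using assms(1) by cases (simp_all add: numeral_eq_Suc)
qed

text \<open>By monotonicity the recursion at least doubles \<open>Fstar\<close> every three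
  steps.\<close>

lemma power2_le_Fstar: "2 ^ m \<le> Fstar (3 * m)"
proof (induction m)
  case (Suc m)
  have "Fstar n \<le> Fstar (Suc n)" for n
    by (induction n rule: Fstar.induct) simp_all
  then have "Fstar (3 * m) \<le> Fstar (Suc (Suc (3 * m)))"
    using le_trans by blast
  then have "2 * Fstar (3 * m) \<le> Fstar (Suc (Suc (Suc (3 * m))))"
    by simp
  also have "Suc (Suc (Suc (3 * m))) = 3 * Suc m"
    by simp
  finally have "2 * Fstar (3 * m) \<le> Fstar (3 * Suc m)" .
  with Suc show ?case by simp
qed simp

lemma Fstar_not_polynomial: "(\<lambda>n. real (Fstar n)) \<notin> O(\<lambda>n. real n ^ k)"
proof
  assume "(\<lambda>n. real (Fstar n)) \<in> O(\<lambda>n. real n ^ k)"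
  then obtain c where c: "c > 0" "\<forall>\<^sub>F n in sequentially. norm (real (Fstar n)) \<le> c * norm (real n ^ k)"
    by (rule landau_o.bigE)
  \<comment> \<open>Chosen so that \<open>c * (3 * m) ^ k\<close> becomes
    \<open>?a * (m * ln 2) ^ k\<close>, which is compared with
    \<open>exp (m * ln 2) = 2 ^ m\<close>.\<close>
  let ?a = "c * (3 / ln 2) ^ k"
  have a: "?a > 0"
    using c(1) by simp
  have lim: "filterlim (\<lambda>m. real m * ln 2) at_top sequentially"
    by (rule filterlim_at_top_mult_tendsto_pos[OF tendsto_const _ filterlim_real_sequentially, of "ln 2", simplified mult.commute]) simp
  have "((\<lambda>m. (real m * ln 2) ^ k / exp (real m * ln 2)) \<longlongrightarrow> 0) sequentially"
    by (rule filterlim_compose[OF tendsto_power_div_exp_0 lim])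
  then have "\<forall>\<^sub>F m in sequentially. (real m * ln 2) ^ k / exp (real m * ln 2) < 1 / ?a"
    by (rule order_tendstoD) (use a in simp)
  moreover have "\<forall>\<^sub>F m in sequentially. norm (real (Fstar (3 * m))) \<le> c * norm (real (3 * m) ^ k)"
    using c(2) by (rule eventually_compose_filterlim) (rule filterlim_subseq, simp add: strict_mono_def)
  ultimately have "\<forall>\<^sub>F m in sequentially. False"
  proof eventually_elim
    case (elim m)
    have e: "exp (real m * ln 2) = 2 ^ m"
      by (simp add: exp_of_nat_mult)
    have "(2::real) ^ m \<le> real (Fstar (3 * m))"
      using power2_le_Fstar[of m] by (metis of_nat_le_iff of_nat_numeral of_nat_power)
    also have "\<dots> \<le> c * (3 * real m) ^ k"
      using elim(2) by simp
    also have "\<dots> = ?a * (real m * ln 2) ^ k"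
      by (simp add: power_mult_distrib power_divide)
    also have "\<dots> < 2 ^ m"
      using elim(1) a unfolding e by (simp add: field_simps)
    finally show False by simp
  qed
  then show False by simp
qed

section \<open>Uniqueness of the extremal property and the dichotomy\<close>

lemma block_tournaments_unique:
  assumes P: "hereditary P" and speed: "\<And>n. speed P n = Fstar n"
  shows "P = block_tournaments"
proof -
  have "\<not> (\<forall>\<^sub>F n in sequentially. level P n = {})"
  proof
    assume "\<forall>\<^sub>F n in sequentially. level P n = {}"
    then obtain n where "level P n = {}"
      by (auto simp: eventually_sequentially)
    then have "speed P n = 0"
      by (simp add: speed_def)
    with speed[of n] Fstar_pos[of n] show False by simp
  qed
  moreover have "(\<lambda>n. real (speed P n)) \<notin> \<Theta>(\<lambda>n. real n ^ k)" for k
    using Fstar_not_polynomial[of k] unfolding speed bigtheta_def by blast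
  ultimately have "\<exists>T\<in>P. K \<le> card (blocks T)" for K
    using polynomial_speed_if_boundedly_many_blocks[OF P, of K] by (meson linorder_le_cases)
  from block_tournaments_or_exponential[OF P this] have "block_tournaments \<subseteq> P"
  proof
    assume "\<forall>n>0. 2 ^ (n - 1) \<le> n * speed P n"
    \<comment> \<open>This instance would read \<open>64 \<le> 7 * 9\<close>.\<close>
    from this[rule_format, of 7] have False
      by (simp add: speed numeral_eq_Suc)
    then show ?thesis ..
  qed
  then show ?thesis
    using eq_if_speed_eq[OF hereditary_block_tournaments P] speed speed_block_tournaments by simp
qed

lemma Fstar_le_speed_if_many_blocks:
  assumes P: "hereditary P" and unbounded: "\<And>K. \<exists>T\<in>P. K \<le> card (blocks T)" and n: "n \<noteq> 4"
  shows "Fstar n \<le> speed P n"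
  using block_tournaments_or_exponential[OF P unbounded]
proof
  assume "block_tournaments \<subseteq> P"
  then show ?thesis
    using speed_mono[OF P, of block_tournaments n] by (simp add: speed_block_tournaments)
next
  assume exp: "\<forall>n>0. 2 ^ (n - 1) \<le> n * speed P n"
  show ?thesis
  \<comment> \<open>The exponential bound starts at 1. For 0, the empty sub-tournament of any member
    provides the one class required.\<close>
  proof (cases "n = 0")
    case True
    obtain T where T: "T \<in> P"
      using unbounded by blast
    have "T \<restriction>\<^sub>T {} \<in> P"
      by (rule hereditary_restrict[OF P T]) simp
    then have "level P 0 \<noteq> {}"
      unfolding level_empty_iff by force
    then show ?thesis
      using finite_level[OF P, of 0] True by (simp add: speed_def Suc_le_eq card_gt_0_iff)
  next
    case False
    then show ?thesis
      using Fstar_le_if_exponential[of n "speed P n"] exp n by simp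
  qed
qed

theorem theorem1:
  shows "(\<forall>P. hereditary P \<longrightarrow>
            (\<forall>\<^sub>F n in sequentially. level P n = {}) \<or>
            (\<exists>k::nat. (\<lambda>n. real (speed P n)) \<in> \<Theta>(\<lambda>n. real n ^ k)) \<or>
            (\<forall>n. n \<noteq> 4 \<longrightarrow> speed P n \<ge> Fstar n))
       \<and> (\<exists>P. hereditary P \<and>
            \<not> (\<exists>k::nat. (\<lambda>n. real (speed P n)) \<in> \<Theta>(\<lambda>n. real n ^ k)) \<and>
            (\<forall>n. speed P n = Fstar n))
       \<and> (\<forall>P. hereditary P \<and> (\<forall>n. speed P n = Fstar n) \<longleftrightarrow> P = block_tournaments)"
proof (intro conjI allI impI)
  fix P assume P: "hereditary P"
  show "(\<forall>\<^sub>F n in sequentially. level P n = {}) \<or>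
            (\<exists>k::nat. (\<lambda>n. real (speed P n)) \<in> \<Theta>(\<lambda>n. real n ^ k)) \<or>
            (\<forall>n. n \<noteq> 4 \<longrightarrow> speed P n \<ge> Fstar n)"
  proof (cases "\<forall>K. \<exists>T\<in>P. K \<le> card (blocks T)")
    case True
    then show ?thesis
      using Fstar_le_speed_if_many_blocks[OF P] by blast
  next
    case False
    then obtain K where "\<And>T. T \<in> P \<Longrightarrow> card (blocks T) \<le> K"
      by (meson linorder_le_cases)
    then show ?thesis
      using polynomial_speed_if_boundedly_many_blocks[OF P] by blast
  qed
next
  have "(\<lambda>n. real (speed block_tournaments n)) \<notin> \<Theta>(\<lambda>n. real n ^ k)" for k
    using Fstar_not_polynomial[of k] unfolding speed_block_tournaments bigtheta_def by blast
  then show "\<exists>P. hereditary P \<and>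
            \<not> (\<exists>k::nat. (\<lambda>n. real (speed P n)) \<in> \<Theta>(\<lambda>n. real n ^ k)) \<and>
            (\<forall>n. speed P n = Fstar n)"
    using hereditary_block_tournaments speed_block_tournaments by blast
next
  fix P
  show "hereditary P \<and> (\<forall>n. speed P n = Fstar n) \<longleftrightarrow> P = block_tournaments"
    using block_tournaments_unique hereditary_block_tournaments speed_block_tournaments by blast
qed

end
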